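(* Let $k$ be an algebraically closed field of characteristic zero and let $n\geq 3$ be odd. Let $R$ be a semisimple braided Hopf algebra over $G=D_n$ (the dihedral group of order $2n$) with $\dim R=n+1$. Then $\operatorname{Supp}(R)\subseteq T$, where $T\simeq\mathbb Z_n$ is the subgroup of rotations in $D_n$. Therefore, $R\# kT$ is a Hopf subalgebra of $R\# kD_n$ of index $2$. In particular, $R\# kT$ is normal in $R\# kD_n$.
   Context: For a finite group $G$, a (semisimple) braided Hopf algebra over $G$ is a (semisimple, as an algebra) Hopf algebra $R$ in the braided category ${}^{kG}_{kG}\mathcal{YD}$ of Yetter–Drinfeld modules over $kG$: $R$ is an algebra and a coalgebra in this category, the comultiplication $\Delta_R(a)=a^{(1)}\otimes a^{(2)}$ satisfies $\Delta_R(ab)=a^{(1)}((a^{(2)})_{-1}.b^{(1)})\otimes (a^{(2)})_0b^{(2)}$, and $\mathrm{id}_R$ has a convolution inverse (antipode). The coaction $\rho:R\to kG\otimes R$, $\rho(a)=a_{-1}\otimes a_0$, gives a grading $R=\bigoplus_{g\in G}R_g$, $R_g=\{r\in R:\rho(r)=g\otimes r\}$, which is both an algebra and a coalgebra grading; $G$ acts on $R$ by algebra and coalgebra automorphisms with $h.R_g=R_{hgh^{-1}}$. The support is $\operatorname{Supp}(R)=\{g\in G:R_g\neq 0\}$. $R\# kG$ denotes the Radford–Majid biproduct: the vector space $R\otimes kG$ with $(a\# g)(b\# h)=a(g.b)\# gh$ and $\Delta(a\# g)=a^{(1)}\#(a^{(2)})_{-1}g\otimes (a^{(2)})_0\# g$,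 for $a,b\in R$, $g,h\in G$. For a subgroup $T\subseteq G$, $R\# kT$ is the subspace $R\otimes kT$ of $R\# kG$. The index of a Hopf subalgebra $K\subseteq H$ is $\dim H/\dim K$; $K$ is normal if it is stable under the left adjoint action of $H$. *)

theory Defs
  imports
    "HOL-Algebra.Elementary_Groups"
    "HOL-Computational_Algebra.Polynomial"
    "HOL-Library.Function_Algebras"
begin

section \<open>Vector spaces and tensor products\<close>

text \<open>
  A vector space over the field \<open>'k\<close> is a subspace \<open>carrier V\<close> of a type \<open>'v\<close> on which \<open>scl V\<close> is a
  scalar multiplication. Addition is that of the type; on function types it is pointwise.
\<close>

record ('k, 'v) vspace = "'v partial_object" +
  scl :: "'k \<Rightarrow> 'v \<Rightarrow> 'v"

definition is_vspace :: "('k::field, 'v::ab_group_add, 'm) vspace_scheme \<Rightarrow> bool" where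
  "is_vspace V \<longleftrightarrow> vector_space (scl V) \<and> module.subspace (scl V) (carrier V)"

definition vdim :: "('k::field, 'v::ab_group_add, 'm) vspace_scheme \<Rightarrow> nat" where
  "vdim V = vector_space.dim (scl V) (carrier V)"

definition linear_map ::
  "('k::field, 'v::ab_group_add, 'm) vspace_scheme \<Rightarrow>
   ('k, 'w::ab_group_add, 'n) vspace_scheme \<Rightarrow> ('v \<Rightarrow> 'w) \<Rightarrow> bool" where
  "linear_map V W f \<longleftrightarrow> f \<in> carrier V \<rightarrow> carrier W \<and>
     (\<forall>x\<in>carrier V. \<forall>y\<in>carrier V. f (x + y) = f x + f y) \<and>
     (\<forall>c. \<forall>x\<in>carrier V. f (scl V c x) = scl W c (f x))"

definition bilinear_map ::
  "('k::field, 'v::ab_group_add, 'm) vspace_scheme \<Rightarrow>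
   ('k, 'w::ab_group_add, 'n) vspace_scheme \<Rightarrow>
   ('k, 'u::ab_group_add, 'l) vspace_scheme \<Rightarrow> ('v \<Rightarrow> 'w \<Rightarrow> 'u) \<Rightarrow> bool" where
  "bilinear_map V W U \<mu> \<longleftrightarrow>
     (\<forall>v\<in>carrier V. linear_map W U (\<mu> v)) \<and>
     (\<forall>w\<in>carrier W. linear_map V U (\<lambda>v. \<mu> v w))"

definition base :: "('k::field, 'k) vspace" where
  "base = \<lparr>carrier = UNIV, scl = (*)\<rparr>"

definition fscale :: "'k::field \<Rightarrow> ('a \<Rightarrow> 'k) \<Rightarrow> ('a \<Rightarrow> 'k)" where
  "fscale c f = (\<lambda>x. c * f x)"

text \<open>
  The tensor product is realised inside the dual of the space of bilinear forms: \<open>v \<otimes> w\<close> is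
  evaluation at \<open>(v, w)\<close>, and \<open>V \<otimes> W\<close> is the span of these elements. The forms range over the whole
  ambient types. As bilinear forms extend from subspaces, this does not change the tensor product,
  and for subspaces \<open>V' \<subseteq> V\<close>, \<open>W' \<subseteq> W\<close> the space \<open>V' \<otimes> W'\<close> is literally a subspace of \<open>V \<otimes> W\<close>.
\<close>

type_synonym ('k, 'v, 'w) tensor = "('v \<Rightarrow> 'w \<Rightarrow> 'k) \<Rightarrow> 'k"

definition tens ::
  "('k::field, 'v::ab_group_add, 'm) vspace_scheme \<Rightarrow>
   ('k, 'w::ab_group_add, 'n) vspace_scheme \<Rightarrow> 'v \<Rightarrow> 'w \<Rightarrow> ('k, 'v, 'w) tensor" where
  "tens V W v w =
     (\<lambda>\<beta>. if bilinear_map (V\<lparr>carrier := UNIV\<rparr>) (W\<lparr>carrier := UNIV\<rparr>) base \<beta> then \<beta> v w else 0)"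

definition tensor ::
  "('k::field, 'v::ab_group_add, 'm) vspace_scheme \<Rightarrow>
   ('k, 'w::ab_group_add, 'n) vspace_scheme \<Rightarrow> ('k, ('k, 'v, 'w) tensor) vspace" where
  "tensor V W =
     \<lparr>carrier = module.span fscale {tens V W v w |v w. v \<in> carrier V \<and> w \<in> carrier W},
      scl = fscale\<rparr>"

text \<open>
  The linear map on \<open>V \<otimes> W\<close> induced by a bilinear map \<open>\<mu>\<close>: it sends \<open>\<Sum>\<^sub>i v\<^sub>i \<otimes> w\<^sub>i\<close> to \<open>\<Sum>\<^sub>i \<mu> v\<^sub>i w\<^sub>i\<close>
  (well-defined by \<open>tlift_sum\<close> below). Sweedler notation is rendered with it: for
  \<open>\<Delta> a = a\<^sub>1 \<otimes> a\<^sub>2\<close>, the expression \<open>\<mu>(a\<^sub>1, a\<^sub>2)\<close> is \<open>tlift V W (\<lambda>a\<^sub>1 a\<^sub>2. \<mu> a\<^sub>1 a\<^sub>2) (\<Delta> a)\<close>.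
\<close>

definition tlift ::
  "('k::field, 'v::ab_group_add, 'm) vspace_scheme \<Rightarrow>
   ('k, 'w::ab_group_add, 'n) vspace_scheme \<Rightarrow>
   ('v \<Rightarrow> 'w \<Rightarrow> 'u::ab_group_add) \<Rightarrow> ('k, 'v, 'w) tensor \<Rightarrow> 'u" where
  "tlift V W \<mu> t = (THE u. \<exists>ps. set ps \<subseteq> carrier V \<times> carrier W \<and>
     t = (\<Sum>(v, w)\<leftarrow>ps. tens V W v w) \<and> u = (\<Sum>(v, w)\<leftarrow>ps. \<mu> v w))"

lemma vspace_projection:
  assumes "is_vspace V"
  shows "\<exists>p. linear_map (V\<lparr>carrier := UNIV\<rparr>) V p \<and> (\<forall>v\<in>carrier V. p v = v)"
proof -
  interpret V: vector_space "scl V" using assms by (simp add: is_vspace_def)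
  interpret VV: vector_space_pair "scl V" "scl V" ..
  have sub: "V.subspace (carrier V)" using assms by (simp add: is_vspace_def)
  have "Vector_Spaces.linear (scl V) (scl V) id" by (rule V.linear_id)
  from VV.linear_exists_left_inverse_on[OF this sub]
  obtain p where p: "range p \<subseteq> carrier V" "Vector_Spaces.linear (scl V) (scl V) p"
    "\<forall>v\<in>carrier V. p v = v" by auto
  interpret p: Vector_Spaces.linear "scl V" "scl V" p by fact
  show ?thesis using p(1,3) by (intro exI[of _ p]) (auto simp: linear_map_def p.add p.scale)
qed

lemma separating_functional:
  assumes "is_vspace (U :: ('k::field, 'u::ab_group_add, 'm) vspace_scheme)" and "d \<noteq> 0"
  shows "\<exists>\<phi>. linear_map (U\<lparr>carrier := UNIV\<rparr>) base \<phi> \<and> \<phi> d \<noteq> 0"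
proof -
  interpret U: vector_space "scl U" using assms by (simp add: is_vspace_def)
  interpret K: vector_space "(*) :: 'k \<Rightarrow> 'k \<Rightarrow> 'k"
    by unfold_locales (auto simp: algebra_simps)
  interpret UK: vector_space_pair "scl U" "(*) :: 'k \<Rightarrow> 'k \<Rightarrow> 'k" ..
  have "U.independent {d}" using assms(2) by simp
  from UK.linear_independent_extend[OF this, of "\<lambda>_. 1"]
  obtain \<phi> where \<phi>: "Vector_Spaces.linear (scl U) (*) \<phi>" "\<phi> d = 1" by auto
  interpret \<phi>: Vector_Spaces.linear "scl U" "(*)" \<phi> by fact
  show ?thesis using \<phi>(2) by (intro exI[of _ \<phi>]) (auto simp: linear_map_def base_def \<phi>.add \<phi>.scale)
qed

lemma linear_map_add: "linear_map V W f \<Longrightarrow> x \<in> carrier V \<Longrightarrow> y \<in> carrier V \<Longrightarrow> f (x + y) = f x + f y"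
  and linear_map_scl: "linear_map V W f \<Longrightarrow> x \<in> carrier V \<Longrightarrow> f (scl V c x) = scl W c (f x)"
  and linear_map_mem: "linear_map V W f \<Longrightarrow> x \<in> carrier V \<Longrightarrow> f x \<in> carrier W"
  by (auto simp: linear_map_def)

lemma tens_sum_apply:
  "bilinear_map (V\<lparr>carrier := UNIV\<rparr>) (W\<lparr>carrier := UNIV\<rparr>) base \<beta> \<Longrightarrow>
    (\<Sum>(v, w)\<leftarrow>ps. tens V W v w) \<beta> = (\<Sum>(v, w)\<leftarrow>ps. \<beta> v w)"
  by (induction ps) (auto simp: tens_def)

lemma linear_map_sum_list:
  assumes "linear_map (U\<lparr>carrier := UNIV\<rparr>) (base :: ('k::field, 'k) vspace) \<phi>"
  shows "\<phi> (\<Sum>x\<leftarrow>xs. f x) = (\<Sum>x\<leftarrow>xs. \<phi> (f x))"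
proof -
  have add: "\<phi> (x + y) = \<phi> x + \<phi> y" for x y using linear_map_add[OF assms] by simp
  have "\<phi> 0 = 0" using add[of 0 0] by (metis add_0 add_right_cancel)
  then show ?thesis by (induction xs) (auto simp: add)
qed

theorem tlift_sum:
  fixes U :: "('k::field, 'u::ab_group_add, 'l) vspace_scheme"
  assumes V: "is_vspace V" and W: "is_vspace W" and U: "is_vspace U"
    and \<mu>: "bilinear_map V W U \<mu>" and ps: "set ps \<subseteq> carrier V \<times> carrier W"
  shows "tlift V W \<mu> (\<Sum>(v, w)\<leftarrow>ps. tens V W v w) = (\<Sum>(v, w)\<leftarrow>ps. \<mu> v w)"
proof -
  have "(\<Sum>(v, w)\<leftarrow>qs. \<mu> v w) = (\<Sum>(v, w)\<leftarrow>ps. \<mu> v w)"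
    if qs: "set qs \<subseteq> carrier V \<times> carrier W"
      and eq: "(\<Sum>(v, w)\<leftarrow>ps. tens V W v w) = (\<Sum>(v, w)\<leftarrow>qs. tens V W v w)" for qs
  proof (rule ccontr)
    define d where "d = (\<Sum>(v, w)\<leftarrow>qs. \<mu> v w) - (\<Sum>(v, w)\<leftarrow>ps. \<mu> v w)"
    assume "\<not> ?thesis"
    then have "d \<noteq> 0" by (simp add: d_def)
    from separating_functional[OF U this] obtain \<phi>
      where \<phi>: "linear_map (U\<lparr>carrier := UNIV\<rparr>) base \<phi>" and "\<phi> d \<noteq> 0" by blast
    from vspace_projection[OF V] obtain p
      where p: "linear_map (V\<lparr>carrier := UNIV\<rparr>) V p" "\<And>v. v \<in> carrier V \<Longrightarrow> p v = v" by blast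
    from vspace_projection[OF W] obtain q
      where q: "linear_map (W\<lparr>carrier := UNIV\<rparr>) W q" "\<And>w. w \<in> carrier W \<Longrightarrow> q w = w" by blast
    define \<beta> where "\<beta> = (\<lambda>v w. \<phi> (\<mu> (p v) (q w)))"
    note [simp] = linear_map_add[OF \<phi>, simplified] linear_map_scl[OF \<phi>, simplified]
      linear_map_add[OF p(1), simplified] linear_map_scl[OF p(1), simplified]
      linear_map_mem[OF p(1), simplified]
      linear_map_add[OF q(1), simplified] linear_map_scl[OF q(1), simplified]
      linear_map_mem[OF q(1), simplified]
    have \<mu>1: "linear_map W U (\<mu> v)" if "v \<in> carrier V" for v
      using \<mu> that by (simp add: bilinear_map_def)
    have \<mu>2: "linear_map V U (\<lambda>v. \<mu> v w)" if "w \<in> carrier W" for w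
      using \<mu> that by (simp add: bilinear_map_def)
    have \<beta>: "bilinear_map (V\<lparr>carrier := UNIV\<rparr>) (W\<lparr>carrier := UNIV\<rparr>) base \<beta>"
      by (auto simp: bilinear_map_def linear_map_def[of "V\<lparr>carrier := UNIV\<rparr>"]
          linear_map_def[of "W\<lparr>carrier := UNIV\<rparr>"] \<beta>_def base_def
          linear_map_add[OF \<mu>1] linear_map_add[OF \<mu>2] linear_map_scl[OF \<mu>1] linear_map_scl[OF \<mu>2])
    have *: "(\<Sum>(v, w)\<leftarrow>xs. tens V W v w) \<beta> = \<phi> (\<Sum>(v, w)\<leftarrow>xs. \<mu> v w)"
      if "set xs \<subseteq> carrier V \<times> carrier W" for xs
    proof -
      have "(\<Sum>(v, w)\<leftarrow>xs. \<beta> v w) = (\<Sum>(v, w)\<leftarrow>xs. \<phi> (\<mu> v w))"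
        using that by (intro arg_cong[of _ _ sum_list] map_cong) (auto simp: \<beta>_def p(2) q(2))
      then show ?thesis
        using tens_sum_apply[OF \<beta>, of xs] linear_map_sum_list[OF \<phi>, of "case_prod \<mu>" xs]
        by (simp add: case_prod_unfold)
    qed
    have "\<phi> (\<Sum>(v, w)\<leftarrow>qs. \<mu> v w) = \<phi> (\<Sum>(v, w)\<leftarrow>ps. \<mu> v w)"
      using *[OF qs] *[OF ps] eq by simp
    moreover have "\<phi> (\<Sum>(v, w)\<leftarrow>qs. \<mu> v w) = \<phi> d + \<phi> (\<Sum>(v, w)\<leftarrow>ps. \<mu> v w)"
      using linear_map_add[OF \<phi>, of d "\<Sum>(v, w)\<leftarrow>ps. \<mu> v w"] by (simp add: d_def)
    ultimately show False using \<open>\<phi> d \<noteq> 0\<close> by simp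
  qed
  then show ?thesis unfolding tlift_def using ps by (intro the_equality) blast+
qed


section \<open>Algebras, coalgebras, Hopf algebras\<close>

record ('k, 'v) bialg = "('k, 'v) vspace" +
  amult :: "'v \<Rightarrow> 'v \<Rightarrow> 'v" (infixl \<open>\<bullet>\<index>\<close> 70)
  aunit :: "'v"
  comult :: "'v \<Rightarrow> ('k, 'v, 'v) tensor"
  counit :: "'v \<Rightarrow> 'k"

definition unital_algebra :: "('k::field, 'v::ab_group_add, 'm) bialg_scheme \<Rightarrow> bool" where
  "unital_algebra A \<longleftrightarrow> is_vspace A \<and> bilinear_map A A A (amult A) \<and> aunit A \<in> carrier A \<and>
     (\<forall>a\<in>carrier A. \<forall>b\<in>carrier A. \<forall>c\<in>carrier A. (a \<bullet>\<^bsub>A\<^esub> b) \<bullet>\<^bsub>A\<^esub> c = a \<bullet>\<^bsub>A\<^esub> (b \<bullet>\<^bsub>A\<^esub> c)) \<and>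
     (\<forall>a\<in>carrier A. aunit A \<bullet>\<^bsub>A\<^esub> a = a \<and> a \<bullet>\<^bsub>A\<^esub> aunit A = a)"

definition left_ideal :: "('k::field, 'v::ab_group_add, 'm) bialg_scheme \<Rightarrow> 'v set \<Rightarrow> bool" where
  "left_ideal A L \<longleftrightarrow> module.subspace (scl A) L \<and> L \<subseteq> carrier A \<and>
     (\<forall>a\<in>carrier A. \<forall>x\<in>L. a \<bullet>\<^bsub>A\<^esub> x \<in> L)"

definition simple_left_ideal :: "('k::field, 'v::ab_group_add, 'm) bialg_scheme \<Rightarrow> 'v set \<Rightarrow> bool"
  where
  "simple_left_ideal A L \<longleftrightarrow> left_ideal A L \<and> L \<noteq> {0} \<and>
     (\<forall>L'. left_ideal A L' \<and> L' \<subseteq> L \<longrightarrow> L' = {0} \<or> L' = L)"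

text \<open>The left regular module is an (internal) direct sum of simple submodules.\<close>

definition semisimple_algebra :: "('k::field, 'v::ab_group_add, 'm) bialg_scheme \<Rightarrow> bool" where
  "semisimple_algebra A \<longleftrightarrow> unital_algebra A \<and>
     (\<exists>M. (\<forall>L\<in>M. simple_left_ideal A L) \<and>
          module.span (scl A) (\<Union>M) = carrier A \<and>
          (\<forall>L\<in>M. L \<inter> module.span (scl A) (\<Union>(M - {L})) = {0}))"

definition coalgebra :: "('k::field, 'v::ab_group_add, 'm) bialg_scheme \<Rightarrow> bool" where
  "coalgebra C \<longleftrightarrow> is_vspace C \<and>
     linear_map C (tensor C C) (comult C) \<and> linear_map C base (counit C) \<and>
     (\<forall>a\<in>carrier C.
        tlift C C (\<lambda>x y. tlift C C (\<lambda>x\<^sub>1 x\<^sub>2. tens C (tensor C C) x\<^sub>1 (tens C C x\<^sub>2 y)) (comult C x))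
          (comult C a) =
        tlift C C (\<lambda>x y. tens C (tensor C C) x (comult C y)) (comult C a)) \<and>
     (\<forall>a\<in>carrier C.
        tlift C C (\<lambda>x y. scl C (counit C x) y) (comult C a) = a \<and>
        tlift C C (\<lambda>x y. scl C (counit C y) x) (comult C a) = a)"

text \<open>A convolution inverse of the identity map.\<close>

definition is_antipode :: "('k::field, 'v::ab_group_add, 'm) bialg_scheme \<Rightarrow> ('v \<Rightarrow> 'v) \<Rightarrow> bool" where
  "is_antipode H S \<longleftrightarrow> linear_map H H S \<and>
     (\<forall>a\<in>carrier H.
        tlift H H (\<lambda>x y. x \<bullet>\<^bsub>H\<^esub> S y) (comult H a) = scl H (counit H a) (aunit H) \<and>
        tlift H H (\<lambda>x y. S x \<bullet>\<^bsub>H\<^esub> y) (comult H a) = scl H (counit H a) (aunit H))"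

definition hopf_algebra :: "('k::field, 'v::ab_group_add, 'm) bialg_scheme \<Rightarrow> bool" where
  "hopf_algebra H \<longleftrightarrow> unital_algebra H \<and> coalgebra H \<and>
     (\<forall>a\<in>carrier H. \<forall>b\<in>carrier H.
        comult H (a \<bullet>\<^bsub>H\<^esub> b) =
          tlift H H (\<lambda>a\<^sub>1 a\<^sub>2. tlift H H (\<lambda>b\<^sub>1 b\<^sub>2. tens H H (a\<^sub>1 \<bullet>\<^bsub>H\<^esub> b\<^sub>1) (a\<^sub>2 \<bullet>\<^bsub>H\<^esub> b\<^sub>2)) (comult H b))
            (comult H a) \<and>
        counit H (a \<bullet>\<^bsub>H\<^esub> b) = counit H a * counit H b) \<and>
     comult H (aunit H) = tens H H (aunit H) (aunit H) \<and> counit H (aunit H) = 1 \<and>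
     (\<exists>S. is_antipode H S)"

text \<open>Determined by \<open>H\<close> on \<open>carrier H\<close>, the only place where it is used.\<close>

definition antipode :: "('k::field, 'v::ab_group_add, 'm) bialg_scheme \<Rightarrow> 'v \<Rightarrow> 'v" where
  "antipode H = (SOME S. is_antipode H S)"

definition hopf_subalgebra :: "'v set \<Rightarrow> ('k::field, 'v::ab_group_add, 'm) bialg_scheme \<Rightarrow> bool"
  where
  "hopf_subalgebra K H \<longleftrightarrow> hopf_algebra H \<and> module.subspace (scl H) K \<and> K \<subseteq> carrier H \<and>
     aunit H \<in> K \<and> (\<forall>a\<in>K. \<forall>b\<in>K. a \<bullet>\<^bsub>H\<^esub> b \<in> K) \<and>
     (\<forall>a\<in>K. comult H a \<in> carrier (tensor (H\<lparr>carrier := K\<rparr>) (H\<lparr>carrier := K\<rparr>))) \<and>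
     (\<forall>a\<in>K. antipode H a \<in> K)"

definition hopf_index :: "('k::field, 'v::ab_group_add, 'm) bialg_scheme \<Rightarrow> 'v set \<Rightarrow> rat" where
  "hopf_index H K = of_nat (vdim H) / of_nat (vdim (H\<lparr>carrier := K\<rparr>))"

text \<open>Stability under the left adjoint action \<open>h \<cdot> k = h\<^sub>1 k S(h\<^sub>2)\<close>.\<close>

definition normal_hopf_subalgebra ::
  "'v set \<Rightarrow> ('k::field, 'v::ab_group_add, 'm) bialg_scheme \<Rightarrow> bool" where
  "normal_hopf_subalgebra K H \<longleftrightarrow> hopf_subalgebra K H \<and>
     (\<forall>h\<in>carrier H. \<forall>k\<in>K.
        tlift H H (\<lambda>h\<^sub>1 h\<^sub>2. h\<^sub>1 \<bullet>\<^bsub>H\<^esub> k \<bullet>\<^bsub>H\<^esub> antipode H h\<^sub>2) (comult H h) \<in> K)"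


section \<open>The group algebra of a finite group\<close>

definition gel :: "'g \<Rightarrow> 'g \<Rightarrow> 'k::field" where
  "gel g = (\<lambda>x. if x = g then 1 else 0)"

definition functions_on :: "'g set \<Rightarrow> ('k::field, 'g \<Rightarrow> 'k) vspace" where
  "functions_on X = \<lparr>carrier = {f. \<forall>x. x \<notin> X \<longrightarrow> f x = 0}, scl = fscale\<rparr>"

definition group_algebra :: "('g, 'm) monoid_scheme \<Rightarrow> ('k::field, 'g \<Rightarrow> 'k) bialg" where
  "group_algebra G =
     \<lparr>carrier = carrier (functions_on (carrier G)),
      scl = fscale,
      amult = (\<lambda>f h. \<Sum>x\<in>carrier G. \<Sum>y\<in>carrier G. fscale (f x * h y) (gel (x \<otimes>\<^bsub>G\<^esub> y))),
      aunit = gel \<one>\<^bsub>G\<^esub>,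
      comult = (\<lambda>f. \<Sum>x\<in>carrier G. 
        fscale (f x) (tens (functions_on (carrier G)) (functions_on (carrier G)) (gel x) (gel x))),
      counit = (\<lambda>f. \<Sum>x\<in>carrier G. f x)\<rparr>"


section \<open>Braided Hopf algebras in the category of Yetter-Drinfeld modules\<close>

record ('k, 'v, 'g) braided = "('k, 'v) bialg" +
  act :: "'g \<Rightarrow> 'v \<Rightarrow> 'v"
  coact :: "'v \<Rightarrow> ('k, 'g \<Rightarrow> 'k, 'v) tensor"

definition kact :: "('g, 'n) monoid_scheme \<Rightarrow> ('k::field, 'v::ab_group_add, 'g, 'm) braided_scheme \<Rightarrow>
    ('g \<Rightarrow> 'k) \<Rightarrow> 'v \<Rightarrow> 'v" where
  "kact G R x a = (\<Sum>g\<in>carrier G. scl R (x g) (act R g a))"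

text \<open>
  The action, the coaction \<open>\<rho> a = a\<^sub>-\<^sub>1 \<otimes> a\<^sub>0\<close> (coassociative and counital), and their compatibility
  \<open>\<rho> (g.a) = g a\<^sub>-\<^sub>1 g\<^sup>-\<^sup>1 \<otimes> g.a\<^sub>0\<close>.
\<close>

definition yetter_drinfeld ::
  "('g, 'n) monoid_scheme \<Rightarrow> ('k::field, 'v::ab_group_add, 'g, 'm) braided_scheme \<Rightarrow> bool" where
  "yetter_drinfeld G R \<longleftrightarrow> (let kG = group_algebra G; \<rho> = coact R in
     is_vspace R \<and>
     (\<forall>g\<in>carrier G. linear_map R R (act R g)) \<and>
     (\<forall>a\<in>carrier R. act R \<one>\<^bsub>G\<^esub> a = a) \<and>
     (\<forall>g\<in>carrier G. \<forall>h\<in>carrier G. \<forall>a\<in>carrier R. act R (g \<otimes>\<^bsub>G\<^esub> h) a = act R g (act R h a)) \<and>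
     linear_map R (tensor kG R) \<rho> \<and>
     (\<forall>a\<in>carrier R.
        tlift kG R (\<lambda>x b. tlift kG kG (\<lambda>x\<^sub>1 x\<^sub>2. tens kG (tensor kG R) x\<^sub>1 (tens kG R x\<^sub>2 b)) (comult kG x))
          (\<rho> a) =
        tlift kG R (\<lambda>x b. tens kG (tensor kG R) x (\<rho> b)) (\<rho> a)) \<and>
     (\<forall>a\<in>carrier R. tlift kG R (\<lambda>x b. scl R (counit kG x) b) (\<rho> a) = a) \<and>
     (\<forall>g\<in>carrier G. \<forall>a\<in>carrier R.
        \<rho> (act R g a) =
          tlift kG R (\<lambda>x b. tens kG R (gel g \<bullet>\<^bsub>kG\<^esub> x \<bullet>\<^bsub>kG\<^esub> gel (inv\<^bsub>G\<^esub> g)) (act R g b)) (\<rho> a)))"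

definition yd_algebra ::
  "('g, 'n) monoid_scheme \<Rightarrow> ('k::field, 'v::ab_group_add, 'g, 'm) braided_scheme \<Rightarrow> bool" where
  "yd_algebra G R \<longleftrightarrow> (let kG = group_algebra G; \<rho> = coact R in
     unital_algebra R \<and>
     (\<forall>g\<in>carrier G. \<forall>a\<in>carrier R. \<forall>b\<in>carrier R. act R g (a \<bullet>\<^bsub>R\<^esub> b) = act R g a \<bullet>\<^bsub>R\<^esub> act R g b) \<and>
     (\<forall>g\<in>carrier G. act R g (aunit R) = aunit R) \<and>
     (\<forall>a\<in>carrier R. \<forall>b\<in>carrier R.
        \<rho> (a \<bullet>\<^bsub>R\<^esub> b) =
          tlift kG R (\<lambda>x a\<^sub>0. tlift kG R (\<lambda>y b\<^sub>0. tens kG R (x \<bullet>\<^bsub>kG\<^esub> y) (a\<^sub>0 \<bullet>\<^bsub>R\<^esub> b\<^sub>0)) (\<rho> b)) (\<rho> a)) \<and>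
     \<rho> (aunit R) = tens kG R (aunit kG) (aunit R))"

definition yd_coalgebra ::
  "('g, 'n) monoid_scheme \<Rightarrow> ('k::field, 'v::ab_group_add, 'g, 'm) braided_scheme \<Rightarrow> bool" where
  "yd_coalgebra G R \<longleftrightarrow> (let kG = group_algebra G; \<rho> = coact R in
     coalgebra R \<and>
     (\<forall>g\<in>carrier G. \<forall>a\<in>carrier R.
        comult R (act R g a) = tlift R R (\<lambda>x y. tens R R (act R g x) (act R g y)) (comult R a) \<and>
        counit R (act R g a) = counit R a) \<and>
     (\<forall>a\<in>carrier R.
        tlift kG R (\<lambda>x a\<^sub>0. tens kG (tensor R R) x (comult R a\<^sub>0)) (\<rho> a) =
        tlift R R (\<lambda>a\<^sub>1 a\<^sub>2. tlift kG R (\<lambda>x b. tlift kG R (\<lambda>y c.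
            tens kG (tensor R R) (x \<bullet>\<^bsub>kG\<^esub> y) (tens R R b c)) (\<rho> a\<^sub>2)) (\<rho> a\<^sub>1)) (comult R a)) \<and>
     (\<forall>a\<in>carrier R.
        tlift kG R (\<lambda>x a\<^sub>0. scl kG (counit R a\<^sub>0) x) (\<rho> a) = scl kG (counit R a) (aunit kG)))"

text \<open>
  In \<open>\<Delta> (a b) = a\<^sub>1 ((a\<^sub>2)\<^sub>-\<^sub>1 . b\<^sub>1) \<otimes> (a\<^sub>2)\<^sub>0 b\<^sub>2\<close> below, \<open>x\<close> is \<open>(a\<^sub>2)\<^sub>-\<^sub>1\<close> and \<open>c\<close> is \<open>(a\<^sub>2)\<^sub>0\<close>.
\<close>

definition braided_hopf_algebra ::
  "('g, 'n) monoid_scheme \<Rightarrow> ('k::field, 'v::ab_group_add, 'g, 'm) braided_scheme \<Rightarrow> bool" where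
  "braided_hopf_algebra G R \<longleftrightarrow>
     group G \<and> finite (carrier G) \<and> yetter_drinfeld G R \<and> yd_algebra G R \<and> yd_coalgebra G R \<and>
     (\<forall>a\<in>carrier R. \<forall>b\<in>carrier R.
        comult R (a \<bullet>\<^bsub>R\<^esub> b) =
          tlift R R (\<lambda>a\<^sub>1 a\<^sub>2. tlift (group_algebra G) R (\<lambda>x c. tlift R R (\<lambda>b\<^sub>1 b\<^sub>2.
              tens R R (a\<^sub>1 \<bullet>\<^bsub>R\<^esub> kact G R x b\<^sub>1) (c \<bullet>\<^bsub>R\<^esub> b\<^sub>2)) (comult R b)) (coact R a\<^sub>2)) (comult R a) \<and>
        counit R (a \<bullet>\<^bsub>R\<^esub> b) = counit R a * counit R b) \<and>
     comult R (aunit R) = tens R R (aunit R) (aunit R) \<and> counit R (aunit R) = 1 \<and>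
     (\<exists>S. is_antipode R S)"

definition homogeneous ::
  "('g, 'n) monoid_scheme \<Rightarrow> ('k::field, 'v::ab_group_add, 'g, 'm) braided_scheme \<Rightarrow> 'g \<Rightarrow> 'v set"
  where
  "homogeneous G R g = {r \<in> carrier R. coact R r = tens (group_algebra G) R (gel g) r}"

definition Supp ::
  "('g, 'n) monoid_scheme \<Rightarrow> ('k::field, 'v::ab_group_add, 'g, 'm) braided_scheme \<Rightarrow> 'g set" where
  "Supp G R = {g \<in> carrier G. homogeneous G R g \<noteq> {0}}"


section \<open>The Radford-Majid biproduct\<close>

text \<open>
  Multiplication: \<open>(a # g) (b # h) = a (g.b) # g h\<close>, extended bilinearly in \<open>g\<close> and \<open>h\<close>.
  Comultiplication: \<open>\<Delta> (a # g) = a\<^sub>1 # (a\<^sub>2)\<^sub>-\<^sub>1 g \<otimes> (a\<^sub>2)\<^sub>0 # g\<close>, extended linearly in \<open>g\<close>; in the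
  formula, \<open>z\<close> is \<open>(a\<^sub>2)\<^sub>-\<^sub>1\<close> and \<open>b\<close> is \<open>(a\<^sub>2)\<^sub>0\<close>.
\<close>

definition biproduct ::
  "('k::field, 'v::ab_group_add, 'g, 'm) braided_scheme \<Rightarrow> ('g, 'n) monoid_scheme \<Rightarrow>
   ('k, ('k, 'v, 'g \<Rightarrow> 'k) tensor) bialg" where
  "biproduct R G = (let kG = group_algebra G; H = tensor R kG in
     \<lparr>carrier = carrier H,
      scl = scl H,
      amult = (\<lambda>u v. tlift R kG (\<lambda>a x. tlift R kG (\<lambda>b y.
         \<Sum>g\<in>carrier G. \<Sum>h\<in>carrier G.
           scl H (x g * y h) (tens R kG (a \<bullet>\<^bsub>R\<^esub> act R g b) (gel (g \<otimes>\<^bsub>G\<^esub> h)))) v) u),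
      aunit = tens R kG (aunit R) (aunit kG),
      comult = (\<lambda>u. tlift R kG (\<lambda>a x. \<Sum>g\<in>carrier G. fscale (x g)
         (tlift R R (\<lambda>a\<^sub>1 a\<^sub>2. tlift kG R (\<lambda>z b.
            tens H H (tens R kG a\<^sub>1 (z \<bullet>\<^bsub>kG\<^esub> gel g)) (tens R kG b (gel g)))
            (coact R a\<^sub>2)) (comult R a))) u),
      counit = tlift R kG (\<lambda>a x. counit R a * counit kG x)\<rparr>)"

text \<open>The subspace \<open>R # kT\<close> of \<open>R # kG\<close>, for \<open>T \<subseteq> G\<close>.\<close>

definition biproduct_part ::
  "('k::field, 'v::ab_group_add, 'g, 'm) braided_scheme \<Rightarrow> ('g, 'n) monoid_scheme \<Rightarrow> 'g set \<Rightarrow>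
   ('k, 'v, 'g \<Rightarrow> 'k) tensor set" where
  "biproduct_part R G T = carrier (tensor R (group_algebra (G\<lparr>carrier := T\<rparr>)))"


section \<open>The dihedral group\<close>

text \<open>
  \<open>(i, False)\<close> is \<open>r\<^sup>i\<close> and \<open>(i, True)\<close> is \<open>r\<^sup>i s\<close>, where \<open>r\<close> is the rotation of order \<open>n\<close>, \<open>s\<close> is a
  reflection and \<open>s r = r\<^sup>-\<^sup>1 s\<close>.
\<close>

definition dihedral_group :: "nat \<Rightarrow> (int \<times> bool) monoid" where
  "dihedral_group n =
     \<lparr>carrier = {0..<int n} \<times> UNIV,
      monoid.mult = (\<lambda>(i, a) (j, b). ((if a then i - j else i + j) mod int n, a \<noteq> b)),
      one = (0, False)\<rparr>"

definition rotations :: "nat \<Rightarrow> (int \<times> bool) set" where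
  "rotations n = {0..<int n} \<times> {False}"

lemma group_dihedral_group:
  assumes "n > 0"
  shows "group (dihedral_group n)"
proof (rule groupI)
  fix x assume "x \<in> carrier (dihedral_group n)"
  then show "\<exists>y\<in>carrier (dihedral_group n). y \<otimes>\<^bsub>dihedral_group n\<^esub> x = \<one>\<^bsub>dihedral_group n\<^esub>"
    using assms
    by (intro bexI[of _ "(if snd x then fst x else (- fst x) mod int n, snd x)"])
       (auto simp: dihedral_group_def mod_simps)
qed (use assms in \<open>auto simp: dihedral_group_def mod_simps algebra_simps\<close>)

lemma rotations_iso_integer_mod_group:
  assumes "n > 0"
  shows "subgroup (rotations n) (dihedral_group n)"
    and "(dihedral_group n)\<lparr>carrier := rotations n\<rparr> \<cong> integer_mod_group n"
proof -
  interpret group "dihedral_group n" by (rule group_dihedral_group[OF assms])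
  have inv: "inv\<^bsub>dihedral_group n\<^esub> (i, False) = ((- i) mod int n, False)" if "0 \<le> i" "i < int n" for i
    using assms that by (intro inv_equality) (auto simp: dihedral_group_def mod_simps)
  show "subgroup (rotations n) (dihedral_group n)"
    by (rule subgroupI) (use assms inv in \<open>auto simp: rotations_def\<close>,
        auto simp: dihedral_group_def)
  have "fst \<in> iso ((dihedral_group n)\<lparr>carrier := rotations n\<rparr>) (integer_mod_group n)"
    using assms
    by (auto simp: iso_def hom_def bij_betw_def inj_on_def rotations_def dihedral_group_def
        integer_mod_group_def integer_group_def image_iff)
  then show "(dihedral_group n)\<lparr>carrier := rotations n\<rparr> \<cong> integer_mod_group n"
    by (auto simp: is_iso_def)
qed

end

theory Submission
  imports Defs
begin

text \<open>
  The biproduct is treated through the coordinates \<open>R # kG = \<Oplus>\<^sub>g R # g\<close> and the homogeneous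
  projections \<open>pr g\<close> of \<open>R\<close>, for which \<open>\<rho> a = \<Sum>\<^sub>g g \<otimes> pr g a\<close>; all identities are checked on the
  generators \<open>a # g\<close>. If \<open>T\<close> is a normal subgroup containing the support, then \<open>pr z a = 0\<close> for
  \<open>z \<notin> T\<close>, so only \<open>G\<close>-components in \<open>T\<close> occur in \<open>\<Delta>(a # g)\<close> and \<open>S(a # g)\<close> for \<open>g \<in> T\<close>, and
  \<open>(a\<^sub>1 # zg) (b # t) S((a\<^sub>2)\<^sub>z # g)\<close> lies over \<open>(zg) t (zg)\<^sup>-\<^sup>1 \<in> T\<close>.

  For the support: as \<open>n\<close> is odd, the \<open>n\<close> reflections are conjugate, so if one of them is in the
  support, all are. Since \<open>1 \<in> R\<^sub>1\<close> and \<open>dim R = n + 1\<close>, the algebra \<open>R\<close> is then spanned by \<open>1\<close> and one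
  element \<open>x\<^sub>t \<in> R\<^sub>t\<close> for every reflection \<open>t\<close>. Products of two distinct reflections are outside the
  support, hence \<open>x\<^sub>t x\<^sub>u = 0\<close> for \<open>t \<noteq> u\<close>, while \<open>x\<^sub>t\<^sup>2 = c 1\<close>; multiplying by \<open>x\<^sub>u\<close> gives \<open>c = 0\<close>. Thus
  \<open>x\<^sub>t R x\<^sub>t = 0\<close>, which is impossible in a semisimple algebra.
\<close>

section \<open>Linear maps and tensors\<close>

text \<open>The assertion that \<open>R # kT\<close> is a Hopf subalgebra includes that
  \<open>R # kG\<close> is a Hopf algebra, so all axioms of the Radford-Majid biproduct have to be
  established; this is the bulk of the work and is done over an arbitrary finite group. Two
  definitions shape it. \<open>tlift\<close> is a definite description that is known to have a value
  only for a bilinear integrand into a vector space, so Sweedler computations carry linearity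
  obligations and are moved to a substitute that is additive in the integrand by construction.
  \<open>antipode\<close> is an arbitrary choice, so an explicit antipode is usable only once
  convolution inverses are known to be unique.

  The dimension n + 1 is a tight count: the degree 1 and the n reflections already carry n + 1
  independent homogeneous elements, which leaves no room for a second element in one of these
  degrees or for any other degree. Oddness of n enters as invertibility of 2 modulo n, and n \<ge> 3
  supplies the second reflection u used to show c = 0. Normality comes from the sign homomorphism of
  the dihedral group, whose kernel is T.\<close>

lemma vector_space_fscale: "vector_space (fscale :: 'k::field \<Rightarrow> ('a \<Rightarrow> 'k) \<Rightarrow> _)"
  by unfold_locales (auto simp: fscale_def fun_eq_iff algebra_simps)

lemma is_vspace_base: "is_vspace (base :: ('k::field, 'k) vspace)"
proof -
  have "vector_space ((*) :: 'k \<Rightarrow> 'k \<Rightarrow> 'k)" by unfold_locales (auto simp: algebra_simps)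
  then show ?thesis
    by (simp add: is_vspace_def base_def module.subspace_UNIV module_iff_vector_space)
qed

lemma scl_tensor [simp]: "scl (tensor V W) = fscale"
  by (simp add: tensor_def)

lemma is_vspace_tensor [simp, intro]: "is_vspace (tensor V W)"
  unfolding is_vspace_def tensor_def
  using vector_space_fscale by (auto intro!: module.subspace_span simp: module_iff_vector_space)

lemma scl_base [simp]: "scl base = (*)" and carrier_base [simp]: "carrier base = UNIV"
  by (simp_all add: base_def)

lemma fscale_simps [simp]:
  "fscale 0 f = 0" "fscale c 0 = 0" "fscale 1 f = f"
  "fscale c (f + g) = fscale c f + fscale c g" "fscale c (fscale d f) = fscale (c * d) f"
  "fscale c (if P then f else g) = (if P then fscale c f else fscale c g)"
  by (auto simp: fscale_def fun_eq_iff algebra_simps)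

lemma fscale_add_left: "fscale (c + d) f = fscale c f + fscale d f"
  by (auto simp: fscale_def fun_eq_iff algebra_simps)

lemma fscale_sum: "fscale c (\<Sum>i\<in>I. f i) = (\<Sum>i\<in>I. fscale c (f i))"
  by (rule module.scale_sum_right) (simp add: module_iff_vector_space vector_space_fscale)

lemma fscale_apply: "fscale c f x = c * f x"
  by (simp add: fscale_def)

context
  fixes V :: "('k::field, 'v::ab_group_add, 'm) vspace_scheme"
  assumes V: "is_vspace V"
begin

interpretation vector_space "scl V" using V by (simp add: is_vspace_def)

lemma carrier_subspace: "module.subspace (scl V) (carrier V)"
  using V by (simp add: is_vspace_def)

lemma zero_mem: "0 \<in> carrier V"
  using carrier_subspace by (rule subspace_0)

lemma add_mem: "x \<in> carrier V \<Longrightarrow> y \<in> carrier V \<Longrightarrow> x + y \<in> carrier V"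
  using carrier_subspace by (rule subspace_add)

lemma scl_mem: "x \<in> carrier V \<Longrightarrow> scl V c x \<in> carrier V"
  using carrier_subspace by (rule subspace_scale)

lemma sum_mem: "(\<And>i. i \<in> I \<Longrightarrow> f i \<in> carrier V) \<Longrightarrow> (\<Sum>i\<in>I. f i) \<in> carrier V"
  using carrier_subspace by (rule subspace_sum)

lemma sum_list_mem: "(\<And>i. i \<in> set xs \<Longrightarrow> f i \<in> carrier V) \<Longrightarrow> (\<Sum>i\<leftarrow>xs. f i) \<in> carrier V"
  by (induction xs) (auto intro: add_mem zero_mem)

lemma scl_zero_left: "scl V 0 x = 0"
  and scl_zero_right: "scl V c 0 = 0"
  and scl_one: "scl V 1 x = x"
  and scl_scl: "scl V c (scl V d x) = scl V (c * d) x"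
  and scl_add_right: "scl V c (x + y) = scl V c x + scl V c y"
  and scl_add_left: "scl V (c + d) x = scl V c x + scl V d x"
  and scl_sum_right: "scl V c (\<Sum>i\<in>I. f i) = (\<Sum>i\<in>I. scl V c (f i))"
  by (simp_all add: scale_left_distrib scale_right_distrib scale_sum_right)

lemma scl_sum_list: "scl V c (\<Sum>i\<leftarrow>xs. f i) = (\<Sum>i\<leftarrow>xs. scl V c (f i))"
  by (induction xs) (simp_all add: scale_right_distrib)

lemma scl_delta:
  assumes "finite I" "j \<in> I"
  shows "(\<Sum>i\<in>I. scl V (if i = j then 1 else 0) (f i)) = f j"
    and "(\<Sum>i\<in>I. scl V (if j = i then 1 else 0) (f i)) = f j"
proof -
  have "(\<Sum>i\<in>I. scl V (if i = j then 1 else 0) (f i)) = (\<Sum>i\<in>I. if i = j then f i else 0)"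
    by (intro sum.cong) auto
  then show "(\<Sum>i\<in>I. scl V (if i = j then 1 else 0) (f i)) = f j" using assms by simp
  have "(\<Sum>i\<in>I. scl V (if j = i then 1 else 0) (f i)) = (\<Sum>i\<in>I. if j = i then f i else 0)"
    by (intro sum.cong) auto
  then show "(\<Sum>i\<in>I. scl V (if j = i then 1 else 0) (f i)) = f j" using assms by simp
qed

lemma linear_map_zero: "linear_map V W f \<Longrightarrow> f 0 = 0"
  using linear_map_add[of V W f 0 0] zero_mem by simp

lemma linear_map_sum:
  assumes "linear_map V W f" and "\<And>i. i \<in> I \<Longrightarrow> x i \<in> carrier V"
  shows "f (\<Sum>i\<in>I. x i) = (\<Sum>i\<in>I. f (x i))"
  using assms(2)
proof (induction I rule: infinite_finite_induct)
  case (insert i I)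
  then show ?case
    by (simp add: linear_map_add[OF assms(1)] sum_mem)
qed (use linear_map_zero[OF assms(1)] in auto)

lemma linear_map_sum_list_on:
  assumes "linear_map V W f" and "\<And>i. i \<in> set xs \<Longrightarrow> x i \<in> carrier V"
  shows "f (\<Sum>i\<leftarrow>xs. x i) = (\<Sum>i\<leftarrow>xs. f (x i))"
  using assms(2)
  by (induction xs) (simp_all add: linear_map_zero[OF assms(1)] linear_map_add[OF assms(1)] sum_list_mem)

end

lemma linear_mapI:
  assumes "\<And>x. x \<in> carrier V \<Longrightarrow> f x \<in> carrier W"
    and "\<And>x y. x \<in> carrier V \<Longrightarrow> y \<in> carrier V \<Longrightarrow> f (x + y) = f x + f y"
    and "\<And>c x. x \<in> carrier V \<Longrightarrow> f (scl V c x) = scl W c (f x)"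
  shows "linear_map V W f"
  unfolding linear_map_def by (intro conjI ballI allI funcsetI assms)

lemma linear_map_comp:
  "linear_map V W f \<Longrightarrow> linear_map W U g \<Longrightarrow> linear_map V U (\<lambda>x. g (f x))"
  by (intro linear_mapI) (simp_all add: linear_map_mem linear_map_add linear_map_scl)

lemma bilinear_mapI:
  assumes "\<And>x y. x \<in> carrier V \<Longrightarrow> y \<in> carrier W \<Longrightarrow> \<mu> x y \<in> carrier U"
    and "\<And>x x' y. x \<in> carrier V \<Longrightarrow> x' \<in> carrier V \<Longrightarrow> y \<in> carrier W \<Longrightarrow> \<mu> (x + x') y = \<mu> x y + \<mu> x' y"
    and "\<And>x y y'. x \<in> carrier V \<Longrightarrow> y \<in> carrier W \<Longrightarrow> y' \<in> carrier W \<Longrightarrow> \<mu> x (y + y') = \<mu> x y + \<mu> x y'"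
    and "\<And>c x y. x \<in> carrier V \<Longrightarrow> y \<in> carrier W \<Longrightarrow> \<mu> (scl V c x) y = scl U c (\<mu> x y)"
    and "\<And>c x y. x \<in> carrier V \<Longrightarrow> y \<in> carrier W \<Longrightarrow> \<mu> x (scl W c y) = scl U c (\<mu> x y)"
  shows "bilinear_map V W U \<mu>"
  unfolding bilinear_map_def by (intro conjI ballI linear_mapI assms)

lemma bilinear_map_linear:
  "bilinear_map V W U \<mu> \<Longrightarrow> v \<in> carrier V \<Longrightarrow> linear_map W U (\<mu> v)"
  "bilinear_map V W U \<mu> \<Longrightarrow> w \<in> carrier W \<Longrightarrow> linear_map V U (\<lambda>v. \<mu> v w)"
  by (auto simp: bilinear_map_def)

section \<open>Pure tensors and their presentations\<close>

lemma tens_add_left: "tens V W (v + v') w = tens V W v w + tens V W v' w"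
  and tens_add_right: "tens V W v (w + w') = tens V W v w + tens V W v w'"
  and tens_scl_left: "tens V W (scl V c v) w = fscale c (tens V W v w)"
  and tens_scl_right: "tens V W v (scl W c w) = fscale c (tens V W v w)"
  by (auto simp: tens_def fun_eq_iff bilinear_map_def linear_map_def base_def fscale_def)

lemma tens_zero_left: "tens V W 0 w = 0" and tens_zero_right: "tens V W v 0 = 0"
  using tens_add_left[of V W 0 0 w] tens_add_right[of V W v 0 0] by simp_all

lemma tens_mem: "v \<in> carrier V \<Longrightarrow> w \<in> carrier W \<Longrightarrow> tens V W v w \<in> carrier (tensor V W)"
  unfolding tensor_def
  by (auto intro!: module.span_base simp: module_iff_vector_space vector_space_fscale)

text \<open>\<open>tens\<close> tests against forms that are bilinear on the full ambient types, so
  it depends on the scalar multiplications alone. Hence tensors over a subspace agree with tensors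
  over the whole space, and tensors over the biproduct record with tensors over
  \<open>tensor R kG\<close>.\<close>

lemma tens_cong:
  assumes "scl V = scl V'" "scl W = scl W'"
  shows "tens V W = tens V' W'"
  using assms by (auto simp: tens_def fun_eq_iff bilinear_map_def linear_map_def)

lemma bilinear_map_tens: "bilinear_map V W (tensor V W) (tens V W)"
  by (rule bilinear_mapI)
     (simp_all add: tens_mem tens_add_left tens_add_right tens_scl_left tens_scl_right)

lemma tens_sum_left: "tens V W (\<Sum>i\<in>I. f i) w = (\<Sum>i\<in>I. tens V W (f i) w)"
  by (induction I rule: infinite_finite_induct) (simp_all add: tens_zero_left tens_add_left)

lemma tens_sum_right: "tens V W v (\<Sum>i\<in>I. f i) = (\<Sum>i\<in>I. tens V W v (f i))"
  by (induction I rule: infinite_finite_induct) (simp_all add: tens_zero_right tens_add_right)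

text \<open>Each scalar of a linear combination of pure tensors is absorbed into its left factor.
  What remains is a plain sum of pure tensors, the shape over which \<open>tlift\<close>
  quantifies.\<close>

lemma tensor_list_repr:
  assumes "is_vspace V" and "t \<in> carrier (tensor V W)"
  shows "\<exists>ps. set ps \<subseteq> carrier V \<times> carrier W \<and> t = (\<Sum>(v, w)\<leftarrow>ps. tens V W v w)"
proof -
  interpret F: vector_space fscale by (rule vector_space_fscale)
  have "t \<in> F.span {tens V W v w |v w. v \<in> carrier V \<and> w \<in> carrier W}"
    using assms(2) by (simp add: tensor_def)
  then show ?thesis
  proof (induction rule: F.span_induct_alt)
    case base
    show ?case by (rule exI[of _ "[]"]) auto
  next
    case (step c x y)
    then obtain v w ps where "x = tens V W v w" "v \<in> carrier V" "w \<in> carrier W"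
      "set ps \<subseteq> carrier V \<times> carrier W" "y = (\<Sum>(v, w)\<leftarrow>ps. tens V W v w)" by blast
    then show ?case
      by (intro exI[of _ "(scl V c v, w) # ps"]) (auto simp: tens_scl_left scl_mem[OF assms(1)])
  qed
qed

text \<open>
  A substitute for \<open>tlift\<close> that evaluates \<open>\<mu>\<close> on a fixed presentation of the tensor \<open>t\<close>. It is
  additive in \<open>\<mu>\<close> whether or not \<open>\<mu>\<close> is bilinear, and agrees with \<open>tlift\<close> if \<open>\<mu>\<close> is.
\<close>

definition tlist ::
  "('k::field, 'v::ab_group_add, 'm) vspace_scheme \<Rightarrow>
   ('k, 'w::ab_group_add, 'n) vspace_scheme \<Rightarrow> ('k, 'v, 'w) tensor \<Rightarrow> ('v \<times> 'w) list" where
  "tlist V W t = (SOME ps. set ps \<subseteq> carrier V \<times> carrier W \<and>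
     (is_vspace V \<longrightarrow> t \<in> carrier (tensor V W) \<longrightarrow> t = (\<Sum>(v, w)\<leftarrow>ps. tens V W v w)))"

definition tsum ::
  "('k::field, 'v::ab_group_add, 'm) vspace_scheme \<Rightarrow>
   ('k, 'w::ab_group_add, 'n) vspace_scheme \<Rightarrow>
   ('v \<Rightarrow> 'w \<Rightarrow> 'u::ab_group_add) \<Rightarrow> ('k, 'v, 'w) tensor \<Rightarrow> 'u" where
  "tsum V W \<mu> t = (\<Sum>(v, w)\<leftarrow>tlist V W t. \<mu> v w)"

text \<open>Containment in the carriers is unconditional, as the empty list serves whenever no
  presentation is demanded. The terms evaluated by \<open>tsum\<close> therefore lie in the carriers
  for every t.\<close>

lemma tlist_props:
  "set (tlist V W t) \<subseteq> carrier V \<times> carrier W \<and>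
     (is_vspace V \<longrightarrow> t \<in> carrier (tensor V W) \<longrightarrow> t = (\<Sum>(v, w)\<leftarrow>tlist V W t. tens V W v w))"
proof -
  have "\<exists>ps. set ps \<subseteq> carrier V \<times> carrier W \<and>
    (is_vspace V \<longrightarrow> t \<in> carrier (tensor V W) \<longrightarrow> t = (\<Sum>(v, w)\<leftarrow>ps. tens V W v w))"
    using tensor_list_repr[of V t W] by (metis empty_subsetI list.set(1))
  then show ?thesis unfolding tlist_def by (rule someI_ex)
qed

lemmas tlist_subset = tlist_props[THEN conjunct1]

lemma tsum_tens: "is_vspace V \<Longrightarrow> t \<in> carrier (tensor V W) \<Longrightarrow> tsum V W (tens V W) t = t"
  using tlist_props[of V W t] by (simp add: tsum_def)

lemma tlift_tsum:
  assumes "is_vspace V" "is_vspace W" "is_vspace U" "bilinear_map V W U \<mu>"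
    and "t \<in> carrier (tensor V W)"
  shows "tlift V W \<mu> t = tsum V W \<mu> t"
  using tlift_sum[OF assms(1-4), of "tlist V W t"] tlist_props[of V W t] assms(1,5)
  by (simp add: tsum_def)

lemma tsum_cong:
  assumes "V = V'" "W = W'" "t = t'"
    and "\<And>v w. v \<in> carrier V' \<Longrightarrow> w \<in> carrier W' \<Longrightarrow> \<mu> v w = \<nu> v w"
  shows "tsum V W \<mu> t = tsum V' W' \<nu> t'"
  unfolding tsum_def assms(1-3) using tlist_subset[of V' W' t'] assms(4)
  by (intro arg_cong[of _ _ sum_list] map_cong) auto

lemma tsum_mem:
  assumes "is_vspace U" "\<And>v w. v \<in> carrier V \<Longrightarrow> w \<in> carrier W \<Longrightarrow> \<mu> v w \<in> carrier U"
  shows "tsum V W \<mu> t \<in> carrier U"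
  unfolding tsum_def using tlist_subset[of V W t] assms(2)
  by (intro sum_list_mem[OF assms(1)]) auto

lemma tsum_linear:
  assumes "linear_map U X f" "is_vspace U"
    "\<And>v w. v \<in> carrier V \<Longrightarrow> w \<in> carrier W \<Longrightarrow> \<mu> v w \<in> carrier U"
  shows "f (tsum V W \<mu> t) = tsum V W (\<lambda>v w. f (\<mu> v w)) t"
  unfolding tsum_def using tlist_subset[of V W t] assms(3)
  by (subst linear_map_sum_list_on[OF assms(2,1)]) (auto simp: case_prod_unfold)

lemma tsum_add: "tsum V W (\<lambda>v w. \<mu> v w + \<nu> v w) t = tsum V W \<mu> t + tsum V W \<nu> t"
  unfolding tsum_def by (simp add: case_prod_unfold sum_list_addf)

lemma tsum_zero: "tsum V W (\<lambda>v w. 0) t = 0"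
  unfolding tsum_def by (simp add: case_prod_unfold)

lemma tsum_scl: "is_vspace U \<Longrightarrow> tsum V W (\<lambda>v w. scl U c (\<mu> v w)) t = scl U c (tsum V W \<mu> t)"
  unfolding tsum_def by (simp add: case_prod_unfold scl_sum_list)

lemma tsum_sum: "tsum V W (\<lambda>v w. \<Sum>i\<in>I. \<mu> i v w) t = (\<Sum>i\<in>I. tsum V W (\<mu> i) t)"
  by (induction I rule: infinite_finite_induct) (simp_all add: tsum_zero tsum_add)

section \<open>Linearity of the maps induced by bilinear maps\<close>

context
  fixes V :: "('k::field, 'v::ab_group_add, 'm) vspace_scheme"
    and W :: "('k, 'w::ab_group_add, 'n) vspace_scheme"
    and U :: "('k, 'u::ab_group_add, 'l) vspace_scheme"
    and \<mu>
  assumes V: "is_vspace V" and W: "is_vspace W" and U: "is_vspace U" and \<mu>: "bilinear_map V W U \<mu>"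
begin

lemma tlift_tens:
  assumes "v \<in> carrier V" "w \<in> carrier W"
  shows "tlift V W \<mu> (tens V W v w) = \<mu> v w"
  using tlift_sum[OF V W U \<mu>, of "[(v, w)]"] assms by simp

text \<open>Concatenating presentations of x and y presents x + y, and scaling all left factors
  presents a multiple of x. By \<open>tlift_sum\<close> the value may be read off from whichever
  presentation is convenient.\<close>

lemma linear_map_tlift: "linear_map (tensor V W) U (tlift V W \<mu>)"
proof (rule linear_mapI)
  have mem: "\<mu> v w \<in> carrier U" if "v \<in> carrier V" "w \<in> carrier W" for v w
    using \<mu> that by (auto simp: bilinear_map_def linear_map_def)
  have scl: "\<mu> (scl V c v) w = scl U c (\<mu> v w)" if "v \<in> carrier V" "w \<in> carrier W" for c v w
    using \<mu> that by (auto simp: bilinear_map_def linear_map_def)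
  show "tlift V W \<mu> x \<in> carrier U" if "x \<in> carrier (tensor V W)" for x
    using that by (simp add: tlift_tsum[OF V W U \<mu>] tsum_mem[OF U] mem)
  show "tlift V W \<mu> (x + y) = tlift V W \<mu> x + tlift V W \<mu> y"
    if xy: "x \<in> carrier (tensor V W)" "y \<in> carrier (tensor V W)" for x y
  proof -
    obtain ps qs where
      "set ps \<subseteq> carrier V \<times> carrier W" "x = (\<Sum>(v, w)\<leftarrow>ps. tens V W v w)"
      "set qs \<subseteq> carrier V \<times> carrier W" "y = (\<Sum>(v, w)\<leftarrow>qs. tens V W v w)"
      using tensor_list_repr[OF V xy(1)] tensor_list_repr[OF V xy(2)] by blast
    then show ?thesis
      using tlift_sum[OF V W U \<mu>, of "ps @ qs"] by (simp add: tlift_sum[OF V W U \<mu>])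
  qed
  show "tlift V W \<mu> (scl (tensor V W) c x) = scl U c (tlift V W \<mu> x)"
    if x: "x \<in> carrier (tensor V W)" for c x
  proof -
    obtain ps where ps:
      "set ps \<subseteq> carrier V \<times> carrier W" "x = (\<Sum>(v, w)\<leftarrow>ps. tens V W v w)"
      using tensor_list_repr[OF V x] by blast
    define qs where "qs = map (\<lambda>(v, w). (scl V c v, w)) ps"
    have qs: "set qs \<subseteq> carrier V \<times> carrier W" using ps by (auto simp: qs_def scl_mem[OF V])
    have "fscale c x = (\<Sum>(v, w)\<leftarrow>qs. tens V W v w)"
      unfolding ps(2) qs_def scl_sum_list[OF is_vspace_tensor[of V W], unfolded scl_tensor]
      by (simp add: tens_scl_left case_prod_unfold comp_def)
    moreover have "(\<Sum>(v, w)\<leftarrow>qs. \<mu> v w) = scl U c (\<Sum>(v, w)\<leftarrow>ps. \<mu> v w)"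
      unfolding qs_def using ps(1)
      by (induction ps) (auto simp: scl scl_add_right[OF U] scl_zero_right[OF U])
    ultimately show ?thesis
      using tlift_sum[OF V W U \<mu>, of qs] tlift_sum[OF V W U \<mu>, of ps] ps qs by simp
  qed
qed

end

text \<open>The tensor is fixed and the bilinear map varies linearly with a parameter. Passing to
  \<open>tsum\<close> evaluates all these maps on one and the same presentation, where linearity in
  the parameter is termwise.\<close>

lemma linear_map_tlift_param:
  assumes "is_vspace V" "is_vspace W" "is_vspace U" "t \<in> carrier (tensor V W)"
    and "\<And>y. y \<in> carrier Y \<Longrightarrow> bilinear_map V W U (\<mu> y)"
    and "\<And>v w. v \<in> carrier V \<Longrightarrow> w \<in> carrier W \<Longrightarrow> linear_map Y U (\<lambda>y. \<mu> y v w)"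
    and "is_vspace Y"
  shows "linear_map Y U (\<lambda>y. tlift V W (\<mu> y) t)"
proof (rule linear_mapI)
  note lift = tlift_tsum[OF assms(1-3) assms(5) assms(4)]
  fix x y c assume x: "x \<in> carrier Y"
  show "tlift V W (\<mu> x) t \<in> carrier U"
    using linear_map_mem[OF linear_map_tlift[OF assms(1-3) assms(5)[OF x]]] assms(4) by simp
  have "tlift V W (\<mu> (scl Y c x)) t = tsum V W (\<mu> (scl Y c x)) t"
    by (rule lift) (rule scl_mem[OF assms(7) x])
  also have "\<dots> = tsum V W (\<lambda>v w. scl U c (\<mu> x v w)) t"
    by (rule tsum_cong) (use linear_map_scl[OF assms(6) x] in auto)
  also have "\<dots> = scl U c (tlift V W (\<mu> x) t)"
    by (simp only: lift[OF x] tsum_scl[OF assms(3)])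
  finally show "tlift V W (\<mu> (scl Y c x)) t = scl U c (tlift V W (\<mu> x) t)" .
  assume y: "y \<in> carrier Y"
  have "tlift V W (\<mu> (x + y)) t = tsum V W (\<mu> (x + y)) t"
    by (rule lift) (rule add_mem[OF assms(7) x y])
  also have "\<dots> = tsum V W (\<lambda>v w. \<mu> x v w + \<mu> y v w) t"
    by (rule tsum_cong) (use linear_map_add[OF assms(6) x y] in auto)
  also have "\<dots> = tlift V W (\<mu> x) t + tlift V W (\<mu> y) t"
    by (simp only: lift[OF x] lift[OF y] tsum_add)
  finally show "tlift V W (\<mu> (x + y)) t = tlift V W (\<mu> x) t + tlift V W (\<mu> y) t" .
qed

text \<open>The description defining \<open>tlift\<close> consults the integrand only at pairs from
  the carriers, so integrands agreeing there give literally the same description.\<close>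

lemma tlift_cong:
  assumes "V = V'" "W = W'" "t = t'"
    and "\<And>v w. v \<in> carrier V' \<Longrightarrow> w \<in> carrier W' \<Longrightarrow> \<mu> v w = \<nu> v w"
  shows "tlift V W \<mu> t = tlift V' W' \<nu> t'"
proof -
  have "(\<Sum>(v, w)\<leftarrow>ps. \<mu> v w) = (\<Sum>(v, w)\<leftarrow>ps. \<nu> v w)"
    if "set ps \<subseteq> carrier V' \<times> carrier W'" for ps
    using that assms(4) by (intro arg_cong[of _ _ sum_list] map_cong) auto
  then show ?thesis
    unfolding tlift_def assms(1-3) by (intro arg_cong[of _ _ The] ext ex_cong1 conj_cong refl) simp_all
qed

lemma tens_fscale:
  "tens (tensor A B) W (fscale c v) w = fscale c (tens (tensor A B) W v w)"
  "tens V (tensor A B) v' (fscale c w') = fscale c (tens V (tensor A B) v' w')"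
  using tens_scl_left[of "tensor A B"] tens_scl_right[of V "tensor A B"] by simp_all

text \<open>The situation on the left side of coassociativity: x enters through a tensor-valued
  linear map \<delta>, such as a comultiplication, and y is a parameter of the integrand. Linearity
  in x comes from the induced map, linearity in y from varying the integrand over a fixed
  tensor.\<close>

lemma bilinear_map_tlift_left:
  assumes "is_vspace V" "is_vspace W" "is_vspace U" "is_vspace B"
    and "linear_map A (tensor V W) \<delta>"
    and "\<And>y. y \<in> carrier B \<Longrightarrow> bilinear_map V W U (\<lambda>v w. \<mu> v w y)"
    and "\<And>v w. v \<in> carrier V \<Longrightarrow> w \<in> carrier W \<Longrightarrow> linear_map B U (\<mu> v w)"
  shows "bilinear_map A B U (\<lambda>x y. tlift V W (\<lambda>v w. \<mu> v w y) (\<delta> x))"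
  unfolding bilinear_map_def
proof (intro conjI ballI)
  show "linear_map B U (\<lambda>y. tlift V W (\<lambda>v w. \<mu> v w y) (\<delta> x))" if "x \<in> carrier A" for x
    by (rule linear_map_tlift_param) (use assms linear_map_mem[OF assms(5) that] in auto)
  show "linear_map A U (\<lambda>x. tlift V W (\<lambda>v w. \<mu> v w y) (\<delta> x))" if "y \<in> carrier B" for y
    by (rule linear_map_comp[OF assms(5)], rule linear_map_tlift) (use assms that in auto)
qed

lemma bilinear_map_flip: "bilinear_map V W U \<mu> \<Longrightarrow> bilinear_map W V U (\<lambda>w v. \<mu> v w)"
  by (auto simp: bilinear_map_def)

lemma bilinear_map_tlift_right:
  assumes "is_vspace V" "is_vspace W" "is_vspace U" "is_vspace B"
    and "linear_map A (tensor V W) \<delta>"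
    and "\<And>y. y \<in> carrier B \<Longrightarrow> bilinear_map V W U (\<mu> y)"
    and "\<And>v w. v \<in> carrier V \<Longrightarrow> w \<in> carrier W \<Longrightarrow> linear_map B U (\<lambda>y. \<mu> y v w)"
  shows "bilinear_map B A U (\<lambda>y x. tlift V W (\<mu> y) (\<delta> x))"
  using bilinear_map_flip[OF bilinear_map_tlift_left[where \<mu> = "\<lambda>v w y. \<mu> y v w", OF assms]] .

lemma linear_map_tsum_param:
  assumes "is_vspace U" "\<And>v w. v \<in> carrier V \<Longrightarrow> w \<in> carrier W \<Longrightarrow> linear_map B U (\<mu> v w)"
  shows "linear_map B U (\<lambda>b. tsum V W (\<lambda>v w. \<mu> v w b) t)"
proof (rule linear_mapI)
  fix x y c assume x: "x \<in> carrier B"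
  show "tsum V W (\<lambda>v w. \<mu> v w x) t \<in> carrier U"
    by (rule tsum_mem[OF assms(1)]) (rule linear_map_mem[OF assms(2) x])
  show "tsum V W (\<lambda>v w. \<mu> v w (scl B c x)) t = scl U c (tsum V W (\<lambda>v w. \<mu> v w x) t)"
    by (subst tsum_scl[OF assms(1), symmetric], rule tsum_cong)
       (simp_all add: linear_map_scl[OF assms(2) x])
  assume y: "y \<in> carrier B"
  show "tsum V W (\<lambda>v w. \<mu> v w (x + y)) t = tsum V W (\<lambda>v w. \<mu> v w x) t + tsum V W (\<lambda>v w. \<mu> v w y) t"
    by (subst tsum_add[symmetric], rule tsum_cong) (simp_all add: linear_map_add[OF assms(2) x y])
qed

lemma linear_map_sum_fun:
  assumes "is_vspace U" "\<And>i. i \<in> I \<Longrightarrow> linear_map V U (f i)"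
  shows "linear_map V U (\<lambda>x. \<Sum>i\<in>I. f i x)"
  by (rule linear_mapI)
     (simp_all add: sum_mem[OF assms(1)] linear_map_mem[OF assms(2)] linear_map_add[OF assms(2)]
       linear_map_scl[OF assms(2)] sum.distrib scl_sum_right[OF assms(1)])

lemma linear_map_id: "linear_map V V (\<lambda>x. x)"
  by (simp add: linear_map_def)

lemma bilinear_map_tlift_param:
  assumes "is_vspace V" "is_vspace W" "is_vspace U" "t \<in> carrier (tensor V W)"
    and "is_vspace A" "is_vspace B"
    and "\<And>x y. x \<in> carrier A \<Longrightarrow> y \<in> carrier B \<Longrightarrow> bilinear_map V W U (\<mu> x y)"
    and "\<And>v w. v \<in> carrier V \<Longrightarrow> w \<in> carrier W \<Longrightarrow> bilinear_map A B U (\<lambda>x y. \<mu> x y v w)"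
  shows "bilinear_map A B U (\<lambda>x y. tlift V W (\<mu> x y) t)"
  unfolding bilinear_map_def
proof (intro conjI ballI)
  show "linear_map B U (\<lambda>y. tlift V W (\<mu> x y) t)" if "x \<in> carrier A" for x
    by (rule linear_map_tlift_param[OF assms(1-4)])
       (use assms that in \<open>auto simp: bilinear_map_linear(1)[OF assms(8)]\<close>)
  show "linear_map A U (\<lambda>x. tlift V W (\<mu> x y) t)" if "y \<in> carrier B" for y
    by (rule linear_map_tlift_param[OF assms(1-4)])
       (use assms that in \<open>auto simp: bilinear_map_linear(2)[OF assms(8)]\<close>)
qed

text \<open>The biproduct and \<open>tensor R kG\<close> are different records with the same carrier
  and scalar multiplication. This rule and the next three move statements between two such
  records.\<close>

lemma tensor_cong:
  assumes "carrier V = carrier V'" "scl V = scl V'" "carrier W = carrier W'" "scl W = scl W'"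
  shows "tensor V W = tensor V' W'"
  using assms tens_cong[of V V' W W'] by (simp add: tensor_def)

lemma tlift_space_cong:
  assumes "carrier V = carrier V'" "scl V = scl V'" "carrier W = carrier W'" "scl W = scl W'"
  shows "tlift V W = tlift V' W'"
  unfolding tlift_def by (intro ext) (simp add: assms(1,3) tens_cong[OF assms(2,4)])

lemma linear_map_space_cong:
  assumes "carrier V = carrier V'" "scl V = scl V'" "carrier W = carrier W'" "scl W = scl W'"
  shows "linear_map V W = linear_map V' W'"
  using assms by (simp add: linear_map_def fun_eq_iff)

lemma bilinear_map_space_cong:
  assumes "carrier V = carrier V'" "scl V = scl V'" "carrier W = carrier W'" "scl W = scl W'"
    "carrier U = carrier U'" "scl U = scl U'"
  shows "bilinear_map V W U = bilinear_map V' W' U'"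
  using assms by (simp add: bilinear_map_def linear_map_def fun_eq_iff)

section \<open>Coalgebras\<close>

lemmas tens_linear = tens_add_left tens_add_right tens_scl_left tens_scl_right tens_fscale

locale coalg =
  fixes C :: "('k::field, 'v::ab_group_add, 'm) bialg_scheme"
  assumes coalgebra: "coalgebra C"
begin

abbreviation sw :: "('v \<Rightarrow> 'v \<Rightarrow> 'u::ab_group_add) \<Rightarrow> 'v \<Rightarrow> 'u" where
  "sw \<mu> a \<equiv> tsum C C \<mu> (comult C a)"

lemma is_vspace_C [simp, intro]: "is_vspace C"
  and linear_map_comult: "linear_map C (tensor C C) (comult C)"
  and linear_map_counit: "linear_map C base (counit C)"
  using coalgebra by (simp_all add: coalgebra_def)

lemma comult_mem [simp]: "a \<in> carrier C \<Longrightarrow> comult C a \<in> carrier (tensor C C)"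
  by (rule linear_map_mem[OF linear_map_comult])

lemma tlift_comult:
  "is_vspace U \<Longrightarrow> bilinear_map C C U \<mu> \<Longrightarrow> a \<in> carrier C \<Longrightarrow> tlift C C \<mu> (comult C a) = sw \<mu> a"
  by (rule tlift_tsum) simp_all

text \<open>The presentation chosen for the comultiplication of a + b is unrelated to those chosen
  for a and b. Linearity in a is inherited from \<open>tlift\<close>, and this is where bilinearity
  of \<mu> enters.\<close>

lemma linear_map_sw:
  assumes "is_vspace U" "bilinear_map C C U \<mu>"
  shows "linear_map C U (sw \<mu>)"
proof -
  have "linear_map C U (\<lambda>a. tlift C C \<mu> (comult C a))"
    by (rule linear_map_comp[OF linear_map_comult linear_map_tlift]) (use assms in auto)
  then show ?thesis
    by (simp add: linear_map_def Pi_iff tlift_comult[OF assms] add_mem scl_mem)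
qed

lemma coalg_lin:
  "a \<in> carrier C \<Longrightarrow> b \<in> carrier C \<Longrightarrow> comult C (a + b) = comult C a + comult C b"
  "a \<in> carrier C \<Longrightarrow> comult C (scl C c a) = fscale c (comult C a)"
  "a \<in> carrier C \<Longrightarrow> b \<in> carrier C \<Longrightarrow> counit C (a + b) = counit C a + counit C b"
  "a \<in> carrier C \<Longrightarrow> counit C (scl C c a) = c * counit C a"
  using linear_map_add[OF linear_map_comult] linear_map_scl[OF linear_map_comult]
    linear_map_add[OF linear_map_counit] linear_map_scl[OF linear_map_counit] by simp_all

definition trilinear :: "('k, 'u::ab_group_add, 'l) vspace_scheme \<Rightarrow> ('v \<Rightarrow> 'v \<Rightarrow> 'v \<Rightarrow> 'u) \<Rightarrow> bool" where
  "trilinear U \<tau> \<longleftrightarrow> (\<forall>x\<in>carrier C. bilinear_map C C U (\<tau> x)) \<and>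
     (\<forall>y\<in>carrier C. \<forall>z\<in>carrier C. linear_map C U (\<lambda>x. \<tau> x y z))"

lemma trilinearI:
  assumes "\<And>y z. y \<in> carrier C \<Longrightarrow> z \<in> carrier C \<Longrightarrow> linear_map C U (\<lambda>x. \<tau> x y z)"
    and "\<And>x z. x \<in> carrier C \<Longrightarrow> z \<in> carrier C \<Longrightarrow> linear_map C U (\<lambda>y. \<tau> x y z)"
    and "\<And>x y. x \<in> carrier C \<Longrightarrow> y \<in> carrier C \<Longrightarrow> linear_map C U (\<lambda>z. \<tau> x y z)"
  shows "trilinear U \<tau>"
  using assms by (auto simp: trilinear_def bilinear_map_def)

text \<open>Coassociativity is an equation in C \<otimes> (C \<otimes> C). The map \<open>F\<close>
  that \<tau> induces on this space is linear, and it turns the two sides, once they are written as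
  Sweedler sums of pure tensors, into the two nested sums.\<close>

lemma sw_coassoc:
  assumes U: "is_vspace U" and \<tau>: "trilinear U \<tau>" and a: "a \<in> carrier C"
  shows "sw (\<lambda>x y. sw (\<lambda>x\<^sub>1 x\<^sub>2. \<tau> x\<^sub>1 x\<^sub>2 y) x) a = sw (\<lambda>x y. sw (\<lambda>y\<^sub>1 y\<^sub>2. \<tau> x y\<^sub>1 y\<^sub>2) y) a"
proof -
  let ?CC = "tensor C C"
  have \<tau>': "bilinear_map C C U (\<tau> x)" if "x \<in> carrier C" for x
    using \<tau> that by (simp add: trilinear_def)
  have bil: "bilinear_map C ?CC U (\<lambda>x t. tlift C C (\<tau> x) t)"
    by (rule bilinear_map_tlift_right[OF _ _ U _ linear_map_id \<tau>'])
       (use \<tau> in \<open>auto simp: trilinear_def\<close>)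
  define F where "F = tlift C ?CC (\<lambda>x t. tlift C C (\<tau> x) t)"
  have F: "linear_map (tensor C ?CC) U F"
    unfolding F_def by (rule linear_map_tlift[OF _ _ U bil]) auto
  have F_tens: "F (tens C ?CC x t) = tlift C C (\<tau> x) t" if "x \<in> carrier C" "t \<in> carrier ?CC" for x t
    unfolding F_def by (rule tlift_tens[OF _ _ U bil]) (use that in auto)
  have bil1: "bilinear_map C C (tensor C ?CC) (\<lambda>x\<^sub>1 x\<^sub>2. tens C ?CC x\<^sub>1 (tens C C x\<^sub>2 y))"
    if "y \<in> carrier C" for y
    by (rule bilinear_mapI) (simp_all add: that tens_mem tens_linear)
  have "tlift C C (\<lambda>x y. tlift C C (\<lambda>x\<^sub>1 x\<^sub>2. tens C ?CC x\<^sub>1 (tens C C x\<^sub>2 y)) (comult C x)) (comult C a) =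
      tlift C C (\<lambda>x y. sw (\<lambda>x\<^sub>1 x\<^sub>2. tens C ?CC x\<^sub>1 (tens C C x\<^sub>2 y)) x) (comult C a)"
    by (intro tlift_cong refl tlift_comult[OF is_vspace_tensor bil1])
  also have "\<dots> = sw (\<lambda>x y. sw (\<lambda>x\<^sub>1 x\<^sub>2. tens C ?CC x\<^sub>1 (tens C C x\<^sub>2 y)) x) a"
  proof (rule tlift_comult[OF is_vspace_tensor[of C ?CC] _ a], unfold bilinear_map_def, intro conjI ballI)
    show "linear_map C (tensor C ?CC) (\<lambda>y. sw (\<lambda>x\<^sub>1 x\<^sub>2. tens C ?CC x\<^sub>1 (tens C C x\<^sub>2 y)) x)" for x
      by (intro linear_map_tsum_param[OF is_vspace_tensor] linear_mapI) (simp_all add: tens_mem tens_linear)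
  qed (rule linear_map_sw[OF is_vspace_tensor bil1])
  also have "tlift C C (\<lambda>x y. tlift C C (\<lambda>x\<^sub>1 x\<^sub>2. tens C ?CC x\<^sub>1 (tens C C x\<^sub>2 y)) (comult C x)) (comult C a) =
      tlift C C (\<lambda>x y. tens C ?CC x (comult C y)) (comult C a)"
    using coalgebra a unfolding coalgebra_def by blast
  also have "\<dots> = sw (\<lambda>x y. tens C ?CC x (comult C y)) a"
    by (rule tlift_comult[OF is_vspace_tensor[of C ?CC] _ a], rule bilinear_mapI)
       (simp_all add: tens_mem tens_linear coalg_lin)
  finally have "F (sw (\<lambda>x y. tens C ?CC x (comult C y)) a) =
      F (sw (\<lambda>x y. sw (\<lambda>x\<^sub>1 x\<^sub>2. tens C ?CC x\<^sub>1 (tens C C x\<^sub>2 y)) x) a)" by simp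
  also have "F (sw (\<lambda>x y. tens C ?CC x (comult C y)) a) = sw (\<lambda>x y. F (tens C ?CC x (comult C y))) a"
    by (rule tsum_linear[OF F]) (simp_all add: tens_mem)
  also have "\<dots> = sw (\<lambda>x y. sw (\<tau> x) y) a"
    by (intro tsum_cong refl) (simp add: tens_mem F_tens tlift_comult[OF U \<tau>'])
  also have "F (sw (\<lambda>x y. sw (\<lambda>x\<^sub>1 x\<^sub>2. tens C ?CC x\<^sub>1 (tens C C x\<^sub>2 y)) x) a) =
      sw (\<lambda>x y. F (sw (\<lambda>x\<^sub>1 x\<^sub>2. tens C ?CC x\<^sub>1 (tens C C x\<^sub>2 y)) x)) a"
    by (rule tsum_linear[OF F]) (simp_all add: tsum_mem[OF is_vspace_tensor] tens_mem)
  also have "\<dots> = sw (\<lambda>x y. sw (\<lambda>x\<^sub>1 x\<^sub>2. \<tau> x\<^sub>1 x\<^sub>2 y) x) a"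
  proof (intro tsum_cong refl)
    fix x y assume x: "x \<in> carrier C" and y: "y \<in> carrier C"
    have "F (sw (\<lambda>x\<^sub>1 x\<^sub>2. tens C ?CC x\<^sub>1 (tens C C x\<^sub>2 y)) x) =
      sw (\<lambda>x\<^sub>1 x\<^sub>2. F (tens C ?CC x\<^sub>1 (tens C C x\<^sub>2 y))) x"
      by (rule tsum_linear[OF F]) (simp_all add: y tens_mem)
    also have "\<dots> = sw (\<lambda>x\<^sub>1 x\<^sub>2. \<tau> x\<^sub>1 x\<^sub>2 y) x"
      by (intro tsum_cong refl) (simp add: tens_mem F_tens tlift_tens[OF _ _ U \<tau>'] y)
    finally show "F (sw (\<lambda>x\<^sub>1 x\<^sub>2. tens C ?CC x\<^sub>1 (tens C C x\<^sub>2 y)) x) = \<dots>" .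
  qed
  finally show ?thesis by simp
qed

text \<open>The counit laws are the case where f is the identity. They are pushed through a linear f
  so that a scalar \<epsilon>(x) can be removed underneath an outer map.\<close>

lemma sw_counit:
  assumes U: "is_vspace U" and f: "linear_map C U f" and a: "a \<in> carrier C"
  shows "sw (\<lambda>x y. scl U (counit C x) (f y)) a = f a" "sw (\<lambda>x y. scl U (counit C y) (f x)) a = f a"
proof -
  have 1: "sw (\<lambda>x y. scl C (counit C x) y) a = a"
    using coalgebra a unfolding coalgebra_def
    by (subst tlift_comult[symmetric, OF is_vspace_C _ a])
       (auto intro!: bilinear_mapI simp: coalg_lin scl_mem scl_add_left scl_add_right scl_scl mult.commute)
  have 2: "sw (\<lambda>x y. scl C (counit C y) x) a = a"
    using coalgebra a unfolding coalgebra_def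
    by (subst tlift_comult[symmetric, OF is_vspace_C _ a])
       (auto intro!: bilinear_mapI simp: coalg_lin scl_mem scl_add_left scl_add_right scl_scl mult.commute)
  have "f a = f (sw (\<lambda>x y. scl C (counit C x) y) a)" by (simp add: 1)
  also have "\<dots> = sw (\<lambda>x y. f (scl C (counit C x) y)) a"
    by (rule tsum_linear[OF f]) (simp_all add: scl_mem)
  also have "\<dots> = sw (\<lambda>x y. scl U (counit C x) (f y)) a"
    by (intro tsum_cong refl) (simp add: linear_map_scl[OF f])
  finally show "sw (\<lambda>x y. scl U (counit C x) (f y)) a = f a" by simp
  have "f a = f (sw (\<lambda>x y. scl C (counit C y) x) a)" by (simp add: 2)
  also have "\<dots> = sw (\<lambda>x y. f (scl C (counit C y) x)) a"
    by (rule tsum_linear[OF f]) (simp_all add: scl_mem)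
  also have "\<dots> = sw (\<lambda>x y. scl U (counit C y) (f x)) a"
    by (intro tsum_cong refl) (simp add: linear_map_scl[OF f])
  finally show "sw (\<lambda>x y. scl U (counit C y) (f x)) a = f a" by simp
qed

end

text \<open>Uniqueness of inverses in the convolution algebra:
  \<open>S' = (S * id) * S' = S * (id * S') = S\<close>, with coassociativity as the change of
  bracketing. This identifies the arbitrary choice in \<open>antipode\<close> with any antipode
  written down explicitly.\<close>

lemma antipode_unique:
  fixes H :: "('k::field, 'v::ab_group_add, 'm) bialg_scheme"
  assumes alg: "unital_algebra H" and coalg: "coalgebra H"
    and S: "is_antipode H S" and S': "is_antipode H S'" and a: "a \<in> carrier H"
  shows "S a = S' a"
proof -
  interpret coalg H by unfold_locales (rule coalg)
  have mul: "bilinear_map H H H (amult H)" and unit: "aunit H \<in> carrier H"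
    and assoc: "\<And>x y z. x \<in> carrier H \<Longrightarrow> y \<in> carrier H \<Longrightarrow> z \<in> carrier H \<Longrightarrow>
      (x \<bullet>\<^bsub>H\<^esub> y) \<bullet>\<^bsub>H\<^esub> z = x \<bullet>\<^bsub>H\<^esub> (y \<bullet>\<^bsub>H\<^esub> z)"
    and one: "\<And>x. x \<in> carrier H \<Longrightarrow> aunit H \<bullet>\<^bsub>H\<^esub> x = x" "\<And>x. x \<in> carrier H \<Longrightarrow> x \<bullet>\<^bsub>H\<^esub> aunit H = x"
    using alg by (auto simp: unital_algebra_def)
  note mulL = bilinear_map_linear(1)[OF mul] and mulR = bilinear_map_linear(2)[OF mul]
  have linS: "linear_map H H S" and linS': "linear_map H H S'"
    using S S' by (auto simp: is_antipode_def)
  note mem = linear_map_mem[OF linS] linear_map_mem[OF linS'] linear_map_mem[OF mulL]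
  have conv: "sw (\<lambda>x y. S x \<bullet>\<^bsub>H\<^esub> y) b = scl H (counit H b) (aunit H)"
      "sw (\<lambda>x y. x \<bullet>\<^bsub>H\<^esub> S' y) b = scl H (counit H b) (aunit H)" if b: "b \<in> carrier H" for b
  proof -
    have 1: "bilinear_map H H H (\<lambda>x y. S x \<bullet>\<^bsub>H\<^esub> y)"
      unfolding bilinear_map_def
      by (intro conjI ballI mulL[OF mem(1)] linear_map_comp[OF linS mulR])
    have 2: "bilinear_map H H H (\<lambda>x y. x \<bullet>\<^bsub>H\<^esub> S' y)"
      unfolding bilinear_map_def
      by (intro conjI ballI mulR[OF mem(2)] linear_map_comp[OF linS' mulL])
    show "sw (\<lambda>x y. S x \<bullet>\<^bsub>H\<^esub> y) b = scl H (counit H b) (aunit H)"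
      "sw (\<lambda>x y. x \<bullet>\<^bsub>H\<^esub> S' y) b = scl H (counit H b) (aunit H)"
      using S S' b tlift_comult[OF is_vspace_C 1 b] tlift_comult[OF is_vspace_C 2 b]
      by (simp_all add: is_antipode_def)
  qed
  have tri: "trilinear H (\<lambda>x y z. S x \<bullet>\<^bsub>H\<^esub> (y \<bullet>\<^bsub>H\<^esub> S' z))"
    by (rule trilinearI)
      (rule linear_map_comp[OF linS mulR] linear_map_comp[OF mulR mulL]
        linear_map_comp[OF linear_map_comp[OF linS' mulL] mulL]; simp add: mem)+
  have "S' a = sw (\<lambda>x y. scl H (counit H x) (S' y)) a"
    by (rule sw_counit(1)[OF _ linS' a, symmetric]) simp
  also have "\<dots> = sw (\<lambda>x y. sw (\<lambda>x\<^sub>1 x\<^sub>2. S x\<^sub>1 \<bullet>\<^bsub>H\<^esub> (x\<^sub>2 \<bullet>\<^bsub>H\<^esub> S' y)) x) a"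
  proof (intro tsum_cong refl)
    fix x y assume x: "x \<in> carrier H" and y: "y \<in> carrier H"
    have "sw (\<lambda>x\<^sub>1 x\<^sub>2. S x\<^sub>1 \<bullet>\<^bsub>H\<^esub> (x\<^sub>2 \<bullet>\<^bsub>H\<^esub> S' y)) x = sw (\<lambda>x\<^sub>1 x\<^sub>2. (S x\<^sub>1 \<bullet>\<^bsub>H\<^esub> x\<^sub>2) \<bullet>\<^bsub>H\<^esub> S' y) x"
      by (intro tsum_cong refl) (simp add: assoc mem y)
    also have "\<dots> = sw (\<lambda>x\<^sub>1 x\<^sub>2. S x\<^sub>1 \<bullet>\<^bsub>H\<^esub> x\<^sub>2) x \<bullet>\<^bsub>H\<^esub> S' y"
      by (rule tsum_linear[OF mulR, symmetric]) (simp_all add: mem y)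
    also have "\<dots> = scl H (counit H x) (S' y)"
      using linear_map_scl[OF mulR[OF mem(2)[OF y]] unit] by (simp add: conv x y one mem)
    finally show "scl H (counit H x) (S' y) = sw (\<lambda>x\<^sub>1 x\<^sub>2. S x\<^sub>1 \<bullet>\<^bsub>H\<^esub> (x\<^sub>2 \<bullet>\<^bsub>H\<^esub> S' y)) x" by simp
  qed
  also have "\<dots> = sw (\<lambda>x y. sw (\<lambda>y\<^sub>1 y\<^sub>2. S x \<bullet>\<^bsub>H\<^esub> (y\<^sub>1 \<bullet>\<^bsub>H\<^esub> S' y\<^sub>2)) y) a"
    by (rule sw_coassoc[OF _ tri a]) simp
  also have "\<dots> = sw (\<lambda>x y. scl H (counit H y) (S x)) a"
  proof (intro tsum_cong refl)
    fix x y assume x: "x \<in> carrier H" and y: "y \<in> carrier H"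
    have "sw (\<lambda>y\<^sub>1 y\<^sub>2. S x \<bullet>\<^bsub>H\<^esub> (y\<^sub>1 \<bullet>\<^bsub>H\<^esub> S' y\<^sub>2)) y = S x \<bullet>\<^bsub>H\<^esub> sw (\<lambda>y\<^sub>1 y\<^sub>2. y\<^sub>1 \<bullet>\<^bsub>H\<^esub> S' y\<^sub>2) y"
      by (rule tsum_linear[OF mulL, symmetric]) (simp_all add: mem x)
    also have "\<dots> = scl H (counit H y) (S x)"
      using linear_map_scl[OF mulL[OF mem(1)[OF x]] unit] by (simp add: conv x y one mem)
    finally show "sw (\<lambda>y\<^sub>1 y\<^sub>2. S x \<bullet>\<^bsub>H\<^esub> (y\<^sub>1 \<bullet>\<^bsub>H\<^esub> S' y\<^sub>2)) y = scl H (counit H y) (S x)" .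
  qed
  also have "\<dots> = S a"
    by (rule sw_counit(2)[OF _ linS a]) simp
  finally show ?thesis by simp
qed

section \<open>Coordinates with respect to a finite group\<close>

lemma carrier_group_algebra: "carrier (group_algebra G) = {f. \<forall>x. x \<notin> carrier G \<longrightarrow> f x = 0}"
  and scl_group_algebra [simp]: "scl (group_algebra G) = fscale"
  by (simp_all add: group_algebra_def functions_on_def)

lemma is_vspace_group_algebra [simp, intro]: "is_vspace (group_algebra G)"
  unfolding is_vspace_def
  by (auto simp: vector_space_fscale module.subspace_def module_iff_vector_space
      carrier_group_algebra fscale_def)

lemma gel_mem [simp]: "g \<in> carrier G \<Longrightarrow> gel g \<in> carrier (group_algebra G)"
  by (auto simp: carrier_group_algebra gel_def)

lemma sum_fun_apply: "(\<Sum>i\<in>I. f i) x = (\<Sum>i\<in>I. f i x)"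
  by (induction I rule: infinite_finite_induct) simp_all

lemma gel_apply: "gel g h = (if h = g then 1 else 0)"
  by (simp add: gel_def)

locale fin_group = group G for G (structure) +
  assumes fin [simp]: "finite (carrier G)"
begin

lemma sum_gel: "g \<in> carrier G \<Longrightarrow> (\<Sum>h\<in>carrier G. fscale (gel g h) (f h)) = f g"
  by (subst sum.cong[OF refl, of _ _ "\<lambda>h. if h = g then f h else 0"]) (auto simp: gel_def)

lemma sum_gel_scl:
  assumes "is_vspace V" "g \<in> carrier G"
  shows "(\<Sum>h\<in>carrier G. scl V (gel g h) (f h)) = f g"
  by (subst sum.cong[OF refl, of _ _ "\<lambda>h. if h = g then f h else 0"])
     (use assms in \<open>auto simp: gel_def scl_zero_left scl_one\<close>)

lemma gel_expand:
  assumes "x \<in> carrier (group_algebra G)"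
  shows "x = (\<Sum>g\<in>carrier G. fscale (x g) (gel g))"
proof
  fix h
  have "(\<Sum>g\<in>carrier G. fscale (x g) (gel g)) h = (\<Sum>g\<in>carrier G. fscale (x g) (gel g) h)"
    by (rule sum_fun_apply)
  also have "\<dots> = (\<Sum>g\<in>carrier G. if g = h then x g else 0)"
    by (intro sum.cong) (auto simp: fscale_def gel_def)
  also have "\<dots> = x h"
    using assms by (auto simp: carrier_group_algebra)
  finally show "x h = (\<Sum>g\<in>carrier G. fscale (x g) (gel g)) h" by simp
qed

lemma group_algebra_mult_gel:
  assumes "g \<in> carrier G" "h \<in> carrier G"
  shows "gel g \<bullet>\<^bsub>group_algebra G\<^esub> gel h = gel (g \<otimes> h)"
proof -
  have "gel g \<bullet>\<^bsub>group_algebra G\<^esub> gel h =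
    (\<Sum>x\<in>carrier G. fscale (gel g x) (\<Sum>y\<in>carrier G. fscale (gel h y) (gel (x \<otimes> y))))"
    by (simp add: group_algebra_def fscale_sum)
  then show ?thesis using assms by (simp add: sum_gel)
qed

lemma bilinear_map_group_algebra_mult:
  "bilinear_map (group_algebra G) (group_algebra G) (group_algebra G) (amult (group_algebra G))"
  by (rule bilinear_mapI)
     (auto simp: group_algebra_def[of G] sum.distrib[symmetric] fscale_sum fscale_add_left[symmetric]
        functions_on_def gel_def fscale_apply sum_fun_apply algebra_simps
      intro!: sum.cong sum.neutral)


lemma group_algebra_comult:
  "comult (group_algebra G) f =
    (\<Sum>x\<in>carrier G. fscale (f x) (tens (group_algebra G) (group_algebra G) (gel x) (gel x)))"
proof -
  have eq: "tens (functions_on (carrier G)) (functions_on (carrier G)) =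
      tens (group_algebra G) (group_algebra G)"
    by (rule tens_cong) (simp_all add: functions_on_def)
  show ?thesis unfolding eq[symmetric] by (simp add: group_algebra_def[of G])
qed

lemma group_algebra_comult_gel:
  assumes "g \<in> carrier G"
  shows "comult (group_algebra G) (gel g) = tens (group_algebra G) (group_algebra G) (gel g) (gel g)"
  using assms by (simp add: group_algebra_comult sum_gel)

lemma linear_map_group_algebra_comult:
  "linear_map (group_algebra G) (tensor (group_algebra G) (group_algebra G)) (comult (group_algebra G))"
proof (rule linear_mapI)
  show "comult (group_algebra G) x \<in> carrier (tensor (group_algebra G) (group_algebra G))"
    for x :: "_ \<Rightarrow> 'k::field"
    unfolding group_algebra_comult
    by (intro sum_mem[OF is_vspace_tensor] scl_mem[OF is_vspace_tensor, unfolded scl_tensor] tens_mem)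
       simp_all
qed (simp_all add: group_algebra_comult fscale_add_left sum.distrib fscale_sum fscale_apply)

lemma group_algebra_counit_gel: "g \<in> carrier G \<Longrightarrow> counit (group_algebra G) (gel g) = 1"
  by (simp add: group_algebra_def gel_def)

lemma linear_map_group_algebra_counit: "linear_map (group_algebra G) base (counit (group_algebra G))"
  by (rule linear_mapI) (simp_all add: group_algebra_def sum.distrib fscale_apply sum_distrib_left)

section \<open>Coordinates in tensor products with the group algebra\<close>

text \<open>As G is a basis of kG, an element of kG \<otimes> V amounts to a family in V indexed by
  G. This is its member at g, obtained by evaluating the first factor at g; \<open>rcoord\<close>
  does the same in V \<otimes> kG.\<close>

definition lcoord :: "('k::field, 'v::ab_group_add, 'm) vspace_scheme \<Rightarrow> 'a \<Rightarrow>
    ('k, 'a \<Rightarrow> 'k, 'v) tensor \<Rightarrow> 'v" where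
  "lcoord V g = tlift (group_algebra G) V (\<lambda>x b. scl V (x g) b)"

definition rcoord :: "('k::field, 'v::ab_group_add, 'm) vspace_scheme \<Rightarrow> 'a \<Rightarrow>
    ('k, 'v, 'a \<Rightarrow> 'k) tensor \<Rightarrow> 'v" where
  "rcoord V g = tlift V (group_algebra G) (\<lambda>b x. scl V (x g) b)"

context
  fixes V :: "('k::field, 'v::ab_group_add, 'm) vspace_scheme"
  assumes V: "is_vspace V"
begin

lemma bilinear_map_coord:
  "bilinear_map (group_algebra G) V V (\<lambda>x b. scl V (x g) b)"
  "bilinear_map V (group_algebra G) V (\<lambda>b x. scl V (x g) b)"
  by (rule bilinear_mapI;
      simp add: scl_mem[OF V] scl_add_left[OF V] scl_add_right[OF V] scl_scl[OF V]
        fscale_apply mult.commute)+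

lemma linear_map_lcoord: "linear_map (tensor (group_algebra G) V) V (lcoord V g)"
  unfolding lcoord_def
  by (rule linear_map_tlift[OF is_vspace_group_algebra V V bilinear_map_coord(1)])

lemma linear_map_rcoord: "linear_map (tensor V (group_algebra G)) V (rcoord V g)"
  unfolding rcoord_def
  by (rule linear_map_tlift[OF V is_vspace_group_algebra V bilinear_map_coord(2)])

lemma lcoord_mem: "t \<in> carrier (tensor (group_algebra G) V) \<Longrightarrow> lcoord V g t \<in> carrier V"
  by (rule linear_map_mem[OF linear_map_lcoord])

lemma rcoord_mem: "t \<in> carrier (tensor V (group_algebra G)) \<Longrightarrow> rcoord V g t \<in> carrier V"
  by (rule linear_map_mem[OF linear_map_rcoord])

lemma lcoord_tens:
  "x \<in> carrier (group_algebra G) \<Longrightarrow> b \<in> carrier V \<Longrightarrow>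
    lcoord V g (tens (group_algebra G) V x b) = scl V (x g) b"
  unfolding lcoord_def by (rule tlift_tens[OF is_vspace_group_algebra V V bilinear_map_coord(1)])

lemma rcoord_tens:
  "x \<in> carrier (group_algebra G) \<Longrightarrow> b \<in> carrier V \<Longrightarrow>
    rcoord V g (tens V (group_algebra G) b x) = scl V (x g) b"
  unfolding rcoord_def by (rule tlift_tens[OF V is_vspace_group_algebra V bilinear_map_coord(2)])

text \<open>On a presentation with terms x \<otimes> b, the scalar x(g) is carried from b over to
  the basis element g; summing over g then restores x in the first factor.\<close>

lemma lcoord_expand:
  assumes t: "t \<in> carrier (tensor (group_algebra G) V)"
  shows "t = (\<Sum>g\<in>carrier G. tens (group_algebra G) V (gel g) (lcoord V g t))"
proof -
  let ?K = "group_algebra G :: ('k, _) bialg"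
  have "tens ?K V (gel g) (lcoord V g t) = tsum ?K V (\<lambda>x b. tens ?K V (fscale (x g) (gel g)) b) t"
    if "g \<in> carrier G" for g
  proof -
    have "tens ?K V (gel g) (lcoord V g t) =
        tens ?K V (gel g) (tsum ?K V (\<lambda>x b. scl V (x g) b) t)"
      unfolding lcoord_def
      by (subst tlift_tsum[OF is_vspace_group_algebra V V bilinear_map_coord(1) t]) simp
    also have "\<dots> = tsum ?K V (\<lambda>x b. tens ?K V (gel g) (scl V (x g) b)) t"
      by (rule tsum_linear[OF bilinear_map_linear(1)[OF bilinear_map_tens]])
         (use that V in \<open>auto simp: scl_mem\<close>)
    finally show ?thesis
      by (simp only: tens_scl_right tens_scl_left[of ?K, unfolded scl_group_algebra])
  qed
  then have "(\<Sum>g\<in>carrier G. tens ?K V (gel g) (lcoord V g t)) =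
      tsum ?K V (\<lambda>x b. tens ?K V (\<Sum>g\<in>carrier G. fscale (x g) (gel g)) b) t"
    by (simp add: tsum_sum tens_sum_left)
  also have "\<dots> = tsum ?K V (tens ?K V) t"
    by (rule tsum_cong) (simp_all add: gel_expand[symmetric])
  finally show ?thesis by (simp add: tsum_tens t)
qed

lemma rcoord_expand:
  assumes t: "t \<in> carrier (tensor V (group_algebra G))"
  shows "t = (\<Sum>g\<in>carrier G. tens V (group_algebra G) (rcoord V g t) (gel g))"
proof -
  let ?K = "group_algebra G :: ('k, _) bialg"
  have "tens V ?K (rcoord V g t) (gel g) = tsum V ?K (\<lambda>b x. tens V ?K b (fscale (x g) (gel g))) t"
    if "g \<in> carrier G" for g
  proof -
    have "tens V ?K (rcoord V g t) (gel g) =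
        tens V ?K (tsum V ?K (\<lambda>b x. scl V (x g) b) t) (gel g)"
      unfolding rcoord_def
      by (subst tlift_tsum[OF V is_vspace_group_algebra V bilinear_map_coord(2) t]) simp
    also have "\<dots> = tsum V ?K (\<lambda>b x. tens V ?K (scl V (x g) b) (gel g)) t"
      by (rule tsum_linear[OF bilinear_map_linear(2)[OF bilinear_map_tens]])
         (use that V in \<open>auto simp: scl_mem\<close>)
    finally show ?thesis
      by (simp only: tens_scl_left tens_scl_right[of _ ?K, unfolded scl_group_algebra])
  qed
  then have "(\<Sum>g\<in>carrier G. tens V ?K (rcoord V g t) (gel g)) =
      tsum V ?K (\<lambda>b x. tens V ?K b (\<Sum>g\<in>carrier G. fscale (x g) (gel g))) t"
    by (simp add: tsum_sum tens_sum_right)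
  also have "\<dots> = tsum V ?K (tens V ?K) t"
    by (rule tsum_cong) (simp_all add: gel_expand[symmetric])
  finally show ?thesis by (simp add: tsum_tens V t)
qed

text \<open>Coefficients of an expansion along G are determined by the tensor. Comparing them turns
  axioms for the coaction into componentwise equations.\<close>

lemma lcoord_sum:
  assumes "g \<in> carrier G" "\<And>h. h \<in> carrier G \<Longrightarrow> b h \<in> carrier V"
  shows "lcoord V g (\<Sum>h\<in>carrier G. tens (group_algebra G) V (gel h) (b h)) = b g"
proof -
  have "lcoord V g (\<Sum>h\<in>carrier G. tens (group_algebra G) V (gel h) (b h)) =
      (\<Sum>h\<in>carrier G. scl V (gel h g) (b h))"
    using assms
    by (subst linear_map_sum[OF is_vspace_tensor linear_map_lcoord])
       (auto simp: tens_mem lcoord_tens intro!: sum.cong)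
  then show ?thesis
    using assms(1) by (simp add: gel_apply scl_delta(2)[OF V])
qed

text \<open>Replaces a lift over kG \<otimes> V by a finite sum over G, so that an integrand matters
  only at group elements.\<close>

lemma tlift_lcoord:
  assumes U: "is_vspace U" and \<mu>: "bilinear_map (group_algebra G) V U \<mu>"
    and t: "t \<in> carrier (tensor (group_algebra G) V)"
  shows "tlift (group_algebra G) V \<mu> t = (\<Sum>g\<in>carrier G. \<mu> (gel g) (lcoord V g t))"
proof -
  have "tlift (group_algebra G) V \<mu> t =
      tlift (group_algebra G) V \<mu> (\<Sum>g\<in>carrier G. tens (group_algebra G) V (gel g) (lcoord V g t))"
    using lcoord_expand[OF t] by simp
  also have "\<dots> = (\<Sum>g\<in>carrier G. \<mu> (gel g) (lcoord V g t))"
    by (subst linear_map_sum[OF is_vspace_tensor linear_map_tlift[OF is_vspace_group_algebra V U \<mu>]])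
       (auto simp: tens_mem lcoord_mem t tlift_tens[OF is_vspace_group_algebra V U \<mu>] intro!: sum.cong)
  finally show ?thesis .
qed

lemma tlift_rcoord:
  assumes U: "is_vspace U" and \<mu>: "bilinear_map V (group_algebra G) U \<mu>"
    and t: "t \<in> carrier (tensor V (group_algebra G))"
  shows "tlift V (group_algebra G) \<mu> t = (\<Sum>g\<in>carrier G. \<mu> (rcoord V g t) (gel g))"
proof -
  have "tlift V (group_algebra G) \<mu> t =
      tlift V (group_algebra G) \<mu> (\<Sum>g\<in>carrier G. tens V (group_algebra G) (rcoord V g t) (gel g))"
    using rcoord_expand[OF t] by simp
  also have "\<dots> = (\<Sum>g\<in>carrier G. \<mu> (rcoord V g t) (gel g))"
    by (subst linear_map_sum[OF is_vspace_tensor linear_map_tlift[OF V is_vspace_group_algebra U \<mu>]])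
       (auto simp: tens_mem rcoord_mem t tlift_tens[OF V is_vspace_group_algebra U \<mu>] intro!: sum.cong)
  finally show ?thesis .
qed

end

end

section \<open>Braided Hopf algebras in terms of homogeneous components\<close>

lemma (in group) inv_cancel [simp]:
  "g \<in> carrier G \<Longrightarrow> h \<in> carrier G \<Longrightarrow> g \<otimes> (inv g \<otimes> h) = h"
  "g \<in> carrier G \<Longrightarrow> h \<in> carrier G \<Longrightarrow> inv g \<otimes> (g \<otimes> h) = h"
  by (simp_all add: m_assoc[symmetric])

locale braided_hopf =
  fixes G :: "('g, 'n) monoid_scheme" (structure)
    and R :: "('k::field, 'v::ab_group_add, 'g, 'm) braided_scheme"
  assumes braided: "braided_hopf_algebra G R"

sublocale braided_hopf \<subseteq> fin_group G
  using braided by (simp add: braided_hopf_algebra_def fin_group_def fin_group_axioms_def)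

context braided_hopf
begin

abbreviation kG :: "('k, 'g \<Rightarrow> 'k) bialg" where "kG \<equiv> group_algebra G"
abbreviation mul :: "'v \<Rightarrow> 'v \<Rightarrow> 'v" (infixl \<open>\<cdot>\<close> 70) where "mul \<equiv> amult R"
abbreviation \<Delta> where "\<Delta> \<equiv> comult R"
abbreviation \<epsilon> where "\<epsilon> \<equiv> counit R"
abbreviation e where "e \<equiv> aunit R"
abbreviation \<rho> where "\<rho> \<equiv> coact R"
abbreviation sw :: "('v \<Rightarrow> 'v \<Rightarrow> 'u::ab_group_add) \<Rightarrow> 'v \<Rightarrow> 'u" where "sw \<mu> a \<equiv> tsum R R \<mu> (\<Delta> a)"

definition pr :: "'g \<Rightarrow> 'v \<Rightarrow> 'v" where "pr g a = lcoord R g (\<rho> a)"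

lemma yd: "yetter_drinfeld G R" and yd_alg: "yd_algebra G R" and yd_coalg: "yd_coalgebra G R"
  using braided by (simp_all add: braided_hopf_algebra_def)

lemmas yd_unfolded = yd[unfolded yetter_drinfeld_def Let_def]
lemmas yd_alg_unfolded = yd_alg[unfolded yd_algebra_def unital_algebra_def Let_def]
lemmas yd_coalg_unfolded = yd_coalg[unfolded yd_coalgebra_def coalgebra_def Let_def]

lemma is_vspace_R [simp, intro]: "is_vspace R"
  using yd_unfolded by blast

lemma linear_map_act: "g \<in> carrier G \<Longrightarrow> linear_map R R (act R g)"
  and act_one [simp]: "a \<in> carrier R \<Longrightarrow> act R \<one> a = a"
  and act_act: "g \<in> carrier G \<Longrightarrow> h \<in> carrier G \<Longrightarrow> a \<in> carrier R \<Longrightarrow>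
    act R g (act R h a) = act R (g \<otimes> h) a"
  and linear_map_coact: "linear_map R (tensor kG R) \<rho>"
  using yd_unfolded by simp_all

lemma bilinear_map_mul: "bilinear_map R R R mul"
  and unit_mem [simp]: "e \<in> carrier R"
  and mul_assoc: "a \<in> carrier R \<Longrightarrow> b \<in> carrier R \<Longrightarrow> c \<in> carrier R \<Longrightarrow> (a \<cdot> b) \<cdot> c = a \<cdot> (b \<cdot> c)"
  and unit_left [simp]: "a \<in> carrier R \<Longrightarrow> e \<cdot> a = a"
  and unit_right [simp]: "a \<in> carrier R \<Longrightarrow> a \<cdot> e = a"
  and act_mul: "g \<in> carrier G \<Longrightarrow> a \<in> carrier R \<Longrightarrow> b \<in> carrier R \<Longrightarrow>
    act R g (a \<cdot> b) = act R g a \<cdot> act R g b"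
  and act_unit [simp]: "g \<in> carrier G \<Longrightarrow> act R g e = e"
  using yd_alg_unfolded by simp_all

lemma linear_map_comult: "linear_map R (tensor R R) \<Delta>"
  and linear_map_counit: "linear_map R base \<epsilon>"
  and counit_act [simp]: "g \<in> carrier G \<Longrightarrow> a \<in> carrier R \<Longrightarrow> \<epsilon> (act R g a) = \<epsilon> a"
  using yd_coalg_unfolded by simp_all

lemma counit_mul [simp]: "a \<in> carrier R \<Longrightarrow> b \<in> carrier R \<Longrightarrow> \<epsilon> (a \<cdot> b) = \<epsilon> a * \<epsilon> b"
  and comult_unit: "\<Delta> e = tens R R e e"
  and counit_unit [simp]: "\<epsilon> e = 1"
  using braided by (simp_all add: braided_hopf_algebra_def)

lemmas bilinear_map_kG_mult = bilinear_map_group_algebra_mult[where 'c = 'k]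

lemma linear_map_pr: "linear_map R R (pr g)"
  unfolding pr_def by (rule linear_map_comp[OF linear_map_coact linear_map_lcoord]) simp

lemma mem [simp]:
  "g \<in> carrier G \<Longrightarrow> a \<in> carrier R \<Longrightarrow> act R g a \<in> carrier R"
  "a \<in> carrier R \<Longrightarrow> b \<in> carrier R \<Longrightarrow> a \<cdot> b \<in> carrier R"
  "a \<in> carrier R \<Longrightarrow> pr g a \<in> carrier R"
  "a \<in> carrier R \<Longrightarrow> \<rho> a \<in> carrier (tensor kG R)"
  "a \<in> carrier R \<Longrightarrow> \<Delta> a \<in> carrier (tensor R R)"
  "0 \<in> carrier R" "a \<in> carrier R \<Longrightarrow> scl R c a \<in> carrier R"
  "a \<in> carrier R \<Longrightarrow> b \<in> carrier R \<Longrightarrow> a + b \<in> carrier R"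
  using linear_map_mem[OF linear_map_act] linear_map_mem[OF linear_map_pr]
    linear_map_mem[OF linear_map_coact] linear_map_mem[OF linear_map_comult]
    linear_map_mem[OF bilinear_map_linear(1)[OF bilinear_map_mul]]
    zero_mem[OF is_vspace_R] scl_mem[OF is_vspace_R] add_mem[OF is_vspace_R] by auto

lemmas R_sum_mem = sum_mem[OF is_vspace_R]

lemma lin:
  "g \<in> carrier G \<Longrightarrow> a \<in> carrier R \<Longrightarrow> b \<in> carrier R \<Longrightarrow> act R g (a + b) = act R g a + act R g b"
  "g \<in> carrier G \<Longrightarrow> a \<in> carrier R \<Longrightarrow> act R g (scl R c a) = scl R c (act R g a)"
  "a \<in> carrier R \<Longrightarrow> b \<in> carrier R \<Longrightarrow> pr h (a + b) = pr h a + pr h b"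
  "a \<in> carrier R \<Longrightarrow> pr h (scl R c a) = scl R c (pr h a)"
  "a \<in> carrier R \<Longrightarrow> b \<in> carrier R \<Longrightarrow> \<rho> (a + b) = \<rho> a + \<rho> b"
  "a \<in> carrier R \<Longrightarrow> \<rho> (scl R c a) = fscale c (\<rho> a)"
  "a \<in> carrier R \<Longrightarrow> b \<in> carrier R \<Longrightarrow> \<Delta> (a + b) = \<Delta> a + \<Delta> b"
  "a \<in> carrier R \<Longrightarrow> \<Delta> (scl R c a) = fscale c (\<Delta> a)"
  "a \<in> carrier R \<Longrightarrow> b \<in> carrier R \<Longrightarrow> \<epsilon> (a + b) = \<epsilon> a + \<epsilon> b"
  "a \<in> carrier R \<Longrightarrow> \<epsilon> (scl R c a) = c * \<epsilon> a"
  "a \<in> carrier R \<Longrightarrow> b \<in> carrier R \<Longrightarrow> d \<in> carrier R \<Longrightarrow> (a + b) \<cdot> d = a \<cdot> d + b \<cdot> d"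
  "a \<in> carrier R \<Longrightarrow> b \<in> carrier R \<Longrightarrow> d \<in> carrier R \<Longrightarrow> d \<cdot> (a + b) = d \<cdot> a + d \<cdot> b"
  "a \<in> carrier R \<Longrightarrow> d \<in> carrier R \<Longrightarrow> scl R c a \<cdot> d = scl R c (a \<cdot> d)"
  "a \<in> carrier R \<Longrightarrow> d \<in> carrier R \<Longrightarrow> d \<cdot> scl R c a = scl R c (d \<cdot> a)"
  using linear_map_add[OF linear_map_act] linear_map_scl[OF linear_map_act]
    linear_map_add[OF linear_map_pr] linear_map_scl[OF linear_map_pr]
    linear_map_add[OF linear_map_coact] linear_map_scl[OF linear_map_coact]
    linear_map_add[OF linear_map_comult] linear_map_scl[OF linear_map_comult]
    linear_map_add[OF linear_map_counit] linear_map_scl[OF linear_map_counit]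
    linear_map_add[OF bilinear_map_linear(1)[OF bilinear_map_mul]]
    linear_map_scl[OF bilinear_map_linear(1)[OF bilinear_map_mul]]
    linear_map_add[OF bilinear_map_linear(2)[OF bilinear_map_mul]]
    linear_map_scl[OF bilinear_map_linear(2)[OF bilinear_map_mul]]
  by simp_all

lemma mul_sum:
  "d \<in> carrier R \<Longrightarrow> (\<And>i. i \<in> I \<Longrightarrow> f i \<in> carrier R) \<Longrightarrow> d \<cdot> (\<Sum>i\<in>I. f i) = (\<Sum>i\<in>I. d \<cdot> f i)"
  "d \<in> carrier R \<Longrightarrow> (\<And>i. i \<in> I \<Longrightarrow> f i \<in> carrier R) \<Longrightarrow> (\<Sum>i\<in>I. f i) \<cdot> d = (\<Sum>i\<in>I. f i \<cdot> d)"
  using linear_map_sum[OF is_vspace_R bilinear_map_linear(1)[OF bilinear_map_mul]]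
    linear_map_sum[OF is_vspace_R bilinear_map_linear(2)[OF bilinear_map_mul]] by blast+

lemma zero_simps [simp]:
  "g \<in> carrier G \<Longrightarrow> act R g 0 = 0" "pr h 0 = 0" "\<epsilon> 0 = 0" "\<Delta> 0 = 0"
  "a \<in> carrier R \<Longrightarrow> 0 \<cdot> a = 0" "a \<in> carrier R \<Longrightarrow> a \<cdot> 0 = 0"
  using linear_map_zero[OF is_vspace_R linear_map_act] linear_map_zero[OF is_vspace_R linear_map_pr]
    linear_map_zero[OF is_vspace_R linear_map_counit]
    linear_map_zero[OF is_vspace_R linear_map_comult]
    linear_map_zero[OF is_vspace_R bilinear_map_linear(1)[OF bilinear_map_mul]]
    linear_map_zero[OF is_vspace_R bilinear_map_linear(2)[OF bilinear_map_mul]]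
  by auto

lemma kG_mem [simp]:
  "x \<in> carrier kG \<Longrightarrow> y \<in> carrier kG \<Longrightarrow> x \<bullet>\<^bsub>kG\<^esub> y \<in> carrier kG"
  "x \<in> carrier kG \<Longrightarrow> y \<in> carrier kG \<Longrightarrow> x + y \<in> carrier kG"
  "x \<in> carrier kG \<Longrightarrow> fscale c x \<in> carrier kG"
  using linear_map_mem[OF bilinear_map_linear(1)[OF bilinear_map_kG_mult]]
    add_mem[OF is_vspace_group_algebra] scl_mem[OF is_vspace_group_algebra] by auto

lemma kG_lin:
  "x \<in> carrier kG \<Longrightarrow> y \<in> carrier kG \<Longrightarrow> z \<in> carrier kG \<Longrightarrow> (x + y) \<bullet>\<^bsub>kG\<^esub> z = x \<bullet>\<^bsub>kG\<^esub> z + y \<bullet>\<^bsub>kG\<^esub> z"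
  "x \<in> carrier kG \<Longrightarrow> y \<in> carrier kG \<Longrightarrow> z \<in> carrier kG \<Longrightarrow> z \<bullet>\<^bsub>kG\<^esub> (x + y) = z \<bullet>\<^bsub>kG\<^esub> x + z \<bullet>\<^bsub>kG\<^esub> y"
  "x \<in> carrier kG \<Longrightarrow> z \<in> carrier kG \<Longrightarrow> fscale c x \<bullet>\<^bsub>kG\<^esub> z = fscale c (x \<bullet>\<^bsub>kG\<^esub> z)"
  "x \<in> carrier kG \<Longrightarrow> z \<in> carrier kG \<Longrightarrow> z \<bullet>\<^bsub>kG\<^esub> fscale c x = fscale c (z \<bullet>\<^bsub>kG\<^esub> x)"
  using linear_map_add[OF bilinear_map_linear(1)[OF bilinear_map_kG_mult]]
    linear_map_scl[OF bilinear_map_linear(1)[OF bilinear_map_kG_mult]]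
    linear_map_add[OF bilinear_map_linear(2)[OF bilinear_map_kG_mult]]
    linear_map_scl[OF bilinear_map_linear(2)[OF bilinear_map_kG_mult]]
  by simp_all

lemma tens_kG: "tens kG V (fscale c x) w = fscale c (tens kG V x w)"
  "tens V kG w (fscale c x) = fscale c (tens V kG w x)"
  using tens_scl_left[of kG] tens_scl_right[of _ kG] by simp_all

lemmas tens_lin = tens_linear tens_kG

lemmas tens_kG_mem [simp] = tens_mem[where V = kG] tens_mem[where W = kG] tens_mem[where V = R]
  tens_mem[where W = R]

section \<open>The grading of R defined by the coaction\<close>

lemma tlift_coact:
  "is_vspace U \<Longrightarrow> bilinear_map kG R U \<mu> \<Longrightarrow> a \<in> carrier R \<Longrightarrow>
    tlift kG R \<mu> (\<rho> a) = (\<Sum>g\<in>carrier G. \<mu> (gel g) (pr g a))"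
  unfolding pr_def by (rule tlift_lcoord) simp_all

text \<open>Comparison of the coefficients of g in the coassociativity of the coaction: \<Delta>(g)
  = g \<otimes> g leaves g \<otimes> \<open>pr g a\<close> on one side, and the other side has
  \<rho>(\<open>pr g a\<close>).\<close>

lemma coact_pr:
  assumes g: "g \<in> carrier G" and a: "a \<in> carrier R"
  shows "\<rho> (pr g a) = tens kG R (gel g) (pr g a)"
proof -
  have 1: "tlift kG R (\<lambda>x b. tlift kG kG (\<lambda>x\<^sub>1 x\<^sub>2. tens kG (tensor kG R) x\<^sub>1 (tens kG R x\<^sub>2 b)) (comult kG x))
          (\<rho> a) = (\<Sum>g\<in>carrier G. tens kG (tensor kG R) (gel g) (tens kG R (gel g) (pr g a)))"
  proof (subst tlift_coact[OF is_vspace_tensor _ a])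
    show "bilinear_map kG R (tensor kG (tensor kG R))
       (\<lambda>x b. tlift kG kG (\<lambda>x\<^sub>1 x\<^sub>2. tens kG (tensor kG R) x\<^sub>1 (tens kG R x\<^sub>2 b)) (comult kG x))"
      by (rule bilinear_map_tlift_left[OF _ _ _ _ linear_map_group_algebra_comult])
         (auto intro!: bilinear_mapI linear_mapI simp: tens_mem tens_lin mult.commute)
    show "(\<Sum>g\<in>carrier G. tlift kG kG (\<lambda>x\<^sub>1 x\<^sub>2. tens kG (tensor kG R) x\<^sub>1 (tens kG R x\<^sub>2 (pr g a)))
       (comult kG (gel g))) = (\<Sum>g\<in>carrier G. tens kG (tensor kG R) (gel g) (tens kG R (gel g) (pr g a)))"
    proof (rule sum.cong[OF refl])
      fix g assume g: "g \<in> carrier G"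
      show "tlift kG kG (\<lambda>x\<^sub>1 x\<^sub>2. tens kG (tensor kG R) x\<^sub>1 (tens kG R x\<^sub>2 (pr g a))) (comult kG (gel g))
        = tens kG (tensor kG R) (gel g) (tens kG R (gel g) (pr g a))"
        unfolding group_algebra_comult_gel[OF g]
        by (rule tlift_tens[where U = "tensor kG (tensor kG R)"])
           (auto intro!: bilinear_mapI simp: tens_mem tens_lin mult.commute g a)
    qed
  qed
  have 2: "tlift kG R (\<lambda>x b. tens kG (tensor kG R) x (\<rho> b)) (\<rho> a) =
      (\<Sum>g\<in>carrier G. tens kG (tensor kG R) (gel g) (\<rho> (pr g a)))"
    by (rule tlift_coact[OF is_vspace_tensor[of kG "tensor kG R"] _ a])
       (auto intro!: bilinear_mapI simp: tens_mem tens_lin lin)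
  have "(\<Sum>g\<in>carrier G. tens kG (tensor kG R) (gel g) (tens kG R (gel g) (pr g a))) =
        (\<Sum>g\<in>carrier G. tens kG (tensor kG R) (gel g) (\<rho> (pr g a)))"
    unfolding 1[symmetric] 2[symmetric] using yd_unfolded a by blast
  then have "lcoord (tensor kG R) g (\<Sum>g\<in>carrier G. tens kG (tensor kG R) (gel g) (tens kG R (gel g) (pr g a))) =
        lcoord (tensor kG R) g (\<Sum>g\<in>carrier G. tens kG (tensor kG R) (gel g) (\<rho> (pr g a)))" by simp
  then show ?thesis
    using g a by (subst (asm) (1 2) lcoord_sum) (simp_all add: tens_mem)
qed

text \<open>Together with \<open>sum_pr\<close> this makes the maps \<open>pr g\<close> a complete
  system of orthogonal projections, that is, a grading of R by G.\<close>

lemma pr_pr: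
  assumes "g \<in> carrier G" "a \<in> carrier R"
  shows "pr h (pr g a) = (if h = g then pr g a else 0)"
  using assms
  by (simp add: pr_def[of h] coact_pr lcoord_tens gel_apply scl_one[OF is_vspace_R] scl_zero_left[OF is_vspace_R])

lemma sum_pr:
  assumes "a \<in> carrier R"
  shows "(\<Sum>g\<in>carrier G. pr g a) = a"
proof -
  have "tlift kG R (\<lambda>x b. scl R (counit kG x) b) (\<rho> a) = (\<Sum>g\<in>carrier G. scl R (counit kG (gel g)) (pr g a))"
    by (rule tlift_coact[OF is_vspace_R _ assms], rule bilinear_mapI)
       (simp_all add: linear_map_add[OF linear_map_group_algebra_counit]
         linear_map_scl[OF linear_map_group_algebra_counit, unfolded scl_group_algebra]
         scl_add_left scl_add_right scl_scl mult.commute)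
  then show ?thesis
    using yd_unfolded assms by (simp add: group_algebra_counit_gel scl_one[OF is_vspace_R])
qed

text \<open>Comparison of coefficients in the Yetter-Drinfeld condition, after the substitution k
  \<mapsto> g k g^-1 in the expansion of \<rho>(g.a) along G.\<close>

lemma pr_act:
  assumes g: "g \<in> carrier G" and h: "h \<in> carrier G" and a: "a \<in> carrier R"
  shows "pr (g \<otimes> h \<otimes> inv g) (act R g a) = act R g (pr h a)"
proof -
  have "\<rho> (act R g a) =
          tlift kG R (\<lambda>x b. tens kG R (gel g \<bullet>\<^bsub>kG\<^esub> x \<bullet>\<^bsub>kG\<^esub> gel (inv g)) (act R g b)) (\<rho> a)"
    using yd_unfolded g a by blast
  also have "\<dots> = (\<Sum>k\<in>carrier G. tens kG R (gel g \<bullet>\<^bsub>kG\<^esub> gel k \<bullet>\<^bsub>kG\<^esub> gel (inv g)) (act R g (pr k a)))"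
    by (rule tlift_coact[OF is_vspace_tensor[of kG R] _ a], rule bilinear_mapI)
       (simp_all add: g tens_lin kG_lin lin)
  also have "\<dots> = (\<Sum>k\<in>carrier G. tens kG R (gel (g \<otimes> k \<otimes> inv g)) (act R g (pr k a)))"
    by (intro sum.cong refl) (simp add: group_algebra_mult_gel g)
  also have "\<dots> = (\<Sum>k\<in>carrier G. tens kG R (gel k) (act R g (pr (inv g \<otimes> k \<otimes> g) a)))"
    by (rule sum.reindex_bij_witness[of _ "\<lambda>k. inv g \<otimes> k \<otimes> g" "\<lambda>k. g \<otimes> k \<otimes> inv g"])
       (auto simp: g m_assoc)
  finally have "pr (g \<otimes> h \<otimes> inv g) (act R g a) = act R g (pr (inv g \<otimes> (g \<otimes> h \<otimes> inv g) \<otimes> g) a)"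
    unfolding pr_def[of "g \<otimes> h \<otimes> inv g"] using g h a by (simp add: lcoord_sum)
  also have "inv g \<otimes> (g \<otimes> h \<otimes> inv g) \<otimes> g = h"
    using g h by (simp add: m_assoc)
  finally show ?thesis .
qed

lemma pr_unit: "g \<in> carrier G \<Longrightarrow> pr g e = (if g = \<one> then e else 0)"
proof -
  assume g: "g \<in> carrier G"
  have "\<rho> e = tens kG R (aunit kG) e" using yd_alg_unfolded by blast
  also have "aunit kG = gel \<one>" by (simp add: group_algebra_def)
  finally have "pr g e = scl R (gel \<one> g) e" by (simp add: pr_def lcoord_tens)
  then show ?thesis
    using g by (simp add: gel_apply scl_one[OF is_vspace_R] scl_zero_left[OF is_vspace_R])
qed


text \<open>Collects the terms of a double sum by the product z = g h, keeping g free and putting h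
  = g^-1 z. Gradedness of the multiplication and of the comultiplication is stated in this
  form.\<close>

lemma sum_tens_gel_mult:
  assumes "\<And>g h. g \<in> carrier G \<Longrightarrow> h \<in> carrier G \<Longrightarrow> f g h \<in> carrier V"
  shows "(\<Sum>g\<in>carrier G. \<Sum>h\<in>carrier G. tens kG V (gel (g \<otimes> h)) (f g h)) =
    (\<Sum>z\<in>carrier G. tens kG V (gel z) (\<Sum>g\<in>carrier G. f g (inv g \<otimes> z)))"
proof -
  have "(\<Sum>g\<in>carrier G. \<Sum>h\<in>carrier G. tens kG V (gel (g \<otimes> h)) (f g h)) =
      (\<Sum>g\<in>carrier G. \<Sum>z\<in>carrier G. tens kG V (gel z) (f g (inv g \<otimes> z)))"
  proof (rule sum.cong[OF refl])
    fix g assume "g \<in> carrier G"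
    then show "(\<Sum>h\<in>carrier G. tens kG V (gel (g \<otimes> h)) (f g h)) =
      (\<Sum>z\<in>carrier G. tens kG V (gel z) (f g (inv g \<otimes> z)))"
      by (intro sum.reindex_bij_witness[of _ "\<lambda>z. inv g \<otimes> z" "\<lambda>h. g \<otimes> h"]) auto
  qed
  then show ?thesis by (subst (asm) sum.swap) (simp add: tens_sum_right)
qed

lemma pr_mul:
  assumes z: "z \<in> carrier G" and a: "a \<in> carrier R" and b: "b \<in> carrier R"
  shows "pr z (a \<cdot> b) = (\<Sum>g\<in>carrier G. pr g a \<cdot> pr (inv g \<otimes> z) b)"
proof -
  have "\<rho> (a \<cdot> b) =
          tlift kG R (\<lambda>x a\<^sub>0. tlift kG R (\<lambda>y b\<^sub>0. tens kG R (x \<bullet>\<^bsub>kG\<^esub> y) (a\<^sub>0 \<cdot> b\<^sub>0)) (\<rho> b)) (\<rho> a)"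
    using yd_alg_unfolded a b by blast
  also have "\<dots> = tlift kG R (\<lambda>x a\<^sub>0. \<Sum>h\<in>carrier G. tens kG R (x \<bullet>\<^bsub>kG\<^esub> gel h) (a\<^sub>0 \<cdot> pr h b)) (\<rho> a)"
    by (intro tlift_cong refl tlift_coact[OF is_vspace_tensor[of kG R] _ b] bilinear_mapI)
       (simp_all add: tens_lin kG_lin lin)
  also have "\<dots> = (\<Sum>g\<in>carrier G. \<Sum>h\<in>carrier G. tens kG R (gel g \<bullet>\<^bsub>kG\<^esub> gel h) (pr g a \<cdot> pr h b))"
    by (intro tlift_coact[OF is_vspace_tensor[of kG R] _ a] bilinear_mapI)
       (simp_all add: tens_lin kG_lin lin b sum.distrib fscale_sum sum_mem[OF is_vspace_tensor])
  also have "\<dots> = (\<Sum>g\<in>carrier G. \<Sum>h\<in>carrier G. tens kG R (gel (g \<otimes> h)) (pr g a \<cdot> pr h b))"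
    by (intro sum.cong refl) (simp add: group_algebra_mult_gel)
  also have "\<dots> = (\<Sum>z\<in>carrier G. tens kG R (gel z) (\<Sum>g\<in>carrier G. pr g a \<cdot> pr (inv g \<otimes> z) b))"
    by (rule sum_tens_gel_mult) (simp add: a b)
  finally show ?thesis unfolding pr_def[of z] by (simp add: lcoord_sum z a b R_sum_mem)
qed

text \<open>The counit is a comodule map to the trivial comodule k, hence sees only the component of
  degree 1.\<close>

lemma counit_pr:
  assumes g: "g \<in> carrier G" and a: "a \<in> carrier R"
  shows "\<epsilon> (pr g a) = (if g = \<one> then \<epsilon> a else 0)"
proof -
  have "tlift kG R (\<lambda>x a\<^sub>0. fscale (\<epsilon> a\<^sub>0) x) (\<rho> a) = fscale (\<epsilon> a) (aunit kG)"
    using yd_coalg_unfolded a by simp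
  moreover have "tlift kG R (\<lambda>x a\<^sub>0. fscale (\<epsilon> a\<^sub>0) x) (\<rho> a) =
      (\<Sum>g\<in>carrier G. fscale (\<epsilon> (pr g a)) (gel g))"
    by (intro tlift_coact[OF is_vspace_group_algebra[of G] _ a] bilinear_mapI)
       (simp_all add: lin fscale_add_left mult.commute)
  ultimately have "(\<Sum>h\<in>carrier G. fscale (\<epsilon> (pr h a)) (gel h)) g = fscale (\<epsilon> a) (aunit kG) g"
    by simp
  then have "(\<Sum>h\<in>carrier G. \<epsilon> (pr h a) * gel h g) = \<epsilon> a * gel \<one> g"
    by (simp add: sum_fun_apply fscale_apply group_algebra_def[of G])
  also have "(\<Sum>h\<in>carrier G. \<epsilon> (pr h a) * gel h g) = (\<Sum>h\<in>carrier G. if h = g then \<epsilon> (pr h a) else 0)"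
    by (intro sum.cong) (auto simp: gel_apply)
  finally show ?thesis using g by (simp add: gel_apply split: if_splits)
qed

lemma tlift_comult:
  "is_vspace U \<Longrightarrow> bilinear_map R R U \<mu> \<Longrightarrow> a \<in> carrier R \<Longrightarrow> tlift R R \<mu> (\<Delta> a) = sw \<mu> a"
  by (rule tlift_tsum) simp_all

text \<open>The coaction on R \<otimes> R multiplies the degrees of the two factors, and the
  comultiplication respects it. The coefficients of z are compared; the contributing pairs of
  degrees are (g, g^-1 z).\<close>

lemma comult_pr:
  assumes z: "z \<in> carrier G" and a: "a \<in> carrier R"
  shows "\<Delta> (pr z a) = (\<Sum>g\<in>carrier G. sw (\<lambda>x y. tens R R (pr g x) (pr (inv g \<otimes> z) y)) a)"
proof -
  let ?RR = "tensor R R"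
  have 1: "tlift kG R (\<lambda>x a\<^sub>0. tens kG ?RR x (\<Delta> a\<^sub>0)) (\<rho> a) =
      (\<Sum>g\<in>carrier G. tens kG ?RR (gel g) (\<Delta> (pr g a)))"
    by (intro tlift_coact[OF is_vspace_tensor[of kG ?RR] _ a] bilinear_mapI)
       (simp_all add: lin tens_lin)
  have "tlift R R (\<lambda>a\<^sub>1 a\<^sub>2. tlift kG R (\<lambda>x b. tlift kG R (\<lambda>y c.
            tens kG ?RR (x \<bullet>\<^bsub>kG\<^esub> y) (tens R R b c)) (\<rho> a\<^sub>2)) (\<rho> a\<^sub>1)) (\<Delta> a) =
      tlift R R (\<lambda>a\<^sub>1 a\<^sub>2. tlift kG R (\<lambda>x b. \<Sum>h\<in>carrier G.
            tens kG ?RR (x \<bullet>\<^bsub>kG\<^esub> gel h) (tens R R b (pr h a\<^sub>2))) (\<rho> a\<^sub>1)) (\<Delta> a)"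
    by (intro tlift_cong refl tlift_coact[OF is_vspace_tensor[of kG ?RR]] bilinear_mapI)
       (simp_all add: lin kG_lin tens_lin)
  also have "\<dots> = tlift R R (\<lambda>a\<^sub>1 a\<^sub>2. \<Sum>g\<in>carrier G. \<Sum>h\<in>carrier G.
            tens kG ?RR (gel g \<bullet>\<^bsub>kG\<^esub> gel h) (tens R R (pr g a\<^sub>1) (pr h a\<^sub>2))) (\<Delta> a)"
    by (intro tlift_cong refl tlift_coact[OF is_vspace_tensor[of kG ?RR]] bilinear_mapI)
       (simp_all add: lin kG_lin tens_lin sum.distrib fscale_sum sum_mem[OF is_vspace_tensor])
  also have "\<dots> = tlift R R (\<lambda>a\<^sub>1 a\<^sub>2. \<Sum>g\<in>carrier G. \<Sum>h\<in>carrier G.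
            tens kG ?RR (gel (g \<otimes> h)) (tens R R (pr g a\<^sub>1) (pr h a\<^sub>2))) (\<Delta> a)"
    by (intro tlift_cong sum.cong refl) (simp add: group_algebra_mult_gel)
  also have "\<dots> = tlift R R (\<lambda>a\<^sub>1 a\<^sub>2. \<Sum>z\<in>carrier G. tens kG ?RR (gel z)
            (\<Sum>g\<in>carrier G. (tens R R (pr g a\<^sub>1) (pr (inv g \<otimes> z) a\<^sub>2)))) (\<Delta> a)"
    by (intro tlift_cong refl sum_tens_gel_mult) simp_all
  also have "\<dots> = sw (\<lambda>a\<^sub>1 a\<^sub>2. \<Sum>z\<in>carrier G. tens kG ?RR (gel z)
            (\<Sum>g\<in>carrier G. (tens R R (pr g a\<^sub>1) (pr (inv g \<otimes> z) a\<^sub>2)))) a"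
    by (intro tlift_comult[OF is_vspace_tensor[of kG ?RR] _ a] bilinear_mapI)
       (simp_all add: lin tens_lin sum.distrib fscale_sum[symmetric] sum_mem[OF is_vspace_tensor])
  also have "\<dots> = (\<Sum>z\<in>carrier G. tens kG ?RR (gel z)
            (\<Sum>g\<in>carrier G. sw (\<lambda>x y. tens R R (pr g x) (pr (inv g \<otimes> z) y)) a))"
    unfolding tsum_sum
    by (subst tsum_sum[symmetric], intro sum.cong refl tsum_linear[OF bilinear_map_linear(1)[OF bilinear_map_tens], symmetric])
       (simp_all add: sum_mem[OF is_vspace_tensor])
  also note 2 = calculation
  have "(\<Sum>g\<in>carrier G. tens kG ?RR (gel g) (\<Delta> (pr g a))) = (\<Sum>z\<in>carrier G. tens kG ?RR (gel z)
            (\<Sum>g\<in>carrier G. sw (\<lambda>x y. tens R R (pr g x) (pr (inv g \<otimes> z) y)) a))"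
    unfolding 1[symmetric] 2[symmetric] using yd_coalg_unfolded a by blast
  then have "lcoord ?RR z (\<Sum>g\<in>carrier G. tens kG ?RR (gel g) (\<Delta> (pr g a))) =
      lcoord ?RR z (\<Sum>z\<in>carrier G. tens kG ?RR (gel z)
            (\<Sum>g\<in>carrier G. sw (\<lambda>x y. tens R R (pr g x) (pr (inv g \<otimes> z) y)) a))" by simp
  then show ?thesis
    using z a by (subst (asm) (1 2) lcoord_sum)
      (simp_all add: sum_mem[OF is_vspace_tensor] tsum_mem[OF is_vspace_tensor])
qed

end

section \<open>Sweedler sums in R\<close>

sublocale braided_hopf \<subseteq> R: coalg R
  using yd_coalg by unfold_locales (simp add: yd_coalgebra_def Let_def)

context braided_hopf
begin

lemmas linear_map_sw = R.linear_map_sw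

text \<open>Identities for \<open>\<Delta>\<close> transfer to \<open>sw\<close> by applying the linear map induced by \<open>\<mu>\<close>.\<close>

lemma sw_act:
  assumes U: "is_vspace U" and \<mu>: "bilinear_map R R U \<mu>" and g: "g \<in> carrier G" and a: "a \<in> carrier R"
  shows "sw \<mu> (act R g a) = sw (\<lambda>x y. \<mu> (act R g x) (act R g y)) a"
proof -
  note L = linear_map_tlift[OF is_vspace_R is_vspace_R U \<mu>]
  have "\<Delta> (act R g a) = tlift R R (\<lambda>x y. tens R R (act R g x) (act R g y)) (\<Delta> a)"
    using yd_coalg_unfolded g a by blast
  also have "\<dots> = sw (\<lambda>x y. tens R R (act R g x) (act R g y)) a"
    by (rule tlift_comult[OF is_vspace_tensor[of R R] _ a], rule bilinear_mapI)
       (simp_all add: g lin tens_lin)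
  finally have "sw \<mu> (act R g a) = tlift R R \<mu> (sw (\<lambda>x y. tens R R (act R g x) (act R g y)) a)"
    using g a tlift_comult[OF U \<mu>, of "act R g a"] by simp
  also have "\<dots> = sw (\<lambda>x y. tlift R R \<mu> (tens R R (act R g x) (act R g y))) a"
    by (rule tsum_linear[OF L]) (simp_all add: g)
  also have "\<dots> = sw (\<lambda>x y. \<mu> (act R g x) (act R g y)) a"
    by (intro tsum_cong refl) (simp add: tlift_tens[OF is_vspace_R is_vspace_R U \<mu>] g)
  finally show ?thesis .
qed

lemma sw_pr:
  assumes U: "is_vspace U" and \<mu>: "bilinear_map R R U \<mu>" and z: "z \<in> carrier G" and a: "a \<in> carrier R"
  shows "sw \<mu> (pr z a) = (\<Sum>g\<in>carrier G. sw (\<lambda>x y. \<mu> (pr g x) (pr (inv g \<otimes> z) y)) a)"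
proof -
  note L = linear_map_tlift[OF is_vspace_R is_vspace_R U \<mu>]
  have "sw \<mu> (pr z a) =
      tlift R R \<mu> (\<Sum>g\<in>carrier G. sw (\<lambda>x y. tens R R (pr g x) (pr (inv g \<otimes> z) y)) a)"
    using z a tlift_comult[OF U \<mu>, of "pr z a"] by (simp add: comult_pr)
  also have "\<dots> = (\<Sum>g\<in>carrier G. tlift R R \<mu> (sw (\<lambda>x y. tens R R (pr g x) (pr (inv g \<otimes> z) y)) a))"
    by (rule linear_map_sum[OF _ L]) (simp_all add: tsum_mem[OF is_vspace_tensor])
  also have "\<dots> = (\<Sum>g\<in>carrier G. sw (\<lambda>x y. tlift R R \<mu> (tens R R (pr g x) (pr (inv g \<otimes> z) y))) a)"
    by (intro sum.cong refl tsum_linear[OF L]) simp_all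
  also have "\<dots> = (\<Sum>g\<in>carrier G. sw (\<lambda>x y. \<mu> (pr g x) (pr (inv g \<otimes> z) y)) a)"
    by (intro sum.cong tsum_cong refl) (simp add: tlift_tens[OF is_vspace_R is_vspace_R U \<mu>])
  finally show ?thesis .
qed

lemma sw_unit: "is_vspace U \<Longrightarrow> bilinear_map R R U \<mu> \<Longrightarrow> sw \<mu> e = \<mu> e e"
  using tlift_comult[of U \<mu> e] by (simp add: comult_unit tlift_tens)

lemma kact_gel: "g \<in> carrier G \<Longrightarrow> kact G R (gel g) a = act R g a"
  by (simp add: kact_def sum_gel_scl)

lemma kact_mem [simp]: "a \<in> carrier R \<Longrightarrow> kact G R x a \<in> carrier R"
  by (auto simp: kact_def intro!: R_sum_mem)

lemma kact_lin:
  "kact G R (x + y) a = kact G R x a + kact G R y a"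
  "kact G R (fscale c x) a = scl R c (kact G R x a)"
  "a \<in> carrier R \<Longrightarrow> b \<in> carrier R \<Longrightarrow> kact G R x (a + b) = kact G R x a + kact G R x b"
  "a \<in> carrier R \<Longrightarrow> kact G R x (scl R c a) = scl R c (kact G R x a)"
  by (simp_all add: kact_def scl_add_left[OF is_vspace_R] scl_add_right[OF is_vspace_R]
      scl_sum_right[OF is_vspace_R] scl_scl[OF is_vspace_R] fscale_apply lin sum.distrib mult.commute)

text \<open>The braided product rule with the coaction on a_2 expanded by degrees: moving b_1 past
  the component of a_2 of degree g costs the action of g.\<close>

lemma sw_mul:
  assumes U: "is_vspace U" and \<mu>: "bilinear_map R R U \<mu>" and a: "a \<in> carrier R" and b: "b \<in> carrier R"
  shows "sw \<mu> (a \<cdot> b) =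
    sw (\<lambda>a\<^sub>1 a\<^sub>2. \<Sum>g\<in>carrier G. sw (\<lambda>b\<^sub>1 b\<^sub>2. \<mu> (a\<^sub>1 \<cdot> act R g b\<^sub>1) (pr g a\<^sub>2 \<cdot> b\<^sub>2)) b) a"
proof -
  note L = linear_map_tlift[OF is_vspace_R is_vspace_R U \<mu>]
  have "\<Delta> (a \<cdot> b) =
          tlift R R (\<lambda>a\<^sub>1 a\<^sub>2. tlift kG R (\<lambda>x c. tlift R R (\<lambda>b\<^sub>1 b\<^sub>2.
              tens R R (a\<^sub>1 \<cdot> kact G R x b\<^sub>1) (c \<cdot> b\<^sub>2)) (\<Delta> b)) (\<rho> a\<^sub>2)) (\<Delta> a)"
    using braided a b unfolding braided_hopf_algebra_def by blast
  also have "\<dots> = tlift R R (\<lambda>a\<^sub>1 a\<^sub>2. tlift kG R (\<lambda>x c. sw (\<lambda>b\<^sub>1 b\<^sub>2.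
              tens R R (a\<^sub>1 \<cdot> kact G R x b\<^sub>1) (c \<cdot> b\<^sub>2)) b) (\<rho> a\<^sub>2)) (\<Delta> a)"
    by (intro tlift_cong refl tlift_comult[OF is_vspace_tensor[of R R] _ b] bilinear_mapI)
       (simp_all add: lin kact_lin tens_lin)
  also have "\<dots> = tlift R R (\<lambda>a\<^sub>1 a\<^sub>2. \<Sum>g\<in>carrier G. sw (\<lambda>b\<^sub>1 b\<^sub>2.
              tens R R (a\<^sub>1 \<cdot> kact G R (gel g) b\<^sub>1) (pr g a\<^sub>2 \<cdot> b\<^sub>2)) b) (\<Delta> a)"
    by (intro tlift_cong refl tlift_coact[OF is_vspace_tensor[of R R]],
        unfold bilinear_map_def, intro conjI ballI linear_map_tsum_param[OF is_vspace_tensor] linear_mapI)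
       (simp_all add: lin kact_lin tens_lin)
  also have "\<dots> = tlift R R (\<lambda>a\<^sub>1 a\<^sub>2. \<Sum>g\<in>carrier G. sw (\<lambda>b\<^sub>1 b\<^sub>2.
              tens R R (a\<^sub>1 \<cdot> act R g b\<^sub>1) (pr g a\<^sub>2 \<cdot> b\<^sub>2)) b) (\<Delta> a)"
    by (intro tlift_cong sum.cong tsum_cong refl) (simp add: kact_gel)
  also have "\<dots> = sw (\<lambda>a\<^sub>1 a\<^sub>2. \<Sum>g\<in>carrier G. sw (\<lambda>b\<^sub>1 b\<^sub>2.
              tens R R (a\<^sub>1 \<cdot> act R g b\<^sub>1) (pr g a\<^sub>2 \<cdot> b\<^sub>2)) b) a"
    by (rule tlift_comult[OF is_vspace_tensor[of R R] _ a], unfold bilinear_map_def,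
        intro conjI ballI linear_map_sum_fun linear_map_tsum_param is_vspace_tensor linear_mapI)
       (simp_all add: lin tens_lin)
  finally have *: "\<Delta> (a \<cdot> b) = sw (\<lambda>a\<^sub>1 a\<^sub>2. \<Sum>g\<in>carrier G. sw (\<lambda>b\<^sub>1 b\<^sub>2.
              tens R R (a\<^sub>1 \<cdot> act R g b\<^sub>1) (pr g a\<^sub>2 \<cdot> b\<^sub>2)) b) a" .
  have "sw \<mu> (a \<cdot> b) = tlift R R \<mu> (\<Delta> (a \<cdot> b))"
    using a b by (simp add: tlift_comult[OF U \<mu>])
  also have "\<dots> = sw (\<lambda>a\<^sub>1 a\<^sub>2. tlift R R \<mu> (\<Sum>g\<in>carrier G. sw (\<lambda>b\<^sub>1 b\<^sub>2.
              tens R R (a\<^sub>1 \<cdot> act R g b\<^sub>1) (pr g a\<^sub>2 \<cdot> b\<^sub>2)) b)) a"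
    unfolding * by (rule tsum_linear[OF L])
      (simp_all add: sum_mem[OF is_vspace_tensor] tsum_mem[OF is_vspace_tensor])
  also have "\<dots> = sw (\<lambda>a\<^sub>1 a\<^sub>2. \<Sum>g\<in>carrier G. tlift R R \<mu> (sw (\<lambda>b\<^sub>1 b\<^sub>2.
              tens R R (a\<^sub>1 \<cdot> act R g b\<^sub>1) (pr g a\<^sub>2 \<cdot> b\<^sub>2)) b)) a"
    by (intro tsum_cong refl linear_map_sum[OF _ L])
      (simp_all add: tsum_mem[OF is_vspace_tensor])
  also have "\<dots> = sw (\<lambda>a\<^sub>1 a\<^sub>2. \<Sum>g\<in>carrier G. sw (\<lambda>b\<^sub>1 b\<^sub>2.
              tlift R R \<mu> (tens R R (a\<^sub>1 \<cdot> act R g b\<^sub>1) (pr g a\<^sub>2 \<cdot> b\<^sub>2))) b) a"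
    by (intro tsum_cong sum.cong refl tsum_linear[OF L]) simp_all
  also have "\<dots> = sw (\<lambda>a\<^sub>1 a\<^sub>2. \<Sum>g\<in>carrier G. sw (\<lambda>b\<^sub>1 b\<^sub>2. \<mu> (a\<^sub>1 \<cdot> act R g b\<^sub>1) (pr g a\<^sub>2 \<cdot> b\<^sub>2)) b) a"
    by (intro tsum_cong sum.cong refl) (simp add: tlift_tens[OF is_vspace_R is_vspace_R U \<mu>])
  finally show ?thesis .
qed

end

section \<open>The biproduct\<close>

context braided_hopf
begin

abbreviation HH where "HH \<equiv> tensor R kG"
abbreviation BP where "BP \<equiv> biproduct R G"

text \<open>The generator \<open>a # g\<close>. Its companion \<open>cmp g\<close> reads off the
  coefficient at g, so u is the sum of all \<open>E (cmp g u) g\<close>.\<close>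

definition E :: "'v \<Rightarrow> 'g \<Rightarrow> ('k, 'v, 'g \<Rightarrow> 'k) tensor" where "E a g = tens R kG a (gel g)"

definition cmp :: "'g \<Rightarrow> ('k, 'v, 'g \<Rightarrow> 'k) tensor \<Rightarrow> 'v" where "cmp g u = rcoord R g u"

lemma carrier_biproduct: "carrier BP = carrier HH" and scl_biproduct [simp]: "scl BP = fscale"
  by (simp_all add: biproduct_def Let_def)

lemma E_mem [simp]: "a \<in> carrier R \<Longrightarrow> g \<in> carrier G \<Longrightarrow> E a g \<in> carrier HH"
  by (simp add: E_def)

lemma HH_mem [simp]:
  "u \<in> carrier HH \<Longrightarrow> v \<in> carrier HH \<Longrightarrow> u + v \<in> carrier HH"
  "u \<in> carrier HH \<Longrightarrow> fscale c u \<in> carrier HH"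
  "u \<in> carrier HH \<Longrightarrow> cmp g u \<in> carrier R"
  using add_mem[OF is_vspace_tensor] scl_mem[OF is_vspace_tensor, unfolded scl_tensor]
    rcoord_mem[OF is_vspace_R] by (auto simp: cmp_def)

lemma E_lin: "E (a + b) g = E a g + E b g" "E (scl R c a) g = fscale c (E a g)" "E 0 g = 0"
  "E (\<Sum>i\<in>I. f i) g = (\<Sum>i\<in>I. E (f i) g)"
  by (simp_all add: E_def tens_lin tens_zero_left tens_sum_left)

lemma linear_map_E: "g \<in> carrier G \<Longrightarrow> linear_map R HH (\<lambda>a. E a g)"
  by (rule linear_mapI) (simp_all add: E_lin)

lemma linear_map_cmp: "linear_map HH R (cmp g)"
  unfolding cmp_def by (rule linear_map_rcoord) simp

lemma cmp_lin:
  "u \<in> carrier HH \<Longrightarrow> v \<in> carrier HH \<Longrightarrow> cmp g (u + v) = cmp g u + cmp g v"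
  "u \<in> carrier HH \<Longrightarrow> cmp g (fscale c u) = scl R c (cmp g u)"
  using linear_map_add[OF linear_map_cmp] linear_map_scl[OF linear_map_cmp] by auto

lemma E_expand: "u \<in> carrier HH \<Longrightarrow> u = (\<Sum>g\<in>carrier G. E (cmp g u) g)"
  unfolding E_def cmp_def by (rule rcoord_expand) simp_all

lemma cmp_E: "a \<in> carrier R \<Longrightarrow> g \<in> carrier G \<Longrightarrow> cmp h (E a g) = (if h = g then a else 0)"
  unfolding E_def cmp_def
  by (simp add: rcoord_tens) (simp add: gel_apply scl_one[OF is_vspace_R] scl_zero_left[OF is_vspace_R])

lemma linear_map_eq_on_E:
  assumes F: "linear_map HH U F" and F': "linear_map HH U F'"
    and eq: "\<And>a g. a \<in> carrier R \<Longrightarrow> g \<in> carrier G \<Longrightarrow> F (E a g) = F' (E a g)"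
    and u: "u \<in> carrier HH"
  shows "F u = F' u"
proof -
  have "F u = F (\<Sum>g\<in>carrier G. E (cmp g u) g)" using E_expand[OF u] by simp
  also have "\<dots> = (\<Sum>g\<in>carrier G. F (E (cmp g u) g))"
    by (rule linear_map_sum[OF is_vspace_tensor F]) (simp add: u)
  also have "\<dots> = (\<Sum>g\<in>carrier G. F' (E (cmp g u) g))"
    by (intro sum.cong refl) (simp add: eq u)
  also have "\<dots> = F' (\<Sum>g\<in>carrier G. E (cmp g u) g)"
    by (rule linear_map_sum[OF is_vspace_tensor F', symmetric]) (simp add: u)
  finally show ?thesis using E_expand[OF u] by simp
qed

lemma tlift_HH:
  "is_vspace U \<Longrightarrow> bilinear_map R kG U \<mu> \<Longrightarrow> u \<in> carrier HH \<Longrightarrow>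
    tlift R kG \<mu> u = (\<Sum>g\<in>carrier G. \<mu> (cmp g u) (gel g))"
  unfolding cmp_def by (rule tlift_rcoord) simp_all

section \<open>Structure maps of the biproduct on generators\<close>

lemma sum_gel_gel:
  assumes "h \<in> carrier G"
  shows "(\<Sum>g\<in>carrier G. \<Sum>k\<in>carrier G. fscale (x g * gel h k) (f g k)) =
    (\<Sum>g\<in>carrier G. fscale (x g) (f g h))"
  using assms by (simp add: sum_gel fscale_simps(5)[symmetric] fscale_sum[symmetric] del: fscale_simps(5))

text \<open>The sums over \<open>x g\<close> and \<open>y h\<close> in the definition express
  bilinear extension. Once u and v are expanded into generators, x and y are basis elements and each
  of these sums keeps a single term.\<close>

lemma biproduct_mult:
  assumes u: "u \<in> carrier HH" and v: "v \<in> carrier HH"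
  shows "u \<bullet>\<^bsub>BP\<^esub> v =
    (\<Sum>g\<in>carrier G. \<Sum>h\<in>carrier G. E (cmp g u \<cdot> act R g (cmp h v)) (g \<otimes> h))"
proof -
  have "u \<bullet>\<^bsub>BP\<^esub> v = tlift R kG (\<lambda>a x. tlift R kG (\<lambda>b y. \<Sum>g\<in>carrier G. \<Sum>h\<in>carrier G.
      fscale (x g * y h) (E (a \<cdot> act R g b) (g \<otimes> h))) v) u"
    by (simp add: biproduct_def Let_def E_def)
  also have "\<dots> = tlift R kG (\<lambda>a x. \<Sum>k\<in>carrier G. \<Sum>g\<in>carrier G. \<Sum>h\<in>carrier G.
      fscale (x g * gel k h) (E (a \<cdot> act R g (cmp k v)) (g \<otimes> h))) u"
    by (intro tlift_cong refl tlift_HH[OF is_vspace_tensor[of R kG] _ v] bilinear_mapI)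
       (simp_all add: E_lin lin sum_mem[OF is_vspace_tensor] sum.distrib fscale_sum fscale_apply
          algebra_simps fscale_add_left)
  also have "\<dots> = tlift R kG (\<lambda>a x. \<Sum>k\<in>carrier G. \<Sum>g\<in>carrier G.
      fscale (x g) (E (a \<cdot> act R g (cmp k v)) (g \<otimes> k))) u"
    by (intro tlift_cong refl sum.cong[OF refl] sum_gel_gel)
  also have "\<dots> = (\<Sum>j\<in>carrier G. \<Sum>k\<in>carrier G. \<Sum>g\<in>carrier G.
      fscale (gel j g) (E (cmp j u \<cdot> act R g (cmp k v)) (g \<otimes> k)))"
    by (intro tlift_HH[OF is_vspace_tensor[of R kG] _ u] bilinear_mapI)
       (simp_all add: E_lin lin sum_mem[OF is_vspace_tensor] sum.distrib fscale_sum fscale_apply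
          algebra_simps fscale_add_left v)
  also have "\<dots> = (\<Sum>j\<in>carrier G. \<Sum>k\<in>carrier G. E (cmp j u \<cdot> act R j (cmp k v)) (j \<otimes> k))"
    by (intro sum.cong[OF refl]) (simp add: sum_gel)
  finally show ?thesis .
qed

lemma bilinear_map_biproduct_mult: "bilinear_map HH HH HH (amult BP)"
  by (rule bilinear_mapI)
     (simp_all add: biproduct_mult cmp_lin lin E_lin sum.distrib fscale_sum sum_mem[OF is_vspace_tensor])

lemma biproduct_mult_E:
  assumes "a \<in> carrier R" "g \<in> carrier G" "b \<in> carrier R" "h \<in> carrier G"
  shows "E a g \<bullet>\<^bsub>BP\<^esub> E b h = E (a \<cdot> act R g b) (g \<otimes> h)"
proof -
  have "E a g \<bullet>\<^bsub>BP\<^esub> E b h = (\<Sum>j\<in>carrier G. \<Sum>k\<in>carrier G.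
      if j = g then if k = h then E (a \<cdot> act R j b) (j \<otimes> k) else 0 else 0)"
    using assms by (subst biproduct_mult) (auto simp: cmp_E E_lin intro!: sum.cong)
  also have "\<dots> = (\<Sum>j\<in>carrier G. if j = g then (\<Sum>k\<in>carrier G.
      if k = h then E (a \<cdot> act R j b) (j \<otimes> k) else 0) else 0)"
    by (intro sum.cong) auto
  also have "\<dots> = E (a \<cdot> act R g b) (g \<otimes> h)" using assms by simp
  finally show ?thesis .
qed

text \<open>The coaction on a_2 is expanded by degrees: the component of degree z contributes the
  factor z to the group part of the left tensor factor.\<close>

definition comultE :: "'v \<Rightarrow> 'g \<Rightarrow> _" where
  "comultE a g = sw (\<lambda>x y. \<Sum>z\<in>carrier G. tens HH HH (E x (z \<otimes> g)) (E (pr z y) g)) a"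

lemma linear_map_comultE: "g \<in> carrier G \<Longrightarrow> linear_map R (tensor HH HH) (\<lambda>a. comultE a g)"
  unfolding comultE_def
  by (intro linear_map_sw is_vspace_tensor bilinear_mapI)
     (simp_all add: sum_mem[OF is_vspace_tensor] tens_mem E_lin lin tens_lin sum.distrib fscale_sum)

lemma biproduct_comult:
  assumes u: "u \<in> carrier HH"
  shows "comult BP u = (\<Sum>g\<in>carrier G. comultE (cmp g u) g)"
proof -
  have inner: "tlift R R (\<lambda>a\<^sub>1 a\<^sub>2. tlift kG R (\<lambda>z b.
            tens HH HH (tens R kG a\<^sub>1 (z \<bullet>\<^bsub>kG\<^esub> gel g)) (tens R kG b (gel g)))
            (\<rho> a\<^sub>2)) (\<Delta> a) = comultE a g" if a: "a \<in> carrier R" and g: "g \<in> carrier G" for a g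
  proof -
    have "tlift R R (\<lambda>a\<^sub>1 a\<^sub>2. tlift kG R (\<lambda>z b.
            tens HH HH (tens R kG a\<^sub>1 (z \<bullet>\<^bsub>kG\<^esub> gel g)) (tens R kG b (gel g)))
            (\<rho> a\<^sub>2)) (\<Delta> a) = tlift R R (\<lambda>a\<^sub>1 a\<^sub>2. \<Sum>z\<in>carrier G.
            tens HH HH (tens R kG a\<^sub>1 (gel z \<bullet>\<^bsub>kG\<^esub> gel g)) (tens R kG (pr z a\<^sub>2) (gel g))) (\<Delta> a)"
      by (intro tlift_cong refl tlift_coact[OF is_vspace_tensor[of HH HH]] bilinear_mapI)
         (simp_all add: g tens_mem tens_lin kG_lin)
    also have "\<dots> = tlift R R (\<lambda>a\<^sub>1 a\<^sub>2. \<Sum>z\<in>carrier G.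
            tens HH HH (E a\<^sub>1 (z \<otimes> g)) (E (pr z a\<^sub>2) g)) (\<Delta> a)"
      by (intro tlift_cong refl sum.cong) (simp add: E_def group_algebra_mult_gel g)
    also have "\<dots> = comultE a g"
      unfolding comultE_def
      by (intro tlift_comult[OF is_vspace_tensor[of HH HH] _ a] bilinear_mapI)
         (simp_all add: g sum_mem[OF is_vspace_tensor] tens_mem E_lin lin tens_lin sum.distrib fscale_sum)
    finally show ?thesis .
  qed
  have "comult BP u = tlift R kG (\<lambda>a x. \<Sum>g\<in>carrier G. fscale (x g) (tlift R R (\<lambda>a\<^sub>1 a\<^sub>2. tlift kG R (\<lambda>z b.
            tens HH HH (tens R kG a\<^sub>1 (z \<bullet>\<^bsub>kG\<^esub> gel g)) (tens R kG b (gel g)))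
            (\<rho> a\<^sub>2)) (\<Delta> a))) u"
    by (simp add: biproduct_def Let_def)
  also have "\<dots> = tlift R kG (\<lambda>a x. \<Sum>g\<in>carrier G. fscale (x g) (comultE a g)) u"
    by (intro tlift_cong refl sum.cong) (simp add: inner)
  also have "\<dots> = (\<Sum>h\<in>carrier G. \<Sum>g\<in>carrier G. fscale (gel h g) (comultE (cmp h u) g))"
    by (intro tlift_HH[OF is_vspace_tensor[of HH HH] _ u] bilinear_mapI sum_mem[OF is_vspace_tensor]
          scl_mem[OF is_vspace_tensor, unfolded scl_tensor] linear_map_mem[OF linear_map_comultE])
       (simp_all add: linear_map_add[OF linear_map_comultE] linear_map_scl[OF linear_map_comultE]
          sum.distrib fscale_sum fscale_apply fscale_add_left mult.commute)
  also have "\<dots> = (\<Sum>g\<in>carrier G. comultE (cmp g u) g)"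
    by (intro sum.cong[OF refl] sum_gel)
  finally show ?thesis .
qed

lemma comultE_mem [simp]: "a \<in> carrier R \<Longrightarrow> g \<in> carrier G \<Longrightarrow> comultE a g \<in> carrier (tensor HH HH)"
  by (rule linear_map_mem[OF linear_map_comultE])

lemma linear_map_biproduct_comult: "linear_map HH (tensor HH HH) (comult BP)"
  by (rule linear_mapI)
     (simp_all add: biproduct_comult sum_mem[OF is_vspace_tensor] cmp_lin linear_map_add[OF linear_map_comultE]
       linear_map_scl[OF linear_map_comultE] sum.distrib fscale_sum)

lemma biproduct_comult_E:
  assumes "a \<in> carrier R" "g \<in> carrier G"
  shows "comult BP (E a g) = comultE a g"
proof -
  have "comult BP (E a g) = (\<Sum>h\<in>carrier G. if h = g then comultE a h else 0)"
    using assms linear_map_zero[OF is_vspace_R linear_map_comultE]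
    by (simp add: biproduct_comult cmp_E if_distrib[where f = "\<lambda>x. comultE x _"] cong: if_cong)
  then show ?thesis using assms by simp
qed

lemma biproduct_counit:
  assumes u: "u \<in> carrier HH"
  shows "counit BP u = (\<Sum>g\<in>carrier G. \<epsilon> (cmp g u))"
proof -
  have "counit BP u = tlift R kG (\<lambda>a x. \<epsilon> a * counit kG x) u"
    by (simp add: biproduct_def Let_def)
  also have "\<dots> = (\<Sum>g\<in>carrier G. \<epsilon> (cmp g u) * counit kG (gel g))"
    by (rule tlift_HH[OF is_vspace_base _ u], rule bilinear_mapI)
       (simp_all add: lin linear_map_add[OF linear_map_group_algebra_counit] algebra_simps
          linear_map_scl[OF linear_map_group_algebra_counit, unfolded scl_group_algebra])
  finally show ?thesis by (simp add: group_algebra_counit_gel)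
qed

lemma linear_map_biproduct_counit: "linear_map HH base (counit BP)"
  by (rule linear_mapI) (simp_all add: biproduct_counit cmp_lin lin sum.distrib sum_distrib_left)

lemma biproduct_counit_E: "a \<in> carrier R \<Longrightarrow> g \<in> carrier G \<Longrightarrow> counit BP (E a g) = \<epsilon> a"
  by (simp add: biproduct_counit cmp_E if_distrib[where f = \<epsilon>] cong: if_cong)

lemma biproduct_unit: "aunit BP = E e \<one>"
  by (simp add: biproduct_def Let_def E_def group_algebra_def)


section \<open>The biproduct as an algebra\<close>

lemma is_vspace_biproduct: "is_vspace BP"
  using is_vspace_tensor[of R kG] unfolding is_vspace_def by (simp add: carrier_biproduct)

lemma tens_BP: "tens BP BP = tens HH HH" "tensor BP BP = tensor HH HH"
  "tens BP (tensor HH HH) = tens HH (tensor HH HH)"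
  by (simp_all add: tens_cong[of BP HH] tensor_cong[of BP HH] carrier_biproduct)

lemma tlift_BP: "tlift BP BP = tlift HH HH"
  by (rule tlift_space_cong) (simp_all add: carrier_biproduct)

lemmas BP_mult_linear =
  bilinear_map_linear[OF bilinear_map_biproduct_mult]

lemma BP_mem [simp]: "u \<in> carrier HH \<Longrightarrow> v \<in> carrier HH \<Longrightarrow> u \<bullet>\<^bsub>BP\<^esub> v \<in> carrier HH"
  by (rule linear_map_mem[OF BP_mult_linear(1)])

lemma BP_lin:
  "u \<in> carrier HH \<Longrightarrow> v \<in> carrier HH \<Longrightarrow> w \<in> carrier HH \<Longrightarrow> (u + v) \<bullet>\<^bsub>BP\<^esub> w = u \<bullet>\<^bsub>BP\<^esub> w + v \<bullet>\<^bsub>BP\<^esub> w"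
  "u \<in> carrier HH \<Longrightarrow> v \<in> carrier HH \<Longrightarrow> w \<in> carrier HH \<Longrightarrow> w \<bullet>\<^bsub>BP\<^esub> (u + v) = w \<bullet>\<^bsub>BP\<^esub> u + w \<bullet>\<^bsub>BP\<^esub> v"
  "u \<in> carrier HH \<Longrightarrow> w \<in> carrier HH \<Longrightarrow> fscale c u \<bullet>\<^bsub>BP\<^esub> w = fscale c (u \<bullet>\<^bsub>BP\<^esub> w)"
  "u \<in> carrier HH \<Longrightarrow> w \<in> carrier HH \<Longrightarrow> w \<bullet>\<^bsub>BP\<^esub> fscale c u = fscale c (w \<bullet>\<^bsub>BP\<^esub> u)"
  using linear_map_add[OF BP_mult_linear(1)] linear_map_scl[OF BP_mult_linear(1)]
    linear_map_add[OF BP_mult_linear(2)] linear_map_scl[OF BP_mult_linear(2)] by auto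

text \<open>Reduced to generators one variable at a time. For \<open>a # g\<close>,
  \<open>b # h\<close>, \<open>c # k\<close> both bracketings are
  \<open>a (g.b) (gh.c) # ghk\<close>, because G acts by algebra automorphisms.\<close>

lemma BP_assoc:
  assumes u: "u \<in> carrier HH" and v: "v \<in> carrier HH" and w: "w \<in> carrier HH"
  shows "(u \<bullet>\<^bsub>BP\<^esub> v) \<bullet>\<^bsub>BP\<^esub> w = u \<bullet>\<^bsub>BP\<^esub> (v \<bullet>\<^bsub>BP\<^esub> w)"
proof (rule linear_map_eq_on_E[where U = HH and F = "\<lambda>u. (u \<bullet>\<^bsub>BP\<^esub> v) \<bullet>\<^bsub>BP\<^esub> w"
      and F' = "\<lambda>u. u \<bullet>\<^bsub>BP\<^esub> (v \<bullet>\<^bsub>BP\<^esub> w)", OF _ _ _ u])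
  fix a g assume a: "a \<in> carrier R" "g \<in> carrier G"
  show "E a g \<bullet>\<^bsub>BP\<^esub> v \<bullet>\<^bsub>BP\<^esub> w = E a g \<bullet>\<^bsub>BP\<^esub> (v \<bullet>\<^bsub>BP\<^esub> w)"
  proof (rule linear_map_eq_on_E[where U = HH and F = "\<lambda>v. (E a g \<bullet>\<^bsub>BP\<^esub> v) \<bullet>\<^bsub>BP\<^esub> w"
      and F' = "\<lambda>v. E a g \<bullet>\<^bsub>BP\<^esub> (v \<bullet>\<^bsub>BP\<^esub> w)", OF _ _ _ v])
    fix b h assume b: "b \<in> carrier R" "h \<in> carrier G"
    show "E a g \<bullet>\<^bsub>BP\<^esub> E b h \<bullet>\<^bsub>BP\<^esub> w = E a g \<bullet>\<^bsub>BP\<^esub> (E b h \<bullet>\<^bsub>BP\<^esub> w)"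
      by (rule linear_map_eq_on_E[where U = HH and F = "\<lambda>w. E a g \<bullet>\<^bsub>BP\<^esub> E b h \<bullet>\<^bsub>BP\<^esub> w"
            and F' = "\<lambda>w. E a g \<bullet>\<^bsub>BP\<^esub> (E b h \<bullet>\<^bsub>BP\<^esub> w)", OF _ _ _ w])
         ((rule linear_mapI; simp add: a b BP_lin biproduct_mult_E) |
           simp add: a b biproduct_mult_E mul_assoc act_mul act_act m_assoc)+
  qed (rule linear_mapI; simp add: a w BP_lin)+
qed (rule linear_mapI; simp add: v w BP_lin)+

lemma unital_algebra_biproduct: "unital_algebra BP"
proof -
  have "E e \<one> \<bullet>\<^bsub>BP\<^esub> u = u" if u: "u \<in> carrier HH" for u
    by (rule linear_map_eq_on_E[where U = HH and F = "\<lambda>u. E e \<one> \<bullet>\<^bsub>BP\<^esub> u" and F' = "\<lambda>u. u", OF _ _ _ u])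
       ((rule linear_mapI; simp add: BP_lin) | simp add: biproduct_mult_E)+
  moreover have "u \<bullet>\<^bsub>BP\<^esub> E e \<one> = u" if u: "u \<in> carrier HH" for u
    by (rule linear_map_eq_on_E[where U = HH and F = "\<lambda>u. u \<bullet>\<^bsub>BP\<^esub> E e \<one>" and F' = "\<lambda>u. u", OF _ _ _ u])
       ((rule linear_mapI; simp add: BP_lin) | simp add: biproduct_mult_E)+
  moreover have "bilinear_map BP BP BP (amult BP)"
    using bilinear_map_biproduct_mult
    by (subst bilinear_map_space_cong[of BP HH BP HH BP HH]) (simp_all add: carrier_biproduct)
  ultimately show ?thesis
    unfolding unital_algebra_def carrier_biproduct biproduct_unit
    using is_vspace_biproduct BP_assoc by auto
qed

section \<open>The biproduct as a coalgebra\<close>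

lemma tlift_comultE:
  assumes U: "is_vspace U" and \<nu>: "bilinear_map HH HH U \<nu>" and a: "a \<in> carrier R" and g: "g \<in> carrier G"
  shows "tlift HH HH \<nu> (comultE a g) = sw (\<lambda>x y. \<Sum>z\<in>carrier G. \<nu> (E x (z \<otimes> g)) (E (pr z y) g)) a"
proof -
  note L = linear_map_tlift[OF is_vspace_tensor is_vspace_tensor U \<nu>]
  have "tlift HH HH \<nu> (comultE a g) =
    sw (\<lambda>x y. tlift HH HH \<nu> (\<Sum>z\<in>carrier G. tens HH HH (E x (z \<otimes> g)) (E (pr z y) g))) a"
    unfolding comultE_def
    by (rule tsum_linear[OF L is_vspace_tensor]) (simp add: sum_mem[OF is_vspace_tensor] tens_mem g)
  also have "\<dots> = sw (\<lambda>x y. \<Sum>z\<in>carrier G. tlift HH HH \<nu> (tens HH HH (E x (z \<otimes> g)) (E (pr z y) g))) a"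
    by (intro tsum_cong refl linear_map_sum[OF is_vspace_tensor L]) (simp add: tens_mem g)
  also have "\<dots> = sw (\<lambda>x y. \<Sum>z\<in>carrier G. \<nu> (E x (z \<otimes> g)) (E (pr z y) g)) a"
    by (intro tsum_cong sum.cong refl tlift_tens[OF is_vspace_tensor is_vspace_tensor U \<nu>]) (simp_all add: g)
  finally show ?thesis .
qed

lemma tlift_comult_E:
  assumes "is_vspace U" "bilinear_map HH HH U \<nu>" "a \<in> carrier R" "g \<in> carrier G"
  shows "tlift HH HH \<nu> (comult BP (E a g)) = sw (\<lambda>x y. \<Sum>z\<in>carrier G. \<nu> (E x (z \<otimes> g)) (E (pr z y) g)) a"
  using assms by (simp add: biproduct_comult_E tlift_comultE)

lemma biproduct_comult_mem [simp]: "u \<in> carrier HH \<Longrightarrow> comult BP u \<in> carrier (tensor HH HH)"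
  by (rule linear_map_mem[OF linear_map_biproduct_comult])

text \<open>The substitution v = p z, where v is a total degree and p, z are the degrees of two
  tensor factors. It matches sums arising from gradedness of \<Delta> with sums arising from the
  comultiplication of the biproduct.\<close>

lemma sum_mult_reindex:
  "(\<Sum>v\<in>carrier G. \<Sum>p\<in>carrier G. f v p (inv p \<otimes> v)) = (\<Sum>z\<in>carrier G. \<Sum>p\<in>carrier G. f (p \<otimes> z) p z)"
proof -
  have "(\<Sum>v\<in>carrier G. f v p (inv p \<otimes> v)) = (\<Sum>z\<in>carrier G. f (p \<otimes> z) p z)" if "p \<in> carrier G" for p
    by (rule sum.reindex_bij_witness[of _ "\<lambda>z. p \<otimes> z" "\<lambda>v. inv p \<otimes> v"]) (use that in auto)
  then have "(\<Sum>p\<in>carrier G. \<Sum>v\<in>carrier G. f v p (inv p \<otimes> v)) =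
      (\<Sum>p\<in>carrier G. \<Sum>z\<in>carrier G. f (p \<otimes> z) p z)"
    by (rule sum.cong[OF refl])
  then show ?thesis
    unfolding sum.swap[of "\<lambda>v p. f v p (inv p \<otimes> v)"] sum.swap[of "\<lambda>z p. f (p \<otimes> z) p z"] .
qed

text \<open>Writing y_z for the component of degree z, both iterated comultiplications of
  \<open>a # g\<close> are the sum over p and z of the tensors with factors
  \<open>a_1 # pzg\<close>, \<open>(a_2)_p # zg\<close>, \<open>(a_3)_z # g\<close>. On one side
  this follows from the formula and coassociativity in R. On the other side the degree v component
  of the second factor is comultiplied, and gradedness of \<Delta> splits v as p z.\<close>

lemma biproduct_coassoc:
  assumes u: "u \<in> carrier HH"
  shows "tlift HH HH (\<lambda>x y. tlift HH HH (\<lambda>x\<^sub>1 x\<^sub>2. tens HH (tensor HH HH) x\<^sub>1 (tens HH HH x\<^sub>2 y)) (comult BP x))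
          (comult BP u) =
        tlift HH HH (\<lambda>x y. tens HH (tensor HH HH) x (comult BP y)) (comult BP u)"
proof -
  let ?H2 = "tensor HH HH" and ?H3 = "tensor HH (tensor HH HH)"
  have bil0: "bilinear_map HH HH ?H3 (\<lambda>x\<^sub>1 x\<^sub>2. tens HH ?H2 x\<^sub>1 (tens HH HH x\<^sub>2 y))" if "y \<in> carrier HH" for y
    by (rule bilinear_mapI) (simp_all add: that tens_mem tens_lin)
  have bil1: "bilinear_map HH HH ?H3 (\<lambda>x y. tlift HH HH
      (\<lambda>x\<^sub>1 x\<^sub>2. tens HH ?H2 x\<^sub>1 (tens HH HH x\<^sub>2 y)) (comult BP x))"
    by (rule bilinear_map_tlift_left[OF _ _ _ _ linear_map_biproduct_comult bil0])
       (auto intro!: linear_mapI simp: tens_mem tens_lin)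
  have bil2: "bilinear_map HH HH ?H3 (\<lambda>x y. tens HH ?H2 x (comult BP y))"
    by (rule bilinear_mapI) (simp_all add: tens_mem tens_lin linear_map_add[OF linear_map_biproduct_comult]
      linear_map_scl[OF linear_map_biproduct_comult, unfolded scl_tensor])
  show ?thesis
  proof (rule linear_map_eq_on_E[where U = ?H3 and
      F = "\<lambda>u. tlift HH HH (\<lambda>x y. tlift HH HH (\<lambda>x\<^sub>1 x\<^sub>2. tens HH ?H2 x\<^sub>1 (tens HH HH x\<^sub>2 y)) (comult BP x)) (comult BP u)"
      and F' = "\<lambda>u. tlift HH HH (\<lambda>x y. tens HH ?H2 x (comult BP y)) (comult BP u)", OF _ _ _ u])
    show "linear_map HH ?H3 (\<lambda>u. tlift HH HH (\<lambda>x y. tlift HH HH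
      (\<lambda>x\<^sub>1 x\<^sub>2. tens HH ?H2 x\<^sub>1 (tens HH HH x\<^sub>2 y)) (comult BP x)) (comult BP u))"
      by (rule linear_map_comp[OF linear_map_biproduct_comult linear_map_tlift[OF _ _ _ bil1]]) auto
    show "linear_map HH ?H3 (\<lambda>u. tlift HH HH (\<lambda>x y. tens HH ?H2 x (comult BP y)) (comult BP u))"
      by (rule linear_map_comp[OF linear_map_biproduct_comult linear_map_tlift[OF _ _ _ bil2]]) auto
    fix a g assume a: "a \<in> carrier R" and g: "g \<in> carrier G"
    define \<tau> where "\<tau> = (\<lambda>x y\<^sub>1 y\<^sub>2. \<Sum>z\<in>carrier G. \<Sum>p\<in>carrier G. tens HH ?H2 (E x (p \<otimes> z \<otimes> g))
      (tens HH HH (E (pr p y\<^sub>1) (z \<otimes> g)) (E (pr z y\<^sub>2) g)))"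
    have tri: "R.trilinear ?H3 \<tau>"
      unfolding \<tau>_def by (rule R.trilinearI; rule linear_mapI)
        (simp_all add: g tens_mem sum_mem[OF is_vspace_tensor] E_lin tens_lin lin sum.distrib fscale_sum)
    have "tlift HH HH (\<lambda>x y. tlift HH HH (\<lambda>x\<^sub>1 x\<^sub>2. tens HH ?H2 x\<^sub>1 (tens HH HH x\<^sub>2 y)) (comult BP x))
          (comult BP (E a g)) =
        sw (\<lambda>x y. \<Sum>z\<in>carrier G. tlift HH HH (\<lambda>x\<^sub>1 x\<^sub>2. tens HH ?H2 x\<^sub>1 (tens HH HH x\<^sub>2 (E (pr z y) g)))
          (comult BP (E x (z \<otimes> g)))) a"
      by (rule tlift_comult_E[OF is_vspace_tensor[of HH ?H2] bil1 a g])
    also have "\<dots> = sw (\<lambda>x y. \<Sum>z\<in>carrier G. sw (\<lambda>x\<^sub>1 x\<^sub>2. \<Sum>p\<in>carrier G. tens HH ?H2 (E x\<^sub>1 (p \<otimes> (z \<otimes> g)))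
          (tens HH HH (E (pr p x\<^sub>2) (z \<otimes> g)) (E (pr z y) g))) x) a"
      by (intro tsum_cong sum.cong refl tlift_comult_E[OF is_vspace_tensor[of HH ?H2] bil0])
         (simp_all add: g)
    also have "\<dots> = sw (\<lambda>x y. sw (\<lambda>x\<^sub>1 x\<^sub>2. \<tau> x\<^sub>1 x\<^sub>2 y) x) a"
      unfolding \<tau>_def tsum_sum[of R R _ "carrier G", symmetric]
      by (intro tsum_cong sum.cong refl) (simp_all add: g m_assoc tsum_sum)
    also have "\<dots> = sw (\<lambda>x y. sw (\<lambda>y\<^sub>1 y\<^sub>2. \<tau> x y\<^sub>1 y\<^sub>2) y) a"
      by (rule R.sw_coassoc[OF is_vspace_tensor tri a])
    also have "\<dots> = sw (\<lambda>x y. \<Sum>v\<in>carrier G. tens HH ?H2 (E x (v \<otimes> g)) (comultE (pr v y) g)) a"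
    proof (intro tsum_cong refl)
      fix x y assume x: "x \<in> carrier R" and y: "y \<in> carrier R"
      have "tens HH ?H2 (E x (v \<otimes> g)) (comultE (pr v y) g) =
          (\<Sum>p\<in>carrier G. sw (\<lambda>y\<^sub>1 y\<^sub>2. tens HH ?H2 (E x (v \<otimes> g))
            (tens HH HH (E (pr p y\<^sub>1) (inv p \<otimes> v \<otimes> g)) (E (pr (inv p \<otimes> v) y\<^sub>2) g))) y)"
        if v: "v \<in> carrier G" for v
      proof -
        have "tens HH ?H2 (E x (v \<otimes> g)) (comultE (pr v y) g) =
            sw (\<lambda>y\<^sub>1 y\<^sub>2. tens HH ?H2 (E x (v \<otimes> g))
              (\<Sum>z\<in>carrier G. tens HH HH (E y\<^sub>1 (z \<otimes> g)) (E (pr z y\<^sub>2) g))) (pr v y)"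
          unfolding comultE_def
          by (rule tsum_linear[OF bilinear_map_linear(1)[OF bilinear_map_tens] is_vspace_tensor])
             (simp_all add: x v g sum_mem[OF is_vspace_tensor] tens_mem)
        also have "\<dots> = (\<Sum>p\<in>carrier G. sw (\<lambda>y\<^sub>1 y\<^sub>2. tens HH ?H2 (E x (v \<otimes> g))
              (\<Sum>z\<in>carrier G. tens HH HH (E (pr p y\<^sub>1) (z \<otimes> g)) (E (pr z (pr (inv p \<otimes> v) y\<^sub>2)) g))) y)"
          by (rule sw_pr[OF is_vspace_tensor[of HH ?H2] _ v y], rule bilinear_mapI)
             (simp_all add: x v g sum_mem[OF is_vspace_tensor] tens_mem E_lin lin tens_lin sum.distrib
               fscale_sum[symmetric])
        \<comment> \<open>By orthogonality of the projections, the inner sum over z retains only z =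
          p^-1 v.\<close>
        also have "\<dots> = (\<Sum>p\<in>carrier G. sw (\<lambda>y\<^sub>1 y\<^sub>2. tens HH ?H2 (E x (v \<otimes> g))
              (\<Sum>z\<in>carrier G. if z = inv p \<otimes> v then tens HH HH (E (pr p y\<^sub>1) (z \<otimes> g)) (E (pr z y\<^sub>2) g) else 0)) y)"
          by (intro sum.cong tsum_cong refl arg_cong2[of _ _ _ _ "tens HH ?H2"])
             (simp add: v pr_pr E_lin tens_zero_right)
        finally show ?thesis using v by simp
      qed
      then have "(\<Sum>v\<in>carrier G. tens HH ?H2 (E x (v \<otimes> g)) (comultE (pr v y) g)) =
        (\<Sum>v\<in>carrier G. \<Sum>p\<in>carrier G. sw (\<lambda>y\<^sub>1 y\<^sub>2. tens HH ?H2 (E x (v \<otimes> g))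
            (tens HH HH (E (pr p y\<^sub>1) (inv p \<otimes> v \<otimes> g)) (E (pr (inv p \<otimes> v) y\<^sub>2) g))) y)"
        by (intro sum.cong) auto
      also have "\<dots> = (\<Sum>z\<in>carrier G. \<Sum>p\<in>carrier G. sw (\<lambda>y\<^sub>1 y\<^sub>2. tens HH ?H2 (E x (p \<otimes> z \<otimes> g))
            (tens HH HH (E (pr p y\<^sub>1) (z \<otimes> g)) (E (pr z y\<^sub>2) g))) y)"
        by (rule sum_mult_reindex)
      also have "\<dots> = sw (\<lambda>y\<^sub>1 y\<^sub>2. \<tau> x y\<^sub>1 y\<^sub>2) y" by (simp add: \<tau>_def tsum_sum)
      finally show "sw (\<lambda>y\<^sub>1 y\<^sub>2. \<tau> x y\<^sub>1 y\<^sub>2) y =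
        (\<Sum>v\<in>carrier G. tens HH ?H2 (E x (v \<otimes> g)) (comultE (pr v y) g))" by simp
    qed
    also have "\<dots> = tlift HH HH (\<lambda>x y. tens HH ?H2 x (comult BP y)) (comult BP (E a g))"
      by (subst tlift_comult_E[OF is_vspace_tensor[of HH ?H2] bil2 a g])
         (intro tsum_cong sum.cong refl, simp add: biproduct_comult_E g)
    finally show "tlift HH HH (\<lambda>x y. tlift HH HH (\<lambda>x\<^sub>1 x\<^sub>2. tens HH ?H2 x\<^sub>1 (tens HH HH x\<^sub>2 y)) (comult BP x))
          (comult BP (E a g)) = \<dots>" .
  qed
qed


text \<open>In the first law \<epsilon> acts on x and the components of y add up to y. In the second
  \<epsilon> vanishes on the components of y of degree z \<noteq> 1, so the group part z g of the
  remaining factor is g.\<close>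

lemma biproduct_counit_laws:
  assumes u: "u \<in> carrier HH"
  shows "tlift HH HH (\<lambda>x y. fscale (counit BP x) y) (comult BP u) = u"
    and "tlift HH HH (\<lambda>x y. fscale (counit BP y) x) (comult BP u) = u"
proof -
  note counit_lin = linear_map_add[OF linear_map_biproduct_counit]
    linear_map_scl[OF linear_map_biproduct_counit, unfolded scl_tensor]
  have bil1: "bilinear_map HH HH HH (\<lambda>x y. fscale (counit BP x) y)"
    by (rule bilinear_mapI) (simp_all add: counit_lin fscale_add_left mult.commute)
  have bil2: "bilinear_map HH HH HH (\<lambda>x y. fscale (counit BP y) x)"
    by (rule bilinear_mapI) (simp_all add: counit_lin fscale_add_left mult.commute)
  have id: "linear_map HH HH (\<lambda>u. u)" by (rule linear_map_id)
  show "tlift HH HH (\<lambda>x y. fscale (counit BP x) y) (comult BP u) = u"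
  proof (rule linear_map_eq_on_E[where U = HH and F' = "\<lambda>u. u" and
        F = "\<lambda>u. tlift HH HH (\<lambda>x y. fscale (counit BP x) y) (comult BP u)", OF _ id _ u])
    show "linear_map HH HH (\<lambda>u. tlift HH HH (\<lambda>x y. fscale (counit BP x) y) (comult BP u))"
      by (rule linear_map_comp[OF linear_map_biproduct_comult linear_map_tlift[OF _ _ _ bil1]]) auto
    fix a g assume a: "a \<in> carrier R" and g: "g \<in> carrier G"
    have "tlift HH HH (\<lambda>x y. fscale (counit BP x) y) (comult BP (E a g)) =
        sw (\<lambda>x y. \<Sum>z\<in>carrier G. fscale (counit BP (E x (z \<otimes> g))) (E (pr z y) g)) a"
      by (rule tlift_comult_E[OF is_vspace_tensor[of R kG] bil1 a g])
    also have "\<dots> = sw (\<lambda>x y. scl HH (\<epsilon> x) (E y g)) a"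
    proof (intro tsum_cong refl)
      fix x y assume x: "x \<in> carrier R" and y: "y \<in> carrier R"
      have "(\<Sum>z\<in>carrier G. fscale (counit BP (E x (z \<otimes> g))) (E (pr z y) g)) =
        fscale (\<epsilon> x) (E (\<Sum>z\<in>carrier G. pr z y) g)"
        by (simp add: biproduct_counit_E x g E_lin fscale_sum)
      then show "(\<Sum>z\<in>carrier G. fscale (counit BP (E x (z \<otimes> g))) (E (pr z y) g)) = scl HH (\<epsilon> x) (E y g)"
        by (simp add: sum_pr y)
    qed
    also have "\<dots> = E a g"
      by (rule R.sw_counit(1)[OF is_vspace_tensor linear_map_E[OF g] a])
    finally show "tlift HH HH (\<lambda>x y. fscale (counit BP x) y) (comult BP (E a g)) = E a g" .
  qed
  show "tlift HH HH (\<lambda>x y. fscale (counit BP y) x) (comult BP u) = u"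
  proof (rule linear_map_eq_on_E[where U = HH and F' = "\<lambda>u. u" and
        F = "\<lambda>u. tlift HH HH (\<lambda>x y. fscale (counit BP y) x) (comult BP u)", OF _ id _ u])
    show "linear_map HH HH (\<lambda>u. tlift HH HH (\<lambda>x y. fscale (counit BP y) x) (comult BP u))"
      by (rule linear_map_comp[OF linear_map_biproduct_comult linear_map_tlift[OF _ _ _ bil2]]) auto
    fix a g assume a: "a \<in> carrier R" and g: "g \<in> carrier G"
    have "tlift HH HH (\<lambda>x y. fscale (counit BP y) x) (comult BP (E a g)) =
        sw (\<lambda>x y. \<Sum>z\<in>carrier G. fscale (counit BP (E (pr z y) g)) (E x (z \<otimes> g))) a"
      by (rule tlift_comult_E[OF is_vspace_tensor[of R kG] bil2 a g])
    also have "\<dots> = sw (\<lambda>x y. scl HH (\<epsilon> y) (E x g)) a"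
    proof (intro tsum_cong refl)
      fix x y assume x: "x \<in> carrier R" and y: "y \<in> carrier R"
      have "(\<Sum>z\<in>carrier G. fscale (counit BP (E (pr z y) g)) (E x (z \<otimes> g))) =
        (\<Sum>z\<in>carrier G. if z = \<one> then fscale (\<epsilon> y) (E x (z \<otimes> g)) else 0)"
        by (intro sum.cong) (simp_all add: biproduct_counit_E y g counit_pr)
      then show "(\<Sum>z\<in>carrier G. fscale (counit BP (E (pr z y) g)) (E x (z \<otimes> g))) = scl HH (\<epsilon> y) (E x g)"
        by (simp add: g)
    qed
    also have "\<dots> = E a g"
      by (rule R.sw_counit(2)[OF is_vspace_tensor linear_map_E[OF g] a])
    finally show "tlift HH HH (\<lambda>x y. fscale (counit BP y) x) (comult BP (E a g)) = E a g" .
  qed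
qed

lemma coalgebra_biproduct: "coalgebra BP"
proof -
  have "linear_map BP (tensor BP BP) (comult BP)"
    using linear_map_biproduct_comult
    by (subst linear_map_space_cong[of BP HH "tensor BP BP" "tensor HH HH"])
       (simp_all add: carrier_biproduct tens_BP)
  moreover have "linear_map BP base (counit BP)"
    using linear_map_biproduct_counit
    by (subst linear_map_space_cong[of BP HH base base]) (simp_all add: carrier_biproduct)
  ultimately show ?thesis
    unfolding coalgebra_def tlift_BP
    using is_vspace_biproduct biproduct_coassoc biproduct_counit_laws
    by (simp add: tens_BP carrier_biproduct)
qed

section \<open>Compatibility of multiplication and comultiplication\<close>

lemma pr_pr_mul:
  assumes a: "a \<in> carrier R" and b: "b \<in> carrier R" and z: "z \<in> carrier G" and w: "w \<in> carrier G"
  shows "pr z (pr w a \<cdot> b) = pr w a \<cdot> pr (inv w \<otimes> z) b"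
proof -
  have "pr z (pr w a \<cdot> b) = (\<Sum>g\<in>carrier G. if g = w then pr w a \<cdot> pr (inv g \<otimes> z) b else 0)"
    using assms by (simp add: pr_mul pr_pr if_distrib[where f = "\<lambda>x. x \<cdot> _"] cong: if_cong)
  then show ?thesis using w by simp
qed

text \<open>The left side involves \<Delta>(a (g.b)). The braided product rule lets the degree w of
  a_2 act on the first factor, equivariance of \<Delta> moves g onto b_1 and b_2, and the
  Yetter-Drinfeld condition converts the degree of g.b_2 into a degree of b_2.\<close>

lemma biproduct_comult_mult_E:
  assumes a: "a \<in> carrier R" and g: "g \<in> carrier G" and b: "b \<in> carrier R" and h: "h \<in> carrier G"
  shows "comult BP (E a g \<bullet>\<^bsub>BP\<^esub> E b h) =
    tlift HH HH (\<lambda>a\<^sub>1 a\<^sub>2. tlift HH HH (\<lambda>b\<^sub>1 b\<^sub>2. tens HH HH (a\<^sub>1 \<bullet>\<^bsub>BP\<^esub> b\<^sub>1) (a\<^sub>2 \<bullet>\<^bsub>BP\<^esub> b\<^sub>2))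
      (comult BP (E b h))) (comult BP (E a g))"
proof -
  let ?H2 = "tensor HH HH"
  have bil0: "bilinear_map HH HH ?H2 (\<lambda>b\<^sub>1 b\<^sub>2. tens HH HH (a\<^sub>1 \<bullet>\<^bsub>BP\<^esub> b\<^sub>1) (a\<^sub>2 \<bullet>\<^bsub>BP\<^esub> b\<^sub>2))"
    if "a\<^sub>1 \<in> carrier HH" "a\<^sub>2 \<in> carrier HH" for a\<^sub>1 a\<^sub>2
    by (rule bilinear_mapI) (simp_all add: that tens_mem tens_lin BP_lin)
  have bil1: "bilinear_map HH HH ?H2 (\<lambda>a\<^sub>1 a\<^sub>2. tlift HH HH (\<lambda>b\<^sub>1 b\<^sub>2. tens HH HH (a\<^sub>1 \<bullet>\<^bsub>BP\<^esub> b\<^sub>1) (a\<^sub>2 \<bullet>\<^bsub>BP\<^esub> b\<^sub>2))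
      (comult BP (E b h)))"
    by (rule bilinear_map_tlift_param[OF _ _ _ _ _ _ bil0])
       (simp_all add: b h, rule bilinear_mapI, simp_all add: tens_mem tens_lin BP_lin)
  define \<mu> where "\<mu> = (\<lambda>x y. \<Sum>z\<in>carrier G. tens HH HH (E x (z \<otimes> (g \<otimes> h))) (E (pr z y) (g \<otimes> h)))"
  have \<mu>: "bilinear_map R R ?H2 \<mu>"
    unfolding \<mu>_def by (rule bilinear_mapI)
      (simp_all add: g h sum_mem[OF is_vspace_tensor] tens_mem E_lin lin tens_lin sum.distrib fscale_sum)
  have \<mu>': "bilinear_map R R ?H2 (\<lambda>x y. \<mu> (a\<^sub>1 \<cdot> act R w x) (a\<^sub>2 \<cdot> y))"
    if "a\<^sub>1 \<in> carrier R" "a\<^sub>2 \<in> carrier R" "w \<in> carrier G" for a\<^sub>1 a\<^sub>2 w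
    unfolding \<mu>_def by (rule bilinear_mapI)
      (simp_all add: that g h sum_mem[OF is_vspace_tensor] tens_mem E_lin lin tens_lin sum.distrib fscale_sum)
  have "comult BP (E a g \<bullet>\<^bsub>BP\<^esub> E b h) = sw \<mu> (a \<cdot> act R g b)"
    using assms by (simp add: biproduct_mult_E biproduct_comult_E comultE_def \<mu>_def)
  also have "\<dots> = sw (\<lambda>a\<^sub>1 a\<^sub>2. \<Sum>w\<in>carrier G. sw (\<lambda>b\<^sub>1 b\<^sub>2. \<mu> (a\<^sub>1 \<cdot> act R w b\<^sub>1) (pr w a\<^sub>2 \<cdot> b\<^sub>2)) (act R g b)) a"
    by (rule sw_mul[OF is_vspace_tensor \<mu> a]) (simp add: g b)
  also have "\<dots> = sw (\<lambda>a\<^sub>1 a\<^sub>2. \<Sum>w\<in>carrier G. sw (\<lambda>b\<^sub>1 b\<^sub>2.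
      \<mu> (a\<^sub>1 \<cdot> act R w (act R g b\<^sub>1)) (pr w a\<^sub>2 \<cdot> act R g b\<^sub>2)) b) a"
    by (intro tsum_cong sum.cong refl sw_act[OF is_vspace_tensor \<mu>' g b]) simp_all
  also have "\<dots> = sw (\<lambda>a\<^sub>1 a\<^sub>2. \<Sum>w\<in>carrier G. sw (\<lambda>b\<^sub>1 b\<^sub>2. \<Sum>z\<in>carrier G.
      tens HH HH (E a\<^sub>1 (w \<otimes> g) \<bullet>\<^bsub>BP\<^esub> E b\<^sub>1 (z \<otimes> h)) (E (pr w a\<^sub>2) g \<bullet>\<^bsub>BP\<^esub> E (pr z b\<^sub>2) h)) b) a"
  proof (intro tsum_cong sum.cong refl)
    fix a\<^sub>1 a\<^sub>2 w b\<^sub>1 b\<^sub>2 assume *: "a\<^sub>1 \<in> carrier R" "a\<^sub>2 \<in> carrier R" "w \<in> carrier G" "b\<^sub>1 \<in> carrier R" "b\<^sub>2 \<in> carrier R"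
    have "\<mu> (a\<^sub>1 \<cdot> act R w (act R g b\<^sub>1)) (pr w a\<^sub>2 \<cdot> act R g b\<^sub>2) =
      (\<Sum>z\<in>carrier G. tens HH HH (E (a\<^sub>1 \<cdot> act R (w \<otimes> g) b\<^sub>1) (z \<otimes> (g \<otimes> h)))
        (E (pr w a\<^sub>2 \<cdot> pr (inv w \<otimes> z) (act R g b\<^sub>2)) (g \<otimes> h)))"
      unfolding \<mu>_def by (intro sum.cong refl) (simp add: * g h act_act pr_pr_mul)
    \<comment> \<open>Substitution z \<mapsto> w (g z g^-1): from here z is the degree of b_2, no
      longer that of the product of \<open>pr w a\<^sub>2\<close> with g.b_2.\<close>
    also have "\<dots> = (\<Sum>z\<in>carrier G. tens HH HH (E (a\<^sub>1 \<cdot> act R (w \<otimes> g) b\<^sub>1) (w \<otimes> g \<otimes> (z \<otimes> h)))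
        (E (pr w a\<^sub>2 \<cdot> pr (g \<otimes> z \<otimes> inv g) (act R g b\<^sub>2)) (g \<otimes> h)))"
      by (rule sum.reindex_bij_witness[of _ "\<lambda>z. w \<otimes> (g \<otimes> z \<otimes> inv g)" "\<lambda>z. inv g \<otimes> (inv w \<otimes> z) \<otimes> g"])
         (simp_all add: * g h m_assoc)
    also have "\<dots> = (\<Sum>z\<in>carrier G. tens HH HH (E a\<^sub>1 (w \<otimes> g) \<bullet>\<^bsub>BP\<^esub> E b\<^sub>1 (z \<otimes> h))
        (E (pr w a\<^sub>2) g \<bullet>\<^bsub>BP\<^esub> E (pr z b\<^sub>2) h))"
      by (intro sum.cong refl) (simp add: * g h biproduct_mult_E pr_act)
    finally show "\<mu> (a\<^sub>1 \<cdot> act R w (act R g b\<^sub>1)) (pr w a\<^sub>2 \<cdot> act R g b\<^sub>2) = \<dots>" .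
  qed
  also have "\<dots> = sw (\<lambda>a\<^sub>1 a\<^sub>2. \<Sum>w\<in>carrier G. tlift HH HH (\<lambda>b\<^sub>1 b\<^sub>2.
      tens HH HH (E a\<^sub>1 (w \<otimes> g) \<bullet>\<^bsub>BP\<^esub> b\<^sub>1) (E (pr w a\<^sub>2) g \<bullet>\<^bsub>BP\<^esub> b\<^sub>2)) (comult BP (E b h))) a"
    by (intro tsum_cong sum.cong refl tlift_comult_E[OF is_vspace_tensor[of HH HH] bil0 b h, symmetric])
       (simp_all add: g)
  also have "\<dots> = tlift HH HH (\<lambda>a\<^sub>1 a\<^sub>2. tlift HH HH (\<lambda>b\<^sub>1 b\<^sub>2. tens HH HH (a\<^sub>1 \<bullet>\<^bsub>BP\<^esub> b\<^sub>1) (a\<^sub>2 \<bullet>\<^bsub>BP\<^esub> b\<^sub>2))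
      (comult BP (E b h))) (comult BP (E a g))"
    by (rule tlift_comult_E[OF is_vspace_tensor[of HH HH] bil1 a g, symmetric])
  finally show ?thesis .
qed

lemma biproduct_comult_mult:
  assumes u: "u \<in> carrier HH" and v: "v \<in> carrier HH"
  shows "comult BP (u \<bullet>\<^bsub>BP\<^esub> v) =
    tlift HH HH (\<lambda>a\<^sub>1 a\<^sub>2. tlift HH HH (\<lambda>b\<^sub>1 b\<^sub>2. tens HH HH (a\<^sub>1 \<bullet>\<^bsub>BP\<^esub> b\<^sub>1) (a\<^sub>2 \<bullet>\<^bsub>BP\<^esub> b\<^sub>2))
      (comult BP v)) (comult BP u)"
proof -
  let ?H2 = "tensor HH HH"
  let ?M = "\<lambda>u v. tlift HH HH (\<lambda>a\<^sub>1 a\<^sub>2. tlift HH HH (\<lambda>b\<^sub>1 b\<^sub>2. tens HH HH (a\<^sub>1 \<bullet>\<^bsub>BP\<^esub> b\<^sub>1) (a\<^sub>2 \<bullet>\<^bsub>BP\<^esub> b\<^sub>2))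
      (comult BP v)) (comult BP u)"
  have bil0: "bilinear_map HH HH ?H2 (\<lambda>b\<^sub>1 b\<^sub>2. tens HH HH (a\<^sub>1 \<bullet>\<^bsub>BP\<^esub> b\<^sub>1) (a\<^sub>2 \<bullet>\<^bsub>BP\<^esub> b\<^sub>2))"
    if "a\<^sub>1 \<in> carrier HH" "a\<^sub>2 \<in> carrier HH" for a\<^sub>1 a\<^sub>2
    by (rule bilinear_mapI) (simp_all add: that tens_mem tens_lin BP_lin)
  have bil1: "bilinear_map HH HH ?H2 (\<lambda>a\<^sub>1 a\<^sub>2. tlift HH HH (\<lambda>b\<^sub>1 b\<^sub>2. tens HH HH (a\<^sub>1 \<bullet>\<^bsub>BP\<^esub> b\<^sub>1) (a\<^sub>2 \<bullet>\<^bsub>BP\<^esub> b\<^sub>2))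
      (comult BP v))" if "v \<in> carrier HH" for v
    by (rule bilinear_map_tlift_param[OF _ _ _ _ _ _ bil0])
       (simp_all add: that, rule bilinear_mapI, simp_all add: tens_mem tens_lin BP_lin)
  have lin1: "linear_map HH ?H2 (\<lambda>u. ?M u v)" if "v \<in> carrier HH" for v
    by (rule linear_map_comp[OF linear_map_biproduct_comult linear_map_tlift[OF _ _ _ bil1[OF that]]]) auto
  have lin2: "linear_map HH ?H2 (\<lambda>v. ?M u v)" if u: "u \<in> carrier HH" for u
    by (rule linear_map_tlift_param[OF _ _ _ _ bil1])
       (simp_all add: u linear_map_comp[OF linear_map_biproduct_comult linear_map_tlift[OF _ _ _ bil0]])
  have lin3: "linear_map HH ?H2 (\<lambda>u. comult BP (u \<bullet>\<^bsub>BP\<^esub> v))" if "v \<in> carrier HH" for v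
    by (rule linear_map_comp[OF BP_mult_linear(2)[OF that] linear_map_biproduct_comult])
  have lin4: "linear_map HH ?H2 (\<lambda>v. comult BP (u \<bullet>\<^bsub>BP\<^esub> v))" if "u \<in> carrier HH" for u
    by (rule linear_map_comp[OF BP_mult_linear(1)[OF that] linear_map_biproduct_comult])
  show ?thesis
  proof (rule linear_map_eq_on_E[OF lin3[OF v] lin1[OF v] _ u])
    fix a g assume a: "a \<in> carrier R" and g: "g \<in> carrier G"
    show "comult BP (E a g \<bullet>\<^bsub>BP\<^esub> v) = ?M (E a g) v"
      by (rule linear_map_eq_on_E[OF lin4 lin2 _ v]) (simp_all add: a g biproduct_comult_mult_E)
  qed
qed

lemma biproduct_counit_mult:
  assumes u: "u \<in> carrier HH" and v: "v \<in> carrier HH"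
  shows "counit BP (u \<bullet>\<^bsub>BP\<^esub> v) = counit BP u * counit BP v"
proof -
  note counit_lin = linear_map_add[OF linear_map_biproduct_counit]
    linear_map_scl[OF linear_map_biproduct_counit, unfolded scl_tensor]
  show ?thesis
  proof (rule linear_map_eq_on_E[where U = base and F = "\<lambda>u. counit BP (u \<bullet>\<^bsub>BP\<^esub> v)"
        and F' = "\<lambda>u. counit BP u * counit BP v", OF _ _ _ u])
    fix a g assume a: "a \<in> carrier R" and g: "g \<in> carrier G"
    show "counit BP (E a g \<bullet>\<^bsub>BP\<^esub> v) = counit BP (E a g) * counit BP v"
      by (rule linear_map_eq_on_E[where U = base and F = "\<lambda>v. counit BP (E a g \<bullet>\<^bsub>BP\<^esub> v)"
        and F' = "\<lambda>v. counit BP (E a g) * counit BP v", OF _ _ _ v])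
        ((rule linear_mapI; simp add: a g BP_lin counit_lin algebra_simps) |
          simp add: a g biproduct_mult_E biproduct_counit_E)+
  qed (rule linear_mapI; simp add: v BP_lin counit_lin algebra_simps)+
qed


section \<open>The antipode of the biproduct\<close>

definition SR :: "'v \<Rightarrow> 'v" where "SR = (SOME S. is_antipode R S)"

lemma is_antipode_SR: "is_antipode R SR"
proof -
  have "\<exists>S. is_antipode R S" using braided by (simp add: braided_hopf_algebra_def)
  then show ?thesis unfolding SR_def by (rule someI_ex)
qed

lemma linear_map_SR: "linear_map R R SR"
  using is_antipode_SR by (simp add: is_antipode_def)

lemma SR_mem [simp]: "a \<in> carrier R \<Longrightarrow> SR a \<in> carrier R"
  by (rule linear_map_mem[OF linear_map_SR])

lemma SR_lin:
  "a \<in> carrier R \<Longrightarrow> b \<in> carrier R \<Longrightarrow> SR (a + b) = SR a + SR b"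
  "a \<in> carrier R \<Longrightarrow> SR (scl R c a) = scl R c (SR a)" "SR 0 = 0"
  using linear_map_add[OF linear_map_SR] linear_map_scl[OF linear_map_SR]
    linear_map_zero[OF is_vspace_R linear_map_SR] by auto

lemma SR_conv:
  assumes "a \<in> carrier R"
  shows "sw (\<lambda>x y. x \<cdot> SR y) a = scl R (\<epsilon> a) e" "sw (\<lambda>x y. SR x \<cdot> y) a = scl R (\<epsilon> a) e"
proof -
  have "bilinear_map R R R (\<lambda>x y. x \<cdot> SR y)" "bilinear_map R R R (\<lambda>x y. SR x \<cdot> y)"
    by (rule bilinear_mapI; simp add: SR_lin lin)+
  note this[THEN tlift_comult[OF is_vspace_R]]
  then show "sw (\<lambda>x y. x \<cdot> SR y) a = scl R (\<epsilon> a) e" "sw (\<lambda>x y. SR x \<cdot> y) a = scl R (\<epsilon> a) e"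
    using is_antipode_SR assms by (simp_all add: is_antipode_def)
qed

text \<open>The antipode \<open>a # g \<mapsto> (1 # S(a\<^sub>-\<^sub>1 g)) (S\<^sub>R(a\<^sub>0) # 1)\<close> of the biproduct.\<close>

definition antipodeE :: "'v \<Rightarrow> 'g \<Rightarrow> ('k, 'v, 'g \<Rightarrow> 'k) tensor" where
  "antipodeE a g = (\<Sum>z\<in>carrier G. E (act R (inv (z \<otimes> g)) (SR (pr z a))) (inv (z \<otimes> g)))"

definition antipodeB :: "('k, 'v, 'g \<Rightarrow> 'k) tensor \<Rightarrow> ('k, 'v, 'g \<Rightarrow> 'k) tensor" where
  "antipodeB u = (\<Sum>g\<in>carrier G. antipodeE (cmp g u) g)"

lemma antipodeE_mem [simp]: "a \<in> carrier R \<Longrightarrow> g \<in> carrier G \<Longrightarrow> antipodeE a g \<in> carrier HH"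
  unfolding antipodeE_def by (intro sum_mem[OF is_vspace_tensor]) simp

lemma antipodeE_lin:
  "a \<in> carrier R \<Longrightarrow> b \<in> carrier R \<Longrightarrow> g \<in> carrier G \<Longrightarrow> antipodeE (a + b) g = antipodeE a g + antipodeE b g"
  "a \<in> carrier R \<Longrightarrow> g \<in> carrier G \<Longrightarrow> antipodeE (scl R c a) g = fscale c (antipodeE a g)"
  "g \<in> carrier G \<Longrightarrow> antipodeE 0 g = 0"
  by (simp_all add: antipodeE_def E_lin SR_lin lin sum.distrib fscale_sum)

lemma linear_map_antipodeB: "linear_map HH HH antipodeB"
  by (rule linear_mapI)
     (simp_all add: antipodeB_def sum_mem[OF is_vspace_tensor] cmp_lin antipodeE_lin sum.distrib fscale_sum)

lemma antipodeB_mem [simp]: "u \<in> carrier HH \<Longrightarrow> antipodeB u \<in> carrier HH"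
  by (rule linear_map_mem[OF linear_map_antipodeB])

lemma antipodeB_lin:
  "u \<in> carrier HH \<Longrightarrow> v \<in> carrier HH \<Longrightarrow> antipodeB (u + v) = antipodeB u + antipodeB v"
  "u \<in> carrier HH \<Longrightarrow> antipodeB (fscale c u) = fscale c (antipodeB u)"
  using linear_map_add[OF linear_map_antipodeB] linear_map_scl[OF linear_map_antipodeB] by auto

lemma antipodeB_E:
  assumes "a \<in> carrier R" "g \<in> carrier G"
  shows "antipodeB (E a g) = antipodeE a g"
proof -
  have "antipodeB (E a g) = (\<Sum>h\<in>carrier G. if h = g then antipodeE a h else 0)"
    unfolding antipodeB_def using assms by (intro sum.cong) (auto simp: cmp_E antipodeE_lin)
  then show ?thesis using assms by simp
qed

text \<open>A homogeneous argument leaves one term of the sum. The right tensor factors in the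
  comultiplication of \<open>a # g\<close> are all of this kind.\<close>

lemma antipodeE_pr:
  assumes "a \<in> carrier R" "g \<in> carrier G" "z \<in> carrier G"
  shows "antipodeE (pr z a) g = E (act R (inv (z \<otimes> g)) (SR (pr z a))) (inv (z \<otimes> g))"
proof -
  have "antipodeE (pr z a) g =
    (\<Sum>w\<in>carrier G. if w = z then E (act R (inv (w \<otimes> g)) (SR (pr w a))) (inv (w \<otimes> g)) else 0)"
    unfolding antipodeE_def using assms by (intro sum.cong) (auto simp: pr_pr SR_lin E_lin)
  then show ?thesis using assms by simp
qed

text \<open>In the product of \<open>x # zg\<close> with the antipode of \<open>pr z y # g\<close>,
  the action of zg undoes the twist by its inverse and the group parts cancel, which leaves
  \<open>x \<cdot> SR (pr z y)\<close> over 1. Summing over z restores y, and the convolution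
  identity of R applies.\<close>

lemma antipodeB_conv_right:
  assumes u: "u \<in> carrier HH"
  shows "tlift HH HH (\<lambda>x y. x \<bullet>\<^bsub>BP\<^esub> antipodeB y) (comult BP u) = fscale (counit BP u) (E e \<one>)"
proof -
  have bil: "bilinear_map HH HH HH (\<lambda>x y. x \<bullet>\<^bsub>BP\<^esub> antipodeB y)"
    by (rule bilinear_mapI) (simp_all add: BP_lin antipodeB_lin)
  show ?thesis
  proof (rule linear_map_eq_on_E[where U = HH and
        F = "\<lambda>u. tlift HH HH (\<lambda>x y. x \<bullet>\<^bsub>BP\<^esub> antipodeB y) (comult BP u)" and
        F' = "\<lambda>u. fscale (counit BP u) (E e \<one>)", OF _ _ _ u])
    show "linear_map HH HH (\<lambda>u. tlift HH HH (\<lambda>x y. x \<bullet>\<^bsub>BP\<^esub> antipodeB y) (comult BP u))"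
      by (rule linear_map_comp[OF linear_map_biproduct_comult linear_map_tlift[OF _ _ _ bil]]) auto
    show "linear_map HH HH (\<lambda>u. fscale (counit BP u) (E e \<one>))"
      by (rule linear_mapI) (simp_all add: linear_map_add[OF linear_map_biproduct_counit] fscale_add_left
        linear_map_scl[OF linear_map_biproduct_counit, unfolded scl_tensor])
    fix a g assume a: "a \<in> carrier R" and g: "g \<in> carrier G"
    have "tlift HH HH (\<lambda>x y. x \<bullet>\<^bsub>BP\<^esub> antipodeB y) (comult BP (E a g)) =
        sw (\<lambda>x y. \<Sum>z\<in>carrier G. E x (z \<otimes> g) \<bullet>\<^bsub>BP\<^esub> antipodeB (E (pr z y) g)) a"
      by (rule tlift_comult_E[OF is_vspace_tensor[of R kG] bil a g])
    also have "\<dots> = sw (\<lambda>x y. E (x \<cdot> SR y) \<one>) a"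
    proof (intro tsum_cong refl)
      fix x y assume x: "x \<in> carrier R" and y: "y \<in> carrier R"
      have "(\<Sum>z\<in>carrier G. E x (z \<otimes> g) \<bullet>\<^bsub>BP\<^esub> antipodeB (E (pr z y) g)) =
        (\<Sum>z\<in>carrier G. E (x \<cdot> SR (pr z y)) \<one>)"
        by (intro sum.cong refl)
           (simp add: x y g antipodeB_E antipodeE_pr biproduct_mult_E act_act)
      also have "\<dots> = E (x \<cdot> SR (\<Sum>z\<in>carrier G. pr z y)) \<one>"
        by (simp add: E_lin(4)[symmetric] mul_sum(1)[symmetric] x y linear_map_sum[OF is_vspace_R linear_map_SR])
      finally show "(\<Sum>z\<in>carrier G. E x (z \<otimes> g) \<bullet>\<^bsub>BP\<^esub> antipodeB (E (pr z y) g)) = E (x \<cdot> SR y) \<one>"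
        by (simp add: sum_pr y)
    qed
    also have "\<dots> = E (sw (\<lambda>x y. x \<cdot> SR y) a) \<one>"
      by (rule tsum_linear[OF linear_map_E, symmetric]) simp_all
    finally show "tlift HH HH (\<lambda>x y. x \<bullet>\<^bsub>BP\<^esub> antipodeB y) (comult BP (E a g)) =
        fscale (counit BP (E a g)) (E e \<one>)"
      by (simp add: SR_conv a g E_lin biproduct_counit_E)
  qed
qed

text \<open>The twists do not cancel termwise here. With x split into degrees w, each term is the
  image of \<open>SR (pr w x) \<cdot> pr z y\<close> under a map depending only on the total degree
  v = w z. Gradedness of \<Delta> collects the terms of equal v into the convolution of
  \<open>SR\<close> with the identity, taken at \<open>pr v a\<close>; the result is a multiple of
  \<epsilon>(\<open>pr v a\<close>) and vanishes unless v = 1.\<close>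

lemma antipodeB_conv_left:
  assumes u: "u \<in> carrier HH"
  shows "tlift HH HH (\<lambda>x y. antipodeB x \<bullet>\<^bsub>BP\<^esub> y) (comult BP u) = fscale (counit BP u) (E e \<one>)"
proof -
  have bil: "bilinear_map HH HH HH (\<lambda>x y. antipodeB x \<bullet>\<^bsub>BP\<^esub> y)"
    by (rule bilinear_mapI) (simp_all add: BP_lin antipodeB_lin)
  show ?thesis
  proof (rule linear_map_eq_on_E[where U = HH and
        F = "\<lambda>u. tlift HH HH (\<lambda>x y. antipodeB x \<bullet>\<^bsub>BP\<^esub> y) (comult BP u)" and
        F' = "\<lambda>u. fscale (counit BP u) (E e \<one>)", OF _ _ _ u])
    show "linear_map HH HH (\<lambda>u. tlift HH HH (\<lambda>x y. antipodeB x \<bullet>\<^bsub>BP\<^esub> y) (comult BP u))"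
      by (rule linear_map_comp[OF linear_map_biproduct_comult linear_map_tlift[OF _ _ _ bil]]) auto
    show "linear_map HH HH (\<lambda>u. fscale (counit BP u) (E e \<one>))"
      by (rule linear_mapI) (simp_all add: linear_map_add[OF linear_map_biproduct_counit] fscale_add_left
        linear_map_scl[OF linear_map_biproduct_counit, unfolded scl_tensor])
    fix a g assume a: "a \<in> carrier R" and g: "g \<in> carrier G"
    \<comment> \<open>The map attached to the total degree v. At v = 1 the group part is g^-1 g, so
      e is sent to \<open>E e \<one>\<close>.\<close>
    define f where "f = (\<lambda>v c. E (act R (inv (v \<otimes> g)) c) (inv (v \<otimes> g) \<otimes> g))"
    have f: "linear_map R HH (f v)" if "v \<in> carrier G" for v
      unfolding f_def by (rule linear_mapI) (simp_all add: E_lin lin that g)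
    have f_bil: "bilinear_map R R HH (\<lambda>x y. f v (SR x \<cdot> y))" if "v \<in> carrier G" for v
      by (rule bilinear_mapI) (simp_all add: that f_def g E_lin lin SR_lin)
    have "tlift HH HH (\<lambda>x y. antipodeB x \<bullet>\<^bsub>BP\<^esub> y) (comult BP (E a g)) =
        sw (\<lambda>x y. \<Sum>z\<in>carrier G. antipodeB (E x (z \<otimes> g)) \<bullet>\<^bsub>BP\<^esub> E (pr z y) g) a"
      by (rule tlift_comult_E[OF is_vspace_tensor[of R kG] bil a g])
    also have "\<dots> = sw (\<lambda>x y. \<Sum>v\<in>carrier G. \<Sum>w\<in>carrier G. f v (SR (pr w x) \<cdot> pr (inv w \<otimes> v) y)) a"
    proof (intro tsum_cong refl)
      fix x y assume x: "x \<in> carrier R" and y: "y \<in> carrier R"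
      have "antipodeB (E x (z \<otimes> g)) \<bullet>\<^bsub>BP\<^esub> E (pr z y) g =
        (\<Sum>w\<in>carrier G. f (w \<otimes> z) (SR (pr w x) \<cdot> pr z y))" if z: "z \<in> carrier G" for z
      proof -
        have "antipodeB (E x (z \<otimes> g)) \<bullet>\<^bsub>BP\<^esub> E (pr z y) g =
          (\<Sum>w\<in>carrier G. E (act R (inv (w \<otimes> (z \<otimes> g))) (SR (pr w x))) (inv (w \<otimes> (z \<otimes> g))) \<bullet>\<^bsub>BP\<^esub> E (pr z y) g)"
          using x y z g unfolding antipodeB_E[OF x m_closed[OF z g]] antipodeE_def
          by (intro linear_map_sum[OF is_vspace_tensor BP_mult_linear(2)]) simp_all
        also have "\<dots> = (\<Sum>w\<in>carrier G. f (w \<otimes> z) (SR (pr w x) \<cdot> pr z y))"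
          by (intro sum.cong refl) (simp add: f_def x y z g biproduct_mult_E act_mul m_assoc)
        finally show ?thesis .
      qed
      then have "(\<Sum>z\<in>carrier G. antipodeB (E x (z \<otimes> g)) \<bullet>\<^bsub>BP\<^esub> E (pr z y) g) =
        (\<Sum>z\<in>carrier G. \<Sum>w\<in>carrier G. f (w \<otimes> z) (SR (pr w x) \<cdot> pr z y))" by simp
      also have "\<dots> = (\<Sum>v\<in>carrier G. \<Sum>w\<in>carrier G. f v (SR (pr w x) \<cdot> pr (inv w \<otimes> v) y))"
        by (rule sum_mult_reindex[symmetric])
      finally show "(\<Sum>z\<in>carrier G. antipodeB (E x (z \<otimes> g)) \<bullet>\<^bsub>BP\<^esub> E (pr z y) g) = \<dots>" .
    qed
    also have "\<dots> = (\<Sum>v\<in>carrier G. sw (\<lambda>x y. f v (SR x \<cdot> y)) (pr v a))"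
      unfolding tsum_sum
      by (intro sum.cong refl sw_pr[OF is_vspace_tensor f_bil _ a, symmetric])
    also have "\<dots> = (\<Sum>v\<in>carrier G. f v (sw (\<lambda>x y. SR x \<cdot> y) (pr v a)))"
      by (intro sum.cong refl tsum_linear[OF f, symmetric]) simp_all
    also have "\<dots> = (\<Sum>v\<in>carrier G. if v = \<one> then f v (scl R (\<epsilon> a) e) else 0)"
      by (intro sum.cong refl)
         (simp add: SR_conv a counit_pr linear_map_zero[OF is_vspace_R f] scl_zero_left[OF is_vspace_R])
    also have "\<dots> = fscale (\<epsilon> a) (E e \<one>)"
      by (simp add: f_def lin E_lin g)
    finally show "tlift HH HH (\<lambda>x y. antipodeB x \<bullet>\<^bsub>BP\<^esub> y) (comult BP (E a g)) =
        fscale (counit BP (E a g)) (E e \<one>)"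
      by (simp add: a g biproduct_counit_E)
  qed
qed

lemma is_antipode_antipodeB: "is_antipode BP antipodeB"
proof -
  have "linear_map BP BP antipodeB"
    using linear_map_antipodeB
    by (subst linear_map_space_cong[of BP HH BP HH]) (simp_all add: carrier_biproduct)
  then show ?thesis
    unfolding is_antipode_def tlift_BP
    by (simp add: carrier_biproduct antipodeB_conv_left antipodeB_conv_right biproduct_unit)
qed

lemma hopf_algebra_biproduct: "hopf_algebra BP"
proof -
  have "comult BP (E e \<one>) = tens HH HH (E e \<one>) (E e \<one>)"
  proof -
    have "comult BP (E e \<one>) = (\<Sum>z\<in>carrier G. tens HH HH (E e (z \<otimes> \<one>)) (E (pr z e) \<one>))"
      unfolding biproduct_comult_E[OF unit_mem one_closed] comultE_def
      by (rule sw_unit[OF is_vspace_tensor[of HH HH]], rule bilinear_mapI)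
         (simp_all add: sum_mem[OF is_vspace_tensor] tens_mem E_lin lin tens_lin sum.distrib fscale_sum)
    \<comment> \<open>The unit of R has degree 1, so only z = 1 contributes.\<close>
    also have "\<dots> = (\<Sum>z\<in>carrier G. if z = \<one> then tens HH HH (E e z) (E e \<one>) else 0)"
      by (intro sum.cong) (auto simp: pr_unit E_lin tens_zero_right)
    finally show ?thesis by simp
  qed
  then show ?thesis
    unfolding hopf_algebra_def carrier_biproduct tlift_BP biproduct_unit
    using unital_algebra_biproduct coalgebra_biproduct is_antipode_antipodeB
    by (auto simp: biproduct_comult_mult biproduct_counit_mult tens_BP biproduct_counit_E)
qed

text \<open>Uniqueness of convolution inverses replaces the arbitrary choice in
  \<open>antipode\<close> by the explicit formula.\<close>

lemma antipode_biproduct: "u \<in> carrier HH \<Longrightarrow> antipode BP u = antipodeB u"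
  unfolding antipode_def
  by (rule antipode_unique[OF unital_algebra_biproduct coalgebra_biproduct _ is_antipode_antipodeB])
     (simp_all add: carrier_biproduct someI[of "is_antipode BP", OF is_antipode_antipodeB])


section \<open>The subspaces R # kX and their dimension\<close>

abbreviation part where "part \<equiv> biproduct_part R G"

context
  fixes X :: "'g set"
  assumes X: "X \<subseteq> carrier G"
begin

lemma part_space: "part X = carrier (tensor R (group_algebra (G\<lparr>carrier := X\<rparr>)))"
  by (simp add: biproduct_part_def)

lemma carrier_kX: "carrier (group_algebra (G\<lparr>carrier := X\<rparr>)) \<subseteq> (carrier kG :: ('g \<Rightarrow> 'k) set)"
  using X by (auto simp: carrier_group_algebra)

lemma tens_kX: "tens R (group_algebra (G\<lparr>carrier := X\<rparr>)) = tens R kG"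
  by (rule tens_cong) simp_all

lemma subspace_part: "module.subspace fscale (part X)"
  unfolding part_space using carrier_subspace[OF is_vspace_tensor] by simp

lemma E_mem_part: "a \<in> carrier R \<Longrightarrow> g \<in> X \<Longrightarrow> E a g \<in> part X"
  unfolding part_space E_def tens_kX[symmetric]
  by (rule tens_mem) (simp_all add: carrier_group_algebra gel_def)

lemma part_list_repr:
  assumes "u \<in> part X"
  shows "\<exists>ps. set ps \<subseteq> carrier R \<times> carrier (group_algebra (G\<lparr>carrier := X\<rparr>)) \<and>
    u = (\<Sum>(v, w)\<leftarrow>ps. tens R kG v w)"
  using tensor_list_repr[OF is_vspace_R assms[unfolded part_space]] unfolding tens_kX .

lemma part_mem: "u \<in> part X \<Longrightarrow> u \<in> carrier HH"
  using part_list_repr carrier_kX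
  by (force intro!: sum_list_mem[OF is_vspace_tensor] tens_mem simp: case_prod_unfold)

text \<open>In a presentation over kX every group algebra factor is a function vanishing off X, so
  \<open>cmp g\<close> kills each term.\<close>

lemma cmp_part:
  assumes u: "u \<in> part X" and g: "g \<notin> X"
  shows "cmp g u = 0"
proof -
  obtain ps where ps: "set ps \<subseteq> carrier R \<times> carrier (group_algebra (G\<lparr>carrier := X\<rparr>))"
    "u = (\<Sum>(v, w)\<leftarrow>ps. tens R kG v w)"
    using part_list_repr[OF u] by blast
  have "cmp g (tens R kG (fst p) (snd p)) = 0" if "p \<in> set ps" for p
  proof -
    have p: "fst p \<in> carrier R" "snd p \<in> carrier (group_algebra (G\<lparr>carrier := X\<rparr>))"
      using ps(1) that by auto
    then have "snd p g = 0" using g by (simp add: carrier_group_algebra)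
    then show ?thesis
      using p carrier_kX by (auto simp: cmp_def rcoord_tens scl_zero_left[OF is_vspace_R])
  qed
  then have "(\<Sum>p\<leftarrow>ps. cmp g (tens R kG (fst p) (snd p))) = (\<Sum>p\<leftarrow>ps. 0)"
    by (intro arg_cong[of _ _ sum_list] map_cong) auto
  moreover have "cmp g u = (\<Sum>p\<leftarrow>ps. cmp g (tens R kG (fst p) (snd p)))"
    unfolding ps(2) case_prod_unfold
    using ps(1) carrier_kX
    by (intro linear_map_sum_list_on[OF is_vspace_tensor linear_map_cmp] tens_mem) auto
  ultimately show ?thesis by simp
qed

lemma finite_part_index: "finite X"
  using X fin by (rule finite_subset)

lemma part_expand: "u \<in> part X \<Longrightarrow> u = (\<Sum>g\<in>X. E (cmp g u) g)"
proof -
  assume u: "u \<in> part X"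
  have "u = (\<Sum>g\<in>carrier G. E (cmp g u) g)" by (rule E_expand[OF part_mem[OF u]])
  also have "\<dots> = (\<Sum>g\<in>X. E (cmp g u) g)"
    by (rule sum.mono_neutral_right) (use X u in \<open>auto simp: cmp_part E_lin\<close>)
  finally show ?thesis .
qed

text \<open>The elements \<open>b # g\<close>, with b in a basis of R and g in X, form a basis. A
  linear relation among them is tested one group element h at a time by \<open>cmp h\<close>, which
  leaves a relation among the basis of R.\<close>

lemma vdim_part:
  assumes "vdim R > 0"
  shows "vector_space.dim fscale (part X) = card X * vdim R"
proof -
  interpret V: vector_space "scl R" using is_vspace_R by (simp add: is_vspace_def)
  interpret F: vector_space "fscale :: 'k \<Rightarrow> (('v \<Rightarrow> ('g \<Rightarrow> 'k) \<Rightarrow> 'k) \<Rightarrow> 'k) \<Rightarrow> _"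
    by (rule vector_space_fscale)
  obtain B where B: "B \<subseteq> carrier R" "V.independent B" "carrier R \<subseteq> V.span B" "card B = vdim R"
    using V.basis_exists[of "carrier R"] unfolding vdim_def by blast
  \<comment> \<open>Positive cardinality forces finiteness, since \<open>card\<close> of an infinite
    set is 0.\<close>
  then have fB: "finite B" using assms by (intro card_ge_0_finite) simp
  have BR: "b \<in> carrier R" if "b \<in> B" for b using that B(1) by blast
  have XG: "g \<in> carrier G" if "g \<in> X" for g using that X by blast
  define BX where "BX = (\<lambda>(b, g). E b g) ` (B \<times> X)"
  \<comment> \<open>All \<open>E 0 g\<close> coincide; only a nonzero b lets \<open>E b g\<close>
    determine g.\<close>
  have Bnz: "b \<noteq> 0" if "b \<in> B" for b using B(2) that V.dependent_zero by blast
  have inj: "inj_on (\<lambda>(b, g). E b g) (B \<times> X)"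
  proof (rule inj_onI, clarify)
    fix b g c h assume *: "b \<in> B" "g \<in> X" "c \<in> B" "h \<in> X" "E b g = E c h"
    have "b = cmp g (E b g)" using *(1-4) by (simp add: cmp_E BR XG)
    also have "\<dots> = cmp g (E c h)" by (simp only: *(5))
    also have "\<dots> = (if g = h then c else 0)" using *(1-4) by (simp add: cmp_E BR XG)
    finally have "b = (if g = h then c else 0)" .
    then show "b = c \<and> g = h" using Bnz[OF *(1)] by (auto split: if_splits)
  qed
  have sub: "BX \<subseteq> part X" using B(1) by (auto simp: BX_def E_mem_part)
  have span: "part X \<subseteq> F.span BX"
  proof
    fix u assume u: "u \<in> part X"
    have "E a g \<in> F.span BX" if a: "a \<in> carrier R" and g: "g \<in> X" for a g
    proof -
      have "a \<in> V.span B" using a B(3) by blast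
      then show ?thesis
      proof (induction rule: V.span_induct_alt)
        case base
        show ?case unfolding E_lin by (rule F.span_zero)
      next
        case (step c x y)
        have "E x g \<in> F.span BX" using step g by (auto simp: BX_def intro!: F.span_base)
        then show ?case unfolding E_lin by (intro F.span_add F.span_scale step)
      qed
    qed
    then have "(\<Sum>g\<in>X. E (cmp g u) g) \<in> F.span BX"
      using part_mem[OF u] by (intro F.span_sum) simp
    then show "u \<in> F.span BX" using part_expand[OF u] by simp
  qed
  have finBX: "finite BX" using fB finite_part_index by (simp add: BX_def)
  have scalars: "f u = 0" if sum: "(\<Sum>u\<in>BX. fscale (f u) u) = 0" and u: "u \<in> BX" for f u
  proof -
    obtain c h where u_eq: "u = E c h" and c: "c \<in> B" and h: "h \<in> X"
      using u by (auto simp: BX_def)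
    have hG: "h \<in> carrier G" using h X by blast
    have "0 = (\<Sum>(b, g)\<in>B \<times> X. fscale (f (E b g)) (E b g))"
      using sum unfolding BX_def by (subst (asm) sum.reindex[OF inj]) (simp add: case_prod_unfold)
    also have "\<dots> = (\<Sum>(b, g)\<in>B \<times> X. E (scl R (f (E b g)) b) g)"
      by (simp add: E_lin)
    finally have "cmp h 0 = cmp h (\<Sum>(b, g)\<in>B \<times> X. E (scl R (f (E b g)) b) g)" by simp
    also have "\<dots> = (\<Sum>(b, g)\<in>B \<times> X. cmp h (E (scl R (f (E b g)) b) g))"
      unfolding case_prod_unfold
      by (rule linear_map_sum[OF is_vspace_tensor linear_map_cmp]) (auto simp: BR XG)
    also have "\<dots> = (\<Sum>(b, g)\<in>B \<times> X. if g = h then scl R (f (E b g)) b else 0)"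
      by (intro sum.cong) (auto simp: cmp_E BR XG)
    also have "\<dots> = (\<Sum>b\<in>B. scl R (f (E b h)) b)"
      using h finite_part_index by (simp add: sum.cartesian_product[symmetric])
    finally have "(\<Sum>b\<in>B. scl R (f (E b h)) b) = 0"
      using linear_map_zero[OF is_vspace_tensor linear_map_cmp] by simp
    then have "f (E c h) = 0"
      by (rule V.independentD[OF B(2) fB subset_refl _ c])
    then show ?thesis by (simp only: u_eq)
  qed
  have indep: "F.independent BX"
    unfolding F.dependent_finite[OF finBX] using scalars by blast
  have "card BX = card (B \<times> X)"
    unfolding BX_def by (rule card_image[OF inj])
  then have "card BX = card X * vdim R"
    by (simp only: card_cartesian_product B(4) mult.commute)
  then show ?thesis by (rule F.dim_unique[OF sub span indep])
qed

end

lemma part_carrier: "part (carrier G) = carrier HH"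
  by (simp add: biproduct_part_def)

text \<open>The common factor \<open>vdim R\<close> cancels from the two dimensions.\<close>

lemma hopf_index_part:
  assumes X: "X \<subseteq> carrier G" "X \<noteq> {}" and d: "vdim R > 0"
  shows "hopf_index BP (part X) = of_nat (card (carrier G)) / of_nat (card X)"
proof -
  have "vdim BP = card (carrier G) * vdim R"
    using vdim_part[OF subset_refl d] by (simp add: vdim_def carrier_biproduct part_carrier)
  moreover have "vdim (BP\<lparr>carrier := part X\<rparr>) = card X * vdim R"
    using vdim_part[OF X(1) d] by (simp add: vdim_def)
  ultimately show ?thesis using d by (simp add: hopf_index_def)
qed

section \<open>Subgroups containing the support\<close>

context
  fixes T :: "'g set"
  assumes T: "subgroup T G"
    and supp: "\<And>z a. z \<in> carrier G \<Longrightarrow> z \<notin> T \<Longrightarrow> a \<in> carrier R \<Longrightarrow> pr z a = 0"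
begin

lemma T_sub: "T \<subseteq> carrier G"
  using T by (rule subgroup.subset)

lemma T_mem: "g \<in> T \<Longrightarrow> g \<in> carrier G"
  using T_sub by blast

abbreviation KT where "KT \<equiv> tensor R (group_algebra (G\<lparr>carrier := T\<rparr>))"

lemma zero_part: "0 \<in> part T"
  unfolding part_space[OF T_sub] by (rule zero_mem) simp

lemma sum_part: "(\<And>i. i \<in> I \<Longrightarrow> f i \<in> part T) \<Longrightarrow> (\<Sum>i\<in>I. f i) \<in> part T"
  unfolding part_space[OF T_sub] by (rule sum_mem) simp_all

lemma part_mult:
  assumes u: "u \<in> part T" and v: "v \<in> part T"
  shows "u \<bullet>\<^bsub>BP\<^esub> v \<in> part T"
proof -
  note uv = part_mem[OF T_sub u] part_mem[OF T_sub v]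
  have "E (cmp g u \<cdot> act R g (cmp h v)) (g \<otimes> h) \<in> part T" if "g \<in> carrier G" "h \<in> carrier G" for g h
  proof (cases "g \<in> T \<and> h \<in> T")
    case True
    then show ?thesis using that uv by (intro E_mem_part[OF T_sub]) (simp_all add: subgroup.m_closed[OF T])
  next
    case False
    then have "cmp g u \<cdot> act R g (cmp h v) = 0"
      using that uv cmp_part[OF T_sub u] cmp_part[OF T_sub v] by auto
    then show ?thesis by (simp add: E_lin zero_part)
  qed
  then show ?thesis unfolding biproduct_mult[OF uv] by (intro sum_part)
qed

text \<open>Membership in the tensor square of the subspace can be checked termwise, because
  \<open>tens\<close> is insensitive to the carriers. A term with z outside T is zero by
  \<open>supp\<close>; for z and g in T both group parts zg and g are in T.\<close>

lemma part_comult: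
  assumes u: "u \<in> part T"
  shows "comult BP u \<in> carrier (tensor (BP\<lparr>carrier := part T\<rparr>) (BP\<lparr>carrier := part T\<rparr>))"
proof -
  let ?P = "BP\<lparr>carrier := part T\<rparr>"
  have P: "tensor ?P ?P = tensor KT KT"
    by (rule tensor_cong) (simp_all add: part_space[OF T_sub])
  have tens_P: "tens HH HH = tens KT KT"
    by (rule tens_cong) simp_all
  have "comultE (cmp g u) g \<in> carrier (tensor KT KT)" if g: "g \<in> carrier G" for g
  proof (cases "g \<in> T")
    case True
    have "tens HH HH (E x (z \<otimes> g)) (E (pr z y) g) \<in> carrier (tensor KT KT)"
      if "x \<in> carrier R" "y \<in> carrier R" "z \<in> carrier G" for x y z
    proof (cases "z \<in> T")
      case zT: True
      then show ?thesis
        unfolding tens_P using that True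
        by (intro tens_mem; fold part_space[OF T_sub])
           (simp_all add: E_mem_part[OF T_sub] subgroup.m_closed[OF T])
    next
      case False
      then show ?thesis
        using that by (simp add: supp E_lin tens_zero_right zero_mem[OF is_vspace_tensor])
    qed
    then show ?thesis
      unfolding comultE_def by (intro tsum_mem[OF is_vspace_tensor] sum_mem[OF is_vspace_tensor])
  next
    case False
    then have "comultE (cmp g u) g = 0"
      using linear_map_zero[OF is_vspace_R linear_map_comultE[OF g]] by (simp add: cmp_part[OF T_sub u])
    then show ?thesis by (simp add: zero_mem[OF is_vspace_tensor])
  qed
  then show ?thesis
    unfolding P biproduct_comult[OF part_mem[OF T_sub u]] by (intro sum_mem[OF is_vspace_tensor])
qed

lemma antipodeB_part:
  assumes u: "u \<in> part T"
  shows "antipodeB u \<in> part T"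
proof -
  have "antipodeE (cmp g u) g \<in> part T" if g: "g \<in> carrier G" for g
  proof (cases "g \<in> T")
    case True
    have "E (act R (inv (z \<otimes> g)) (SR (pr z (cmp g u)))) (inv (z \<otimes> g)) \<in> part T" if z: "z \<in> carrier G" for z
    proof (cases "z \<in> T")
      case zT: True
      then show ?thesis
        using True z g part_mem[OF T_sub u]
        by (intro E_mem_part[OF T_sub]) (simp_all add: subgroup.m_closed[OF T] subgroup.m_inv_closed[OF T])
    next
      case False
      then show ?thesis
        using z g part_mem[OF T_sub u] by (simp add: supp SR_lin E_lin zero_part)
    qed
    then show ?thesis unfolding antipodeE_def by (intro sum_part)
  next
    case False
    then show ?thesis using g by (simp add: cmp_part[OF T_sub u] antipodeE_lin zero_part)
  qed
  then show ?thesis unfolding antipodeB_def by (intro sum_part)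
qed

lemma hopf_subalgebra_part: "hopf_subalgebra (part T) BP"
  unfolding hopf_subalgebra_def
  using hopf_algebra_biproduct subspace_part[OF T_sub] part_mem[OF T_sub] part_mult part_comult antipodeB_part
    E_mem_part[OF T_sub unit_mem subgroup.one_closed[OF T]]
  by (auto simp: carrier_biproduct biproduct_unit antipode_biproduct)

lemma normal_part:
  assumes normal: "\<And>g t. g \<in> carrier G \<Longrightarrow> t \<in> T \<Longrightarrow> g \<otimes> t \<otimes> inv g \<in> T"
  shows "normal_hopf_subalgebra (part T) BP"
proof -
  \<comment> \<open>The antipode of \<open>pr z y # g\<close> is a single generator over (zg)^-1, so
    the adjoint action of a generator is a sum of products of this shape, with zg in place of
    g.\<close>
  have conj: "E x g \<bullet>\<^bsub>BP\<^esub> k \<bullet>\<^bsub>BP\<^esub> E y (inv g) \<in> part T"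
    if x: "x \<in> carrier R" and y: "y \<in> carrier R" and g: "g \<in> carrier G" and k: "k \<in> part T" for x y g k
  proof -
    have lin: "linear_map HH HH (\<lambda>k. E x g \<bullet>\<^bsub>BP\<^esub> k \<bullet>\<^bsub>BP\<^esub> E y (inv g))"
      by (rule linear_mapI) (simp_all add: x y g BP_lin)
    have kH: "cmp t k \<in> carrier R" for t using part_mem[OF T_sub k] by simp
    have "E x g \<bullet>\<^bsub>BP\<^esub> k \<bullet>\<^bsub>BP\<^esub> E y (inv g) = E x g \<bullet>\<^bsub>BP\<^esub> (\<Sum>t\<in>T. E (cmp t k) t) \<bullet>\<^bsub>BP\<^esub> E y (inv g)"
      using part_expand[OF T_sub k] by simp
    also have "\<dots> = (\<Sum>t\<in>T. E x g \<bullet>\<^bsub>BP\<^esub> E (cmp t k) t \<bullet>\<^bsub>BP\<^esub> E y (inv g))"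
      by (rule linear_map_sum[OF is_vspace_tensor lin]) (simp add: kH T_mem)
    also have "\<dots> = (\<Sum>t\<in>T. E (x \<cdot> act R g (cmp t k) \<cdot> act R (g \<otimes> t) y) (g \<otimes> t \<otimes> inv g))"
      by (intro sum.cong refl) (simp add: biproduct_mult_E x y g kH T_mem)
    also have "\<dots> \<in> part T"
      by (intro sum_part E_mem_part[OF T_sub] normal) (simp_all add: x y g kH T_mem)
    finally show ?thesis .
  qed
  have "tlift BP BP (\<lambda>h\<^sub>1 h\<^sub>2. h\<^sub>1 \<bullet>\<^bsub>BP\<^esub> k \<bullet>\<^bsub>BP\<^esub> antipode BP h\<^sub>2) (comult BP h) \<in> part T"
    if h: "h \<in> carrier HH" and k: "k \<in> part T" for h k
  proof -
    note kH = part_mem[OF T_sub k]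
    have bil: "bilinear_map HH HH HH (\<lambda>h\<^sub>1 h\<^sub>2. h\<^sub>1 \<bullet>\<^bsub>BP\<^esub> k \<bullet>\<^bsub>BP\<^esub> antipodeB h\<^sub>2)"
      by (rule bilinear_mapI) (simp_all add: BP_lin antipodeB_lin kH)
    note L = linear_map_tlift[OF is_vspace_tensor is_vspace_tensor is_vspace_tensor bil]
    have "tlift BP BP (\<lambda>h\<^sub>1 h\<^sub>2. h\<^sub>1 \<bullet>\<^bsub>BP\<^esub> k \<bullet>\<^bsub>BP\<^esub> antipode BP h\<^sub>2) (comult BP h) =
      tlift HH HH (\<lambda>h\<^sub>1 h\<^sub>2. h\<^sub>1 \<bullet>\<^bsub>BP\<^esub> k \<bullet>\<^bsub>BP\<^esub> antipodeB h\<^sub>2) (comult BP h)"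
      unfolding tlift_BP by (intro tlift_cong refl) (simp add: antipode_biproduct)
    also have "\<dots> = (\<Sum>g\<in>carrier G. tlift HH HH (\<lambda>h\<^sub>1 h\<^sub>2. h\<^sub>1 \<bullet>\<^bsub>BP\<^esub> k \<bullet>\<^bsub>BP\<^esub> antipodeB h\<^sub>2) (comultE (cmp g h) g))"
      unfolding biproduct_comult[OF h] by (rule linear_map_sum[OF is_vspace_tensor L]) (simp add: h)
    also have "\<dots> = (\<Sum>g\<in>carrier G. sw (\<lambda>x y. \<Sum>z\<in>carrier G.
        E x (z \<otimes> g) \<bullet>\<^bsub>BP\<^esub> k \<bullet>\<^bsub>BP\<^esub> antipodeB (E (pr z y) g)) (cmp g h))"
      by (intro sum.cong refl tlift_comultE[OF is_vspace_tensor bil]) (simp_all add: h)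
    also have "\<dots> = (\<Sum>g\<in>carrier G. sw (\<lambda>x y. \<Sum>z\<in>carrier G.
        E x (z \<otimes> g) \<bullet>\<^bsub>BP\<^esub> k \<bullet>\<^bsub>BP\<^esub> E (act R (inv (z \<otimes> g)) (SR (pr z y))) (inv (z \<otimes> g))) (cmp g h))"
      by (intro sum.cong tsum_cong refl) (simp add: antipodeB_E antipodeE_pr)
    also have "\<dots> \<in> part T"
    proof (rule sum_part)
      fix g assume g: "g \<in> carrier G"
      show "sw (\<lambda>x y. \<Sum>z\<in>carrier G.
        E x (z \<otimes> g) \<bullet>\<^bsub>BP\<^esub> k \<bullet>\<^bsub>BP\<^esub> E (act R (inv (z \<otimes> g)) (SR (pr z y))) (inv (z \<otimes> g))) (cmp g h) \<in> part T"
        unfolding part_space[OF T_sub]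
        by (rule tsum_mem[OF is_vspace_tensor], fold part_space[OF T_sub], rule sum_part, rule conj)
           (simp_all add: g k)
    qed
    finally show ?thesis .
  qed
  then show ?thesis
    unfolding normal_hopf_subalgebra_def carrier_biproduct using hopf_subalgebra_part by blast
qed

end

end

section \<open>The support\<close>

text \<open>
  If \<open>x v \<noteq> 0\<close> for an element \<open>v\<close> of a simple left ideal \<open>L\<close>, then \<open>L = A x v\<close>, so \<open>v = a x v\<close> and
  \<open>x v = x a x v = 0\<close>.
\<close>

lemma semisimple_semiprime:
  fixes A :: "('k::field, 'v::ab_group_add, 'm) bialg_scheme"
  assumes ss: "semisimple_algebra A" and x: "x \<in> carrier A"
    and zero: "\<And>a. a \<in> carrier A \<Longrightarrow> x \<bullet>\<^bsub>A\<^esub> (a \<bullet>\<^bsub>A\<^esub> x) = 0"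
  shows "x = 0"
proof -
  have alg: "unital_algebra A" using ss by (simp add: semisimple_algebra_def)
  then have V: "is_vspace A" by (simp add: unital_algebra_def)
  interpret V: vector_space "scl A" using V by (simp add: is_vspace_def)
  have mul: "bilinear_map A A A (amult A)" and unit: "aunit A \<in> carrier A"
    and assoc: "\<And>x y z. x \<in> carrier A \<Longrightarrow> y \<in> carrier A \<Longrightarrow> z \<in> carrier A \<Longrightarrow>
      (x \<bullet>\<^bsub>A\<^esub> y) \<bullet>\<^bsub>A\<^esub> z = x \<bullet>\<^bsub>A\<^esub> (y \<bullet>\<^bsub>A\<^esub> z)"
    and one: "\<And>x. x \<in> carrier A \<Longrightarrow> aunit A \<bullet>\<^bsub>A\<^esub> x = x" "\<And>x. x \<in> carrier A \<Longrightarrow> x \<bullet>\<^bsub>A\<^esub> aunit A = x"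
    using alg by (auto simp: unital_algebra_def)
  note mulL = bilinear_map_linear(1)[OF mul] and mulR = bilinear_map_linear(2)[OF mul]
  note mem = linear_map_mem[OF mulL]
  obtain M where "(\<forall>L\<in>M. simple_left_ideal A L) \<and> V.span (\<Union>M) = carrier A \<and>
      (\<forall>L\<in>M. L \<inter> V.span (\<Union>(M - {L})) = {0})"
    using ss[unfolded semisimple_algebra_def, THEN conjunct2] by (rule exE)
  then have M: "\<And>L. L \<in> M \<Longrightarrow> simple_left_ideal A L" "V.span (\<Union>M) = carrier A" by simp_all
  have kill: "x \<bullet>\<^bsub>A\<^esub> v = 0" if L: "L \<in> M" and v: "v \<in> L" for L v
  proof (rule ccontr)
    assume nz: "x \<bullet>\<^bsub>A\<^esub> v \<noteq> 0"
    have simple: "left_ideal A L" "\<And>L'. left_ideal A L' \<Longrightarrow> L' \<subseteq> L \<Longrightarrow> L' = {0} \<or> L' = L"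
      using M(1)[OF L] unfolding simple_left_ideal_def by blast+
    have Lsub: "L \<subseteq> carrier A" and Lmul: "\<And>a y. a \<in> carrier A \<Longrightarrow> y \<in> L \<Longrightarrow> a \<bullet>\<^bsub>A\<^esub> y \<in> L"
      using simple(1) unfolding left_ideal_def by blast+
    have vA: "v \<in> carrier A" using v Lsub by blast
    define w where "w = x \<bullet>\<^bsub>A\<^esub> v"
    have w: "w \<in> L" "w \<in> carrier A" unfolding w_def using Lmul[OF x v] mem[OF x vA] by auto
    define L' where "L' = (\<lambda>a. a \<bullet>\<^bsub>A\<^esub> w) ` carrier A"
    have "left_ideal A L'"
      unfolding left_ideal_def
    proof (intro conjI ballI)
      show "V.subspace L'"
      proof (rule V.subspaceI)
        show "0 \<in> L'" unfolding L'_def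
          using linear_map_zero[OF V mulR[OF w(2)]] zero_mem[OF V] by (intro image_eqI[of _ _ 0]) simp_all
        fix y z c assume "y \<in> L'"
        then obtain a where a: "a \<in> carrier A" "y = a \<bullet>\<^bsub>A\<^esub> w" unfolding L'_def by blast
        show "scl A c y \<in> L'" unfolding L'_def
          using a linear_map_scl[OF mulR[OF w(2)] a(1)] scl_mem[OF V a(1)]
          by (intro image_eqI[of _ _ "scl A c a"]) simp_all
        assume "z \<in> L'"
        then obtain b where b: "b \<in> carrier A" "z = b \<bullet>\<^bsub>A\<^esub> w" unfolding L'_def by blast
        show "y + z \<in> L'" unfolding L'_def
          using a b linear_map_add[OF mulR[OF w(2)] a(1) b(1)] add_mem[OF V a(1) b(1)]
          by (intro image_eqI[of _ _ "a + b"]) simp_all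
      qed
      show "L' \<subseteq> carrier A" unfolding L'_def using mem w(2) by auto
      fix a y assume a: "a \<in> carrier A" and "y \<in> L'"
      then obtain b where b: "b \<in> carrier A" "y = b \<bullet>\<^bsub>A\<^esub> w" unfolding L'_def by blast
      show "a \<bullet>\<^bsub>A\<^esub> y \<in> L'" unfolding L'_def
        using a b w(2) assoc mem by (intro image_eqI[of _ _ "a \<bullet>\<^bsub>A\<^esub> b"]) simp_all
    qed
    moreover have "L' \<subseteq> L" unfolding L'_def using Lmul w(1) by auto
    moreover have "w \<in> L'" unfolding L'_def using one(1)[OF w(2)] unit by (intro image_eqI[of _ _ "aunit A"]) simp_all
    ultimately have "L' = L" using simple(2) nz unfolding w_def by blast
    then obtain a where a: "a \<in> carrier A" "v = a \<bullet>\<^bsub>A\<^esub> w"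
      using v unfolding L'_def by blast
    have "x \<bullet>\<^bsub>A\<^esub> v = (x \<bullet>\<^bsub>A\<^esub> (a \<bullet>\<^bsub>A\<^esub> x)) \<bullet>\<^bsub>A\<^esub> v"
      by (subst a(2)) (simp add: w_def assoc mem x a(1) vA)
    also have "\<dots> = 0"
      using zero[OF a(1)] linear_map_zero[OF V mulR[OF vA]] by simp
    finally show False using nz by simp
  qed
  \<comment> \<open>The simple left ideals span A, so left multiplication by x annihilates all of A,
    and in particular the unit.\<close>
  have "v \<in> carrier A \<and> x \<bullet>\<^bsub>A\<^esub> v = 0" if "v \<in> V.span (\<Union>M)" for v
    using that
  proof (induction rule: V.span_induct_alt)
    case base
    show ?case using linear_map_zero[OF V mulL[OF x]] zero_mem[OF V] by simp
  next
    case (step c y z)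
    obtain L where "L \<in> M" "y \<in> L" using step(1) by blast
    then have y: "y \<in> carrier A" "x \<bullet>\<^bsub>A\<^esub> y = 0"
      using kill[of L y] M(2) V.span_base[of y "\<Union>M"] by auto
    show ?case
      using step(2) y linear_map_add[OF mulL[OF x], of "scl A c y" z] linear_map_scl[OF mulL[OF x], of y c]
      by (simp add: scl_mem[OF V] add_mem[OF V])
  qed
  then have "x \<bullet>\<^bsub>A\<^esub> aunit A = 0" using unit M(2) by blast
  then show ?thesis using one(2)[OF x] by simp
qed

section \<open>Homogeneous elements and conjugation of the support\<close>

context braided_hopf
begin

lemma homogeneous_iff: "g \<in> carrier G \<Longrightarrow> r \<in> homogeneous G R g \<longleftrightarrow> r \<in> carrier R \<and> pr g r = r"
proof -
  assume g: "g \<in> carrier G"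
  have "pr g r = r" if "r \<in> carrier R" "\<rho> r = tens kG R (gel g) r"
    unfolding pr_def that(2) using g that(1)
    by (simp add: lcoord_tens) (simp add: gel_apply scl_one[OF is_vspace_R])
  moreover have "\<rho> r = tens kG R (gel g) r" if "r \<in> carrier R" "pr g r = r"
    using coact_pr[OF g that(1)] that(2) by simp
  ultimately show ?thesis by (auto simp: homogeneous_def)
qed

lemma Supp_iff: "g \<in> Supp G R \<longleftrightarrow> g \<in> carrier G \<and> (\<exists>a\<in>carrier R. pr g a = a \<and> a \<noteq> 0)"
proof -
  have "homogeneous G R g \<noteq> {0} \<longleftrightarrow> (\<exists>a\<in>carrier R. pr g a = a \<and> a \<noteq> 0)" if "g \<in> carrier G"
    using homogeneous_iff[OF that, of 0] homogeneous_iff[OF that] by auto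
  then show ?thesis by (auto simp: Supp_def)
qed

text \<open>\<open>pr z a\<close> is itself homogeneous of degree z and would put z into the support
  if it were nonzero.\<close>

lemma pr_not_Supp: "z \<in> carrier G \<Longrightarrow> z \<notin> Supp G R \<Longrightarrow> a \<in> carrier R \<Longrightarrow> pr z a = 0"
  using Supp_iff[of z] pr_pr[of z a z] by auto

text \<open>The action of g is invertible, so a nonzero element of degree s stays nonzero while its
  degree is conjugated by g.\<close>

lemma Supp_conj:
  assumes "g \<in> carrier G" "s \<in> Supp G R"
  shows "g \<otimes> s \<otimes> inv g \<in> Supp G R"
proof -
  obtain a where a: "s \<in> carrier G" "a \<in> carrier R" "pr s a = a" "a \<noteq> 0" using assms(2) Supp_iff by blast
  have "act R (inv g) (act R g a) = a" using assms(1) a by (simp add: act_act)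
  then have "act R g a \<noteq> 0" using a(4) assms(1) by auto
  then show ?thesis
    using pr_act[OF assms(1) a(1,2)] a assms(1) by (auto simp: Supp_iff intro!: bexI[of _ "act R g a"])
qed

context
  fixes I :: "'g set" and x :: "'g \<Rightarrow> 'v"
  assumes I: "I \<subseteq> carrier G"
    and x: "\<And>i. i \<in> I \<Longrightarrow> x i \<in> carrier R" "\<And>i. i \<in> I \<Longrightarrow> pr i (x i) = x i" "\<And>i. i \<in> I \<Longrightarrow> x i \<noteq> 0"
begin

lemma pr_homogeneous: "i \<in> I \<Longrightarrow> pr j (x i) = (if j = i then x i else 0)"
  using pr_pr[of i "x i" j] x(1,2)[of i] I by auto

lemma homogeneous_inj: "inj_on x I"
proof (rule inj_onI)
  fix i j assume "i \<in> I" "j \<in> I" "x i = x j"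
  then show "i = j" using pr_homogeneous[of i i] pr_homogeneous[of j i] x(3)[of i] by (auto split: if_splits)
qed

text \<open>Applying \<open>pr h\<close> to a linear relation isolates the term of degree h, as the
  degrees in the family are distinct.\<close>

lemma homogeneous_independent: "\<not> module.dependent (scl R) (x ` I)"
proof -
  interpret V: vector_space "scl R" using is_vspace_R by (simp add: is_vspace_def)
  have fI: "finite I" using I fin by (rule finite_subset)
  have "f (x h) = 0" if sum: "(\<Sum>v\<in>x ` I. scl R (f v) v) = 0" and h: "h \<in> I" for f h
  proof -
    have "0 = pr h (\<Sum>i\<in>I. scl R (f (x i)) (x i))"
      using sum by (simp add: sum.reindex[OF homogeneous_inj])
    also have "\<dots> = (\<Sum>i\<in>I. pr h (scl R (f (x i)) (x i)))"
      by (rule linear_map_sum[OF is_vspace_R linear_map_pr]) (simp add: x)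
    also have "\<dots> = (\<Sum>i\<in>I. if i = h then scl R (f (x i)) (x i) else 0)"
      by (intro sum.cong) (auto simp: lin x pr_homogeneous scl_zero_right[OF is_vspace_R])
    also have "\<dots> = scl R (f (x h)) (x h)" using h fI by simp
    finally show ?thesis using x(3)[OF h] by simp
  qed
  then show ?thesis
    unfolding V.dependent_finite[OF finite_imageI[OF fI]] by blast
qed

text \<open>An element outside the span would enlarge the independent family to an independent set
  with more members than a basis of R.\<close>

lemma homogeneous_span:
  assumes "card I \<ge> vdim R" "vdim R > 0"
  shows "carrier R \<subseteq> module.span (scl R) (x ` I)"
proof
  interpret V: vector_space "scl R" using is_vspace_R by (simp add: is_vspace_def)
  fix a assume a: "a \<in> carrier R"
  obtain B where B: "B \<subseteq> carrier R" "V.independent B" "carrier R \<subseteq> V.span B" "card B = vdim R"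
    unfolding vdim_def by (rule V.basis_exists[of "carrier R"])
  then have fB: "finite B" using assms(2) by (intro card_ge_0_finite) simp
  show "a \<in> V.span (x ` I)"
  proof (rule ccontr)
    assume na: "a \<notin> V.span (x ` I)"
    then have "V.independent (insert a (x ` I))"
      using homogeneous_independent by (rule V.independent_insertI)
    moreover have "insert a (x ` I) \<subseteq> V.span B" using a x(1) B(3) by blast
    ultimately have "card (insert a (x ` I)) \<le> card B"
      by (rule V.independent_span_bound[OF fB, THEN conjunct2])
    moreover have "finite I" using I fin by (rule finite_subset)
    moreover have "a \<notin> x ` I" using na V.span_base by auto
    ultimately show False
      using assms(1) B(4) by (simp add: card_image[OF homogeneous_inj])
  qed
qed

end

end

section \<open>Reflections in dihedral groups of odd degree\<close>

text \<open>Conjugation by the rotation r^k sends r^i s to r^(i+2k) s, so it suffices to solve 2 k =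
  j - i modulo n.\<close>

lemma reflections_conjugate:
  assumes n: "n > 0" "odd n" and i: "i \<in> {0..<int n}" and j: "j \<in> {0..<int n}"
  shows "\<exists>g\<in>carrier (dihedral_group n).
    g \<otimes>\<^bsub>dihedral_group n\<^esub> (i, True) \<otimes>\<^bsub>dihedral_group n\<^esub> inv\<^bsub>dihedral_group n\<^esub> g = (j, True)"
proof -
  interpret group "dihedral_group n" by (rule group_dihedral_group[OF n(1)])
  obtain m where m: "int n = 2 * m + 1" using n(2) by (auto elim!: oddE)
  \<comment> \<open>For n = 2 m + 1 the inverse of 2 modulo n is m + 1.\<close>
  define k where "k = ((j - i) * (m + 1)) mod int n"
  have k: "(k, False) \<in> carrier (dihedral_group n)" using n(1) by (simp add: dihedral_group_def k_def)
  have "((- k) mod int n, False) \<otimes>\<^bsub>dihedral_group n\<^esub> (k, False) = \<one>\<^bsub>dihedral_group n\<^esub>"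
    by (simp add: dihedral_group_def mod_simps)
  then have inv: "inv\<^bsub>dihedral_group n\<^esub> (k, False) = ((- k) mod int n, False)"
    using k n(1) by (intro inv_equality) (auto simp: dihedral_group_def)
  have "(k + i - - k) mod int n = (2 * k + i) mod int n" by (simp add: algebra_simps)
  also have "\<dots> = (2 * ((j - i) * (m + 1)) + i) mod int n"
    unfolding k_def by (rule mod_add_cong[OF mod_mult_right_eq refl])
  \<comment> \<open>As 2 (m + 1) = n + 1, the exponent differs from j by a multiple of n.\<close>
  also have "2 * ((j - i) * (m + 1)) + i = j + (j - i) * int n"
    by (simp add: m algebra_simps)
  also have "(j + (j - i) * int n) mod int n = j" using j by simp
  finally have "(k, False) \<otimes>\<^bsub>dihedral_group n\<^esub> (i, True) \<otimes>\<^bsub>dihedral_group n\<^esub> inv\<^bsub>dihedral_group n\<^esub> (k, False) = (j, True)"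
    unfolding inv by (simp add: dihedral_group_def mod_simps)
  then show ?thesis using k by blast
qed

lemma dihedral_support:
  fixes R :: "('k::field, 'v::ab_group_add, int \<times> bool, 'm) braided_scheme"
  assumes n: "n \<ge> 3" "odd n" and braided: "braided_hopf_algebra (dihedral_group n) R"
    and ss: "semisimple_algebra R" and dim: "vdim R = n + 1"
  shows "Supp (dihedral_group n) R \<subseteq> rotations n"
proof (rule ccontr)
  let ?D = "dihedral_group n"
  interpret braided_hopf ?D R by unfold_locales (rule braided)
  interpret V: vector_space "scl R" using is_vspace_R by (simp add: is_vspace_def)
  have n0: "n > 0" using n by simp
  define Refl where "Refl = {0..<int n} \<times> {True}"
  have carrier_D: "carrier ?D = {0..<int n} \<times> UNIV" and one_D: "\<one>\<^bsub>?D\<^esub> = (0, False)"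
    by (simp_all add: dihedral_group_def)
  assume "\<not> Supp ?D R \<subseteq> rotations n"
  then obtain i b where ib: "(i, b) \<in> Supp ?D R" "(i, b) \<notin> rotations n" by auto
  then have "(i, b) \<in> carrier ?D" by (simp add: Supp_def)
  with ib have i: "i \<in> {0..<int n}" "(i, True) \<in> Supp ?D R"
    by (cases b; auto simp: carrier_D rotations_def)+
  have "t \<in> Supp ?D R" if t: "t \<in> Refl" for t
  proof -
    have "fst t \<in> {0..<int n}" and t_eq: "t = (fst t, True)" using t by (auto simp: Refl_def)
    from reflections_conjugate[OF n0 n(2) i(1) this(1)] obtain g where g: "g \<in> carrier ?D"
      "g \<otimes>\<^bsub>?D\<^esub> (i, True) \<otimes>\<^bsub>?D\<^esub> inv\<^bsub>?D\<^esub> g = t" unfolding t_eq[symmetric] by (rule bexE)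
    show ?thesis using Supp_conj[OF g(1) i(2)] unfolding g(2) .
  qed
  then have "\<forall>t\<in>Refl. \<exists>a. a \<in> carrier R \<and> pr t a = a \<and> a \<noteq> 0" unfolding Supp_iff by blast
  from bchoice[OF this] obtain y where y: "\<And>t. t \<in> Refl \<Longrightarrow> y t \<in> carrier R \<and> pr t (y t) = y t \<and> y t \<noteq> 0"
    by blast
  \<comment> \<open>The counit takes the value 1 at e and 0 at 0.\<close>
  have e_nz: "e \<noteq> 0"
    using counit_unit zero_simps(3) by force
  \<comment> \<open>These are n + 1 distinct degrees, each with a nonzero homogeneous element, and n
    + 1 is the dimension of R.\<close>
  define I where "I = insert \<one>\<^bsub>?D\<^esub> Refl"
  define x where "x = (\<lambda>t. if t = \<one>\<^bsub>?D\<^esub> then e else y t)"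
  have one_Refl: "\<one>\<^bsub>?D\<^esub> \<notin> Refl" by (simp add: one_D Refl_def)
  have I: "I \<subseteq> carrier ?D" using n0 by (auto simp: I_def Refl_def carrier_D one_D)
  have x: "x t \<in> carrier R" "pr t (x t) = x t" "x t \<noteq> 0" if "t \<in> I" for t
    using that y[of t] e_nz pr_unit[OF one_closed] by (auto simp: I_def x_def)
  have x_one: "x \<one>\<^bsub>?D\<^esub> = e" by (simp add: x_def)
  have "card I = n + 1"
    using one_Refl by (simp add: I_def Refl_def card_cartesian_product)
  then have span: "carrier R \<subseteq> V.span (x ` I)"
    using homogeneous_span[OF I x] dim by simp
  note pr_x = pr_homogeneous[OF I x]
  \<comment> \<open>Each homogeneous component is at most a line: it is spanned by
    \<open>x z\<close> for z in \<open>I\<close> and is zero for other z.\<close>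
  have pr_line: "pr z a \<in> V.span (if z \<in> I then {x z} else {})" if "a \<in> carrier R" for z a
  proof -
    have "a \<in> V.span (x ` I)" using that span by blast
    then have "a \<in> carrier R \<and> pr z a \<in> V.span (if z \<in> I then {x z} else {})"
    proof (induction rule: V.span_induct_alt)
      case base
      show ?case by (simp add: V.span_zero)
    next
      case (step c v w)
      then obtain t where t: "t \<in> I" "v = x t" by blast
      have "pr z v \<in> V.span (if z \<in> I then {x z} else {})"
        using t by (auto simp: pr_x V.span_zero intro: V.span_base)
      then show ?case
        using step t x(1) by (simp add: lin V.span_add V.span_scale)
    qed
    then show ?thesis by simp
  qed
  have mul_x: "x t \<cdot> x u \<in> V.span (if t \<otimes>\<^bsub>?D\<^esub> u \<in> I then {x (t \<otimes>\<^bsub>?D\<^esub> u)} else {})"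
    if t: "t \<in> I" and u: "u \<in> I" for t u
  proof -
    have tu: "t \<in> carrier ?D" "u \<in> carrier ?D" using I t u by auto
    have "pr (t \<otimes>\<^bsub>?D\<^esub> u) (x t \<cdot> x u) = x t \<cdot> x u"
      using pr_pr_mul[OF x(1)[OF t] x(1)[OF u] m_closed[OF tu] tu(1)] x(2)[OF t] x(2)[OF u] tu by simp
    then show ?thesis using pr_line[of "x t \<cdot> x u" "t \<otimes>\<^bsub>?D\<^esub> u"] x(1) t u by simp
  qed
  have orth: "x t \<cdot> x u = 0" if t: "t \<in> Refl" and u: "u \<in> Refl" and "t \<noteq> u" for t u
  proof -
    \<comment> \<open>The product of two distinct reflections is a nontrivial rotation, hence
      neither 1 nor a reflection.\<close>
    have "t \<otimes>\<^bsub>?D\<^esub> u \<notin> I"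
    proof
      assume "t \<otimes>\<^bsub>?D\<^esub> u \<in> I"
      then have "(fst t - fst u) mod int n = 0"
        using t u by (auto simp: I_def Refl_def dihedral_group_def)
      then have "fst t mod int n = fst u mod int n" by (simp add: mod_eq_dvd_iff dvd_eq_mod_eq_0)
      then show False using t u \<open>t \<noteq> u\<close> by (auto simp: Refl_def)
    qed
    then show ?thesis using mul_x[of t u] t u by (auto simp: I_def)
  qed
  have sq: "x t \<cdot> x t = 0" if t: "t \<in> Refl" for t
  proof -
    have tI: "t \<in> I" using t by (simp add: I_def)
    have "t \<otimes>\<^bsub>?D\<^esub> t = \<one>\<^bsub>?D\<^esub>" using t by (auto simp: Refl_def dihedral_group_def)
    then obtain c where c: "x t \<cdot> x t = scl R c e"
      using mul_x[OF tI tI] by (auto simp: I_def x_one V.span_singleton)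
    \<comment> \<open>A second reflection exists because n > 1: \<open>(1, True)\<close> if t is
      \<open>(0, True)\<close>, and \<open>(0, True)\<close> otherwise.\<close>
    obtain u where u: "u \<in> Refl" "u \<noteq> t"
    proof (cases "fst t = 0")
      case True
      then show ?thesis using that[of "(1, True)"] n by (cases t) (auto simp: Refl_def)
    next
      case False
      then show ?thesis using that[of "(0, True)"] n by (cases t) (auto simp: Refl_def)
    qed
    have uI: "u \<in> I" using u by (simp add: I_def)
    have "scl R c (x u) = (x t \<cdot> x t) \<cdot> x u" by (simp add: c lin x(1) uI)
    also have "\<dots> = 0" using orth[OF t u(1)] u(2) tI uI by (simp add: mul_assoc x(1))
    finally have "c = 0" using x(3)[OF uI] by simp
    then show ?thesis by (simp add: c)
  qed
  have t0: "(0, True) \<in> Refl" using n0 by (simp add: Refl_def)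
  then have t0I: "(0, True) \<in> I" by (simp add: I_def)
  let ?x = "x (0, True)"
  have "?x \<cdot> (a \<cdot> ?x) = 0" if a: "a \<in> carrier R" for a
  proof -
    have "a \<in> V.span (x ` I)" using a span by blast
    then have "a \<in> carrier R \<and> ?x \<cdot> (a \<cdot> ?x) = 0"
    proof (induction rule: V.span_induct_alt)
      case base
      show ?case using x(1)[OF t0I] by simp
    next
      case (step c v w)
      then obtain t where t: "t \<in> I" "v = x t" by blast
      \<comment> \<open>On a spanning element x_t with t a reflection the inner product already
        vanishes; on the unit the claim is that \<open>?x\<close> squares to zero.\<close>
      have "x t \<cdot> ?x = 0" if "t \<in> Refl" using orth sq t0 that by (cases "t = (0, True)") auto
      then have "?x \<cdot> (x t \<cdot> ?x) = 0"
        using t(1) x(1)[OF t0I] sq[OF t0] by (auto simp: I_def x_one)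
      then show ?case
        using step t x(1)[OF t0I] x(1)[OF t(1)] by (simp add: lin)
    qed
    then show ?thesis by simp
  qed
  then have "?x = 0" by (rule semisimple_semiprime[OF ss x(1)[OF t0I]])
  then show False using x(3)[OF t0I] by simp
qed

section \<open>Index and normality of the rotation part\<close>

theorem proposition3p5:
  fixes R :: "('k::{alg_closed_field, field_char_0}, 'v::ab_group_add, int \<times> bool) braided"
    and n :: nat
  assumes "n \<ge> 3" and "odd n"
    and "braided_hopf_algebra (dihedral_group n) R"
    and "semisimple_algebra R"
    and "vdim R = n + 1"
  shows "Supp (dihedral_group n) R \<subseteq> rotations n \<and>
    hopf_subalgebra (biproduct_part R (dihedral_group n) (rotations n))
      (biproduct R (dihedral_group n)) \<and>
    hopf_index (biproduct R (dihedral_group n))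
      (biproduct_part R (dihedral_group n) (rotations n)) = 2 \<and>
    normal_hopf_subalgebra (biproduct_part R (dihedral_group n) (rotations n))
      (biproduct R (dihedral_group n))"
proof -
  let ?D = "dihedral_group n"
  interpret braided_hopf ?D R by unfold_locales (rule assms(3))
  have n0: "n > 0" using assms(1) by simp
  have supp: "Supp ?D R \<subseteq> rotations n"
    by (rule dihedral_support) (use assms in auto)
  have T: "subgroup (rotations n) ?D" by (rule rotations_iso_integer_mod_group(1)[OF n0])
  have zero: "pr z a = 0" if "z \<in> carrier ?D" "z \<notin> rotations n" "a \<in> carrier R" for z a
    using pr_not_Supp[OF that(1) _ that(3)] supp that(2) by blast
  \<comment> \<open>The second component is the sign homomorphism of the dihedral group. The
    rotations are its kernel, which makes them a normal subgroup.\<close>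
  have snd_mult: "snd (g \<otimes>\<^bsub>?D\<^esub> h) = (snd g \<noteq> snd h)" for g h
    by (cases g; cases h) (simp add: dihedral_group_def)
  have normal: "g \<otimes>\<^bsub>?D\<^esub> t \<otimes>\<^bsub>?D\<^esub> inv\<^bsub>?D\<^esub> g \<in> rotations n"
    if g: "g \<in> carrier ?D" and t: "t \<in> rotations n" for g t
  proof -
    have rot: "h \<in> rotations n \<longleftrightarrow> h \<in> carrier ?D \<and> \<not> snd h" for h
      by (cases h) (auto simp: rotations_def dihedral_group_def)
    \<comment> \<open>The identity has trivial sign, so g and its inverse have the same sign and
      conjugation preserves signs.\<close>
    have "snd (g \<otimes>\<^bsub>?D\<^esub> inv\<^bsub>?D\<^esub> g) = False"
      unfolding r_inv[OF g] by (simp add: dihedral_group_def)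
    then have "snd (inv\<^bsub>?D\<^esub> g) = snd g" unfolding snd_mult by simp
    then show ?thesis using g t by (simp add: rot snd_mult)
  qed
  have "hopf_index BP (part (rotations n)) = of_nat (card (carrier ?D)) / of_nat (card (rotations n))"
    by (rule hopf_index_part) (use assms n0 in \<open>auto simp: rotations_def dihedral_group_def\<close>)
  also have "\<dots> = 2"
    using n0 by (simp add: rotations_def dihedral_group_def card_cartesian_product)
  finally show ?thesis
    using supp hopf_subalgebra_part[OF T zero] normal_part[OF T zero normal] by simp
qed

end
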